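(* Let $G$ be a finitely generated group that has a finite-index subgroup isomorphic to a (finitely generated) subgroup of a group of the form $H_1\times\cdots\times H_t$ ($t\ge1$), where each $H_i$ is a free product $\mathbb{Z}^{r_{1}}*\cdots*\mathbb{Z}^{r_{m}}$ of finitely many free abelian groups of finite ranks $r_j\in\mathbb{N}$ ($m\ge1$, with $\mathbb{Z}^0$ the trivial group). Then $W_G\in\mathsf{coN2QCFA}(n,2,\widetilde{\mathbb{C}})$.
   Context: Word problem: if $G=\langle S\mid R\rangle$ with $S$ finite, let $\Sigma=S\sqcup S^{-1}$, let $\phi:\Sigma^*\to G$ be the natural monoid homomorphism, and let $W_G=\{w\in\Sigma^*:\phi(w)=1_G\}$. Membership in the class below does not depend on the finite presentation. A 2QCFA is a two-way deterministic finite automaton augmented with a quantum register, a unit vector in $\mathbb{C}^{|Q|}$ for a finite set $Q$ of quantum basis states. It reads $\#_L w\#_R$ starting at $\#_L$ with classical and quantum (basis) start states. At each step, depending on the classical state and scanned symbol, it either applies a unitary, changes classical state and moves the head by $-1,0,+1$, or performs a projective measurement with respect to a partition of $Q$ whose outcome determines the new classical state and head move. It halts on entering an accepting or rejecting state. Transition amplitudes are the entries of its unitaries. $\mathsf{coN2QCFA}(T,d,\mathbb{A})$ is the class of languages $L$ for which there is a 2QCFA $M$ with $d$ quantum basis states and transition amplitudes in $\mathbb{A}$ such that for every input $w$: - $M$ runs in expected time $O(T(|w|))$; - $\Pr[M\text{ accepts }w]+\Pr[M\text{ rejects }w]=1$; - $w\in L\Rightarrow\Pr[M\text{ accepts }w]=1$;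 - $w\notin L\Rightarrow \Pr[M\text{ rejects }w]>0$. $\widetilde{\mathbb{C}}=\overline{\mathbb{Q}}\cup\{e^{\pi i r}:r\in\overline{\mathbb{Q}}\cap\mathbb{R}\}$, where $\overline{\mathbb{Q}}$ denotes the algebraic numbers. *)

theory Defs
  imports
    "HOL-Algebra.Elementary_Groups"
    "HOL-Algebra.Product_Groups"
    "HOL-Algebra.Generated_Groups"
    "HOL-Probability.SPMF"
    "HOL-Library.Disjoint_Sets"
    "HOL-Library.Landau_Symbols"
    "HOL-Computational_Algebra.Polynomial"
    "Jordan_Normal_Form.Matrix"
    "Jordan_Normal_Form.Schur_Decomposition"
begin

no_notation Finite_Cartesian_Product.vec_nth (infixl \<open>$\<close> 90)

text \<open>
  The free product of a family of groups is the monoid of words over the disjoint union of the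
  carriers, modulo the congruence generated by deleting identity letters and multiplying adjacent
  letters that come from the same factor.
\<close>

abbreviation fp_words :: "'i set \<Rightarrow> ('i \<Rightarrow> ('a, 'b) monoid_scheme) \<Rightarrow> ('i \<times> 'a) list set" where
  "fp_words I H \<equiv> lists (SIGMA i:I. carrier (H i))"

inductive_set fp_rel ::
  "'i set \<Rightarrow> ('i \<Rightarrow> ('a, 'b) monoid_scheme) \<Rightarrow> (('i \<times> 'a) list \<times> ('i \<times> 'a) list) set"
  for I :: "'i set" and H :: "'i \<Rightarrow> ('a, 'b) monoid_scheme" where
  fp_refl: "w \<in> fp_words I H \<Longrightarrow> (w, w) \<in> fp_rel I H"
| fp_sym: "(u, v) \<in> fp_rel I H \<Longrightarrow> (v, u) \<in> fp_rel I H"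
| fp_trans: "(u, v) \<in> fp_rel I H \<Longrightarrow> (v, w) \<in> fp_rel I H \<Longrightarrow> (u, w) \<in> fp_rel I H"
| fp_one: "u \<in> fp_words I H \<Longrightarrow> v \<in> fp_words I H \<Longrightarrow> i \<in> I \<Longrightarrow>
    (u @ [(i, \<one>\<^bsub>H i\<^esub>)] @ v, u @ v) \<in> fp_rel I H"
| fp_mult: "u \<in> fp_words I H \<Longrightarrow> v \<in> fp_words I H \<Longrightarrow> i \<in> I \<Longrightarrow>
    a \<in> carrier (H i) \<Longrightarrow> b \<in> carrier (H i) \<Longrightarrow>
    (u @ [(i, a), (i, b)] @ v, u @ [(i, a \<otimes>\<^bsub>H i\<^esub> b)] @ v) \<in> fp_rel I H"

definition free_product ::
  "'i set \<Rightarrow> ('i \<Rightarrow> ('a, 'b) monoid_scheme) \<Rightarrow> ('i \<times> 'a) list set monoid" where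
  "free_product I H =
    \<lparr>carrier = fp_words I H // fp_rel I H,
     monoid.mult = (\<lambda>A B. \<Union>a\<in>A. \<Union>b\<in>B. fp_rel I H `` {a @ b}),
     one = fp_rel I H `` {[]}\<rparr>"

lemma fp_rel_words:
  assumes "\<And>i. i \<in> I \<Longrightarrow> group (H i)" and "(u, v) \<in> fp_rel I H"
  shows "u \<in> fp_words I H \<and> v \<in> fp_words I H"
  using assms(2)
proof induction
  case (fp_one u v i)
  then have "\<one>\<^bsub>H i\<^esub> \<in> carrier (H i)"
    using assms(1) by (intro monoid.one_closed group.is_monoid)
  with fp_one show ?case by (simp only: append_in_lists_conv) simp
next
  case (fp_mult u v i a b)
  then have "a \<otimes>\<^bsub>H i\<^esub> b \<in> carrier (H i)"
    using assms(1) by (intro monoid.m_closed group.is_monoid)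
  with fp_mult show ?case by (simp only: append_in_lists_conv) simp
qed blast+

lemma equiv_fp_rel:
  assumes "\<And>i. i \<in> I \<Longrightarrow> group (H i)"
  shows "equiv (fp_words I H) (fp_rel I H)"
proof (rule equivI)
  show "fp_rel I H \<subseteq> fp_words I H \<times> fp_words I H"
  proof (rule subrelI, rule SigmaI)
    fix u v assume "(u, v) \<in> fp_rel I H"
    from fp_rel_words[OF assms this] show "u \<in> fp_words I H" "v \<in> fp_words I H" by auto
  qed
  show "refl_on (fp_words I H) (fp_rel I H)" by (rule refl_onI) (rule fp_refl)
  show "sym (fp_rel I H)" by (rule symI) (rule fp_sym)
  show "trans (fp_rel I H)" by (rule transI) (rule fp_trans)
qed

lemma fp_rel_append_left:
  assumes "w \<in> fp_words I H" and "(u, v) \<in> fp_rel I H"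
  shows "(w @ u, w @ v) \<in> fp_rel I H"
  using assms(2)
proof induction
  case (fp_refl u)
  then show ?case using assms(1) by (intro fp_rel.fp_refl) simp
next
  case (fp_one u v i)
  then show ?case using assms(1) fp_rel.fp_one[of "w @ u" I H v i] by simp
next
  case (fp_mult u v i a b)
  then show ?case using assms(1) fp_rel.fp_mult[of "w @ u" I H v i a b] by simp
next
  case (fp_sym u v)
  then show ?case by (rule_tac fp_rel.fp_sym)
next
  case (fp_trans u v x)
  then show ?case by (rule_tac fp_rel.fp_trans)
qed

lemma fp_rel_append_right:
  assumes "w \<in> fp_words I H" and "(u, v) \<in> fp_rel I H"
  shows "(u @ w, v @ w) \<in> fp_rel I H"
  using assms(2)
proof induction
  case (fp_refl u)
  then show ?case using assms(1) by (intro fp_rel.fp_refl) simp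
next
  case (fp_one u v i)
  then show ?case using assms(1) fp_rel.fp_one[of u I H "v @ w" i] by simp
next
  case (fp_mult u v i a b)
  then show ?case using assms(1) fp_rel.fp_mult[of u I H "v @ w" i a b] by simp
next
  case (fp_sym u v)
  then show ?case by (rule_tac fp_rel.fp_sym)
next
  case (fp_trans u v x)
  then show ?case by (rule_tac fp_rel.fp_trans)
qed

lemma fp_rel_append:
  assumes "\<And>i. i \<in> I \<Longrightarrow> group (H i)"
    and "(u, u') \<in> fp_rel I H" and "(v, v') \<in> fp_rel I H"
  shows "(u @ v, u' @ v') \<in> fp_rel I H"
proof (rule fp_trans)
  show "(u @ v, u' @ v) \<in> fp_rel I H"
    using fp_rel_words[OF assms(1) assms(3)] assms(2) by (intro fp_rel_append_right) auto
  show "(u' @ v, u' @ v') \<in> fp_rel I H"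
    using fp_rel_words[OF assms(1) assms(2)] assms(3) by (intro fp_rel_append_left) auto
qed

lemma free_product_mult:
  assumes gr: "\<And>i. i \<in> I \<Longrightarrow> group (H i)"
    and u: "u \<in> fp_words I H" and v: "v \<in> fp_words I H"
  shows "(fp_rel I H `` {u}) \<otimes>\<^bsub>free_product I H\<^esub> (fp_rel I H `` {v}) = fp_rel I H `` {u @ v}"
proof -
  have "congruent2 (fp_rel I H) (fp_rel I H) (\<lambda>a b. fp_rel I H `` {a @ b})"
    by (rule congruent2I', rule equiv_class_eq[OF equiv_fp_rel[OF gr]], assumption)
      (rule fp_rel_append[OF gr])
  from UN_equiv_class2[OF equiv_fp_rel[OF gr] equiv_fp_rel[OF gr] this u v]
  show ?thesis by (simp add: free_product_def)
qed

lemma group_free_product: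
  assumes gr: "\<And>i. i \<in> I \<Longrightarrow> group (H i)"
  shows "group (free_product I H)"
proof -
  let ?F = "free_product I H" and ?W = "fp_words I H"
  let ?c = "\<lambda>w. fp_rel I H `` {w}"
  have car: "carrier ?F = ?c ` ?W" by (auto simp: free_product_def quotient_def)
  have one: "\<one>\<^bsub>?F\<^esub> = ?c []" by (simp add: free_product_def)
  have mult: "?c u \<otimes>\<^bsub>?F\<^esub> ?c v = ?c (u @ v)" if "u \<in> ?W" "v \<in> ?W" for u v
    by (rule free_product_mult[OF gr that])
  have app: "u @ v \<in> ?W" if "u \<in> ?W" "v \<in> ?W" for u v using that by simp
  have inv: "\<exists>u\<in>?W. (u @ w, []) \<in> fp_rel I H" if "w \<in> ?W" for w
    using that
  proof (induction w)
    case Nil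
    then show ?case by (auto intro!: bexI[of _ "[]"] fp_refl)
  next
    case (Cons x w)
    then obtain u where u: "u \<in> ?W" "(u @ w, []) \<in> fp_rel I H" by auto
    obtain i a where x: "x = (i, a)" by (cases x)
    with Cons have i: "i \<in> I" and a: "a \<in> carrier (H i)" and w: "w \<in> ?W" by auto
    interpret Hi: group "H i" using gr[OF i] .
    let ?b = "inv\<^bsub>H i\<^esub> a"
    have "(u @ [(i, ?b), (i, a)] @ w, u @ [(i, ?b \<otimes>\<^bsub>H i\<^esub> a)] @ w) \<in> fp_rel I H"
      using u i a w by (intro fp_mult) auto
    also have "?b \<otimes>\<^bsub>H i\<^esub> a = \<one>\<^bsub>H i\<^esub>" using a by simp
    finally have "(u @ [(i, ?b), (i, a)] @ w, u @ [(i, \<one>\<^bsub>H i\<^esub>)] @ w) \<in> fp_rel I H" .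
    with fp_one[OF u(1) w i] u(2) have "(u @ [(i, ?b), (i, a)] @ w, []) \<in> fp_rel I H"
      by (blast intro: fp_trans)
    then show ?case using u i a x by (intro bexI[of _ "u @ [(i, ?b)]"]) auto
  qed
  show ?thesis
  proof (rule groupI)
    fix x assume "x \<in> carrier ?F"
    then obtain w where w: "w \<in> ?W" "x = ?c w" by (auto simp: car)
    obtain u where u: "u \<in> ?W" "(u @ w, []) \<in> fp_rel I H" using inv[OF w(1)] by auto
    have "?c u \<otimes>\<^bsub>?F\<^esub> x = \<one>\<^bsub>?F\<^esub>"
      using w u equiv_class_eq[OF equiv_fp_rel[OF gr] u(2)] by (simp only: mult one)
    then show "\<exists>y\<in>carrier ?F. y \<otimes>\<^bsub>?F\<^esub> x = \<one>\<^bsub>?F\<^esub>" using u(1) by (auto simp: car)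
  next
    fix x y assume "x \<in> carrier ?F" "y \<in> carrier ?F"
    then obtain u v where uv: "u \<in> ?W" "v \<in> ?W" "x = ?c u" "y = ?c v" by (auto simp: car)
    have "x \<otimes>\<^bsub>?F\<^esub> y = ?c (u @ v)" by (simp only: uv mult)
    then show "x \<otimes>\<^bsub>?F\<^esub> y \<in> carrier ?F" using app[OF uv(1,2)] by (simp only: car image_eqI)
  next
    fix x y z assume "x \<in> carrier ?F" "y \<in> carrier ?F" "z \<in> carrier ?F"
    then obtain u v w where "u \<in> ?W" "v \<in> ?W" "w \<in> ?W" "x = ?c u" "y = ?c v" "z = ?c w"
      by (auto simp: car)
    then show "x \<otimes>\<^bsub>?F\<^esub> y \<otimes>\<^bsub>?F\<^esub> z = x \<otimes>\<^bsub>?F\<^esub> (y \<otimes>\<^bsub>?F\<^esub> z)"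
      by (simp only: mult app append_assoc)
  next
    show "\<one>\<^bsub>?F\<^esub> \<in> carrier ?F" by (auto simp: car one)
  next
    fix x assume "x \<in> carrier ?F"
    then obtain w where w: "w \<in> ?W" "x = ?c w" by (auto simp: car)
    have "?c [] \<otimes>\<^bsub>?F\<^esub> ?c w = ?c ([] @ w)" by (rule mult) (use w in auto)
    then show "\<one>\<^bsub>?F\<^esub> \<otimes>\<^bsub>?F\<^esub> x = x" by (simp only: one w append_Nil)
  qed
qed

definition int_power_group :: "nat \<Rightarrow> (nat \<Rightarrow> int) monoid" where
  "int_power_group r = product_group {..<r} (\<lambda>_. integer_group)"

text \<open>
  The parameter \<open>r\<close> lists the ranks: the \<open>i\<close>-th factor (\<open>i < t\<close>) is the free product of the groups
  \<open>\<int>\<close>-to-the-\<open>r i j\<close> for \<open>j < m i\<close>.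
\<close>

definition prod_free_prod_abelian ::
  "nat \<Rightarrow> (nat \<Rightarrow> nat) \<Rightarrow> (nat \<Rightarrow> nat \<Rightarrow> nat) \<Rightarrow>
    (nat \<Rightarrow> (nat \<times> (nat \<Rightarrow> int)) list set) monoid" where
  "prod_free_prod_abelian t m r =
    product_group {..<t} (\<lambda>i. free_product {..<m i} (\<lambda>j. int_power_group (r i j)))"

text \<open>
  A presentation of \<open>G\<close> on a finite set \<open>S\<close> of symbols enters only through the generating family
  \<open>\<gamma> : S \<rightarrow> G\<close> that it induces, which need not be injective. \<open>Inl s\<close> stands for the generator \<open>s\<close>,
  and \<open>Inr s\<close> for its formal inverse.
\<close>

definition letter_val :: "('g, 'b) monoid_scheme \<Rightarrow> ('s \<Rightarrow> 'g) \<Rightarrow> 's + 's \<Rightarrow> 'g" where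
  "letter_val G \<gamma> x = (case x of Inl s \<Rightarrow> \<gamma> s | Inr s \<Rightarrow> inv\<^bsub>G\<^esub> (\<gamma> s))"

definition word_val :: "('g, 'b) monoid_scheme \<Rightarrow> ('s \<Rightarrow> 'g) \<Rightarrow> ('s + 's) list \<Rightarrow> 'g" where
  "word_val G \<gamma> w = foldr (\<lambda>x g. letter_val G \<gamma> x \<otimes>\<^bsub>G\<^esub> g) w \<one>\<^bsub>G\<^esub>"

definition word_problem :: "('g, 'b) monoid_scheme \<Rightarrow> 's set \<Rightarrow> ('s \<Rightarrow> 'g) \<Rightarrow> ('s + 's) list set" where
  "word_problem G S \<gamma> = {w \<in> lists (S <+> S). word_val G \<gamma> w = \<one>\<^bsub>G\<^esub>}"

datatype 'a tape_symbol = Left_End | Letter 'a | Right_End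

text \<open>
  The quantum basis states are \<open>0, \<dots>, d - 1\<close>. In \<open>Unitary_Step U c k\<close> the state \<open>c\<close> is the
  next classical state and \<open>k\<close> the head displacement. In \<open>Measure_Step P \<delta>\<close> the outcome of the
  measurement is a block of the partition \<open>P\<close> of the basis states, and \<open>\<delta>\<close> maps it to the next
  classical state and the head displacement.
\<close>

datatype 'c action =
    Unitary_Step "complex mat" 'c int
  | Measure_Step "nat set set" "nat set \<Rightarrow> 'c \<times> int"

record ('c, 'a) two_qcfa =
  qdim :: nat
  cstates :: "'c set"
  qstart :: nat
  cstart :: 'c
  accepting :: "'c set"
  rejecting :: "'c set"
  trans_fun :: "'c \<Rightarrow> 'a tape_symbol \<Rightarrow> 'c action"

definition tape_alphabet :: "'a set \<Rightarrow> 'a tape_symbol set" where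
  "tape_alphabet \<Sigma> = {Left_End, Right_End} \<union> Letter ` \<Sigma>"

definition active_states :: "('c, 'a) two_qcfa \<Rightarrow> 'c set" where
  "active_states M = cstates M - (accepting M \<union> rejecting M)"

text \<open>The head never moves beyond the end markers.\<close>

definition valid_move :: "'a tape_symbol \<Rightarrow> int \<Rightarrow> bool" where
  "valid_move \<sigma> k \<longleftrightarrow> k \<in> {-1, 0, 1} \<and> (\<sigma> = Left_End \<longrightarrow> k \<noteq> -1) \<and> (\<sigma> = Right_End \<longrightarrow> k \<noteq> 1)"

definition unitary_mat :: "nat \<Rightarrow> complex mat \<Rightarrow> bool" where
  "unitary_mat d U \<longleftrightarrow>
    U \<in> carrier_mat d d \<and> U * mat_adjoint U = 1\<^sub>m d \<and> mat_adjoint U * U = 1\<^sub>m d"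

fun valid_action :: "nat \<Rightarrow> 'c set \<Rightarrow> 'a tape_symbol \<Rightarrow> 'c action \<Rightarrow> bool" where
  "valid_action d C \<sigma> (Unitary_Step U c k) \<longleftrightarrow> unitary_mat d U \<and> c \<in> C \<and> valid_move \<sigma> k"
| "valid_action d C \<sigma> (Measure_Step P \<delta>) \<longleftrightarrow>
    partition_on {..<d} P \<and> (\<forall>B\<in>P. fst (\<delta> B) \<in> C \<and> valid_move \<sigma> (snd (\<delta> B)))"

definition is_two_qcfa :: "'a set \<Rightarrow> ('c, 'a) two_qcfa \<Rightarrow> bool" where
  "is_two_qcfa \<Sigma> M \<longleftrightarrow>
    finite \<Sigma> \<and> finite (cstates M) \<and> qstart M < qdim M \<and> cstart M \<in> cstates M \<and>
    accepting M \<subseteq> cstates M \<and> rejecting M \<subseteq> cstates M \<and> accepting M \<inter> rejecting M = {} \<and>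
    (\<forall>c\<in>active_states M. \<forall>\<sigma>\<in>tape_alphabet \<Sigma>.
       valid_action (qdim M) (cstates M) \<sigma> (trans_fun M c \<sigma>))"

definition amplitudes_in :: "'a set \<Rightarrow> ('c, 'a) two_qcfa \<Rightarrow> complex set \<Rightarrow> bool" where
  "amplitudes_in \<Sigma> M A \<longleftrightarrow>
    (\<forall>c\<in>active_states M. \<forall>\<sigma>\<in>tape_alphabet \<Sigma>. \<forall>U c' k.
       trans_fun M c \<sigma> = Unitary_Step U c' k \<longrightarrow>
       (\<forall>i<qdim M. \<forall>j<qdim M. U $$ (i, j) \<in> A))"

text \<open>
  A configuration consists of the classical state, the head position (position \<open>0\<close> carries the
  left end marker) and the state of the quantum register.
\<close>

type_synonym 'c config = "'c \<times> nat \<times> complex Matrix.vec"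

definition tape :: "'a list \<Rightarrow> 'a tape_symbol list" where
  "tape w = Left_End # map Letter w @ [Right_End]"

definition init_config :: "('c, 'a) two_qcfa \<Rightarrow> 'c config" where
  "init_config M = (cstart M, 0, unit_vec (qdim M) (qstart M))"

definition halted :: "('c, 'a) two_qcfa \<Rightarrow> 'c config \<Rightarrow> bool" where
  "halted M x \<longleftrightarrow> fst x \<in> accepting M \<union> rejecting M"

definition outcome_prob :: "complex Matrix.vec \<Rightarrow> nat set \<Rightarrow> real" where
  "outcome_prob v B = (\<Sum>i\<in>B. (cmod (v $ i))\<^sup>2)"

definition outcome_pmf :: "nat set set \<Rightarrow> complex Matrix.vec \<Rightarrow> nat set pmf" where
  "outcome_pmf P v = embed_pmf (\<lambda>B. if B \<in> P then outcome_prob v B else 0)"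

text \<open>The function given to \<^const>\<open>embed_pmf\<close> is a probability mass function for unit vectors.\<close>

lemma pmf_outcome_pmf:
  assumes P: "partition_on {..<dim_vec v} P" and v: "(\<Sum>i<dim_vec v. (cmod (v $ i))\<^sup>2) = 1"
  shows "pmf (outcome_pmf P v) B = (if B \<in> P then outcome_prob v B else 0)"
proof -
  let ?f = "\<lambda>B. if B \<in> P then outcome_prob v B else 0"
  have nonneg: "outcome_prob v B \<ge> 0" for B
    unfolding outcome_prob_def by (rule sum_nonneg, rule zero_le_power2)
  then have f_nonneg: "0 \<le> ?f B" for B by simp
  have fin: "finite P" by (rule finite_elements[OF finite_lessThan P])
  have un: "\<Union>P = {..<dim_vec v}" and disj: "disjoint P"
    using P unfolding partition_on_def by (rule conjunct1, elim conjE)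
  have "(\<integral>\<^sup>+B. ennreal (?f B) \<partial>count_space UNIV) = (\<Sum>B\<in>P. ennreal (?f B))"
    by (rule nn_integral_count_space'[OF fin]) auto
  also have "\<dots> = ennreal (\<Sum>B\<in>P. outcome_prob v B)"
    by (subst sum_ennreal[symmetric]) (auto simp: nonneg)
  also have "(\<Sum>B\<in>P. outcome_prob v B) = (\<Sum>i\<in>\<Union>P. (cmod (v $ i))\<^sup>2)"
    unfolding outcome_prob_def
  proof (rule sum.Union_disjoint[symmetric, unfolded comp_def])
    show "\<forall>B\<in>P. finite B" using un by (metis Union_upper finite_lessThan finite_subset)
    show "\<forall>A\<in>P. \<forall>B\<in>P. A \<noteq> B \<longrightarrow> A \<inter> B = {}" using disj by (simp add: disjoint_def)
  qed
  also have "\<dots> = 1" by (simp only: un v)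
  finally have "(\<integral>\<^sup>+B. ennreal (?f B) \<partial>count_space UNIV) = 1" by simp
  from pmf_embed_pmf[where f = ?f and x = B, OF f_nonneg this]
  show ?thesis by (simp only: outcome_pmf_def)
qed

definition collapse :: "complex Matrix.vec \<Rightarrow> nat set \<Rightarrow> complex Matrix.vec" where
  "collapse v B =
    Matrix.vec (dim_vec v)
      (\<lambda>i. if i \<in> B then v $ i / complex_of_real (sqrt (outcome_prob v B)) else 0)"

definition step :: "('c, 'a) two_qcfa \<Rightarrow> 'a list \<Rightarrow> 'c config \<Rightarrow> 'c config pmf" where
  "step M w x = (case x of (c, h, v) \<Rightarrow>
     (case trans_fun M c (tape w ! h) of
        Unitary_Step U c' k \<Rightarrow> return_pmf (c', nat (int h + k), U *\<^sub>v v)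
      | Measure_Step P \<delta> \<Rightarrow>
          map_pmf (\<lambda>B. (fst (\<delta> B), nat (int h + snd (\<delta> B)), collapse v B)) (outcome_pmf P v)))"

text \<open>
  \<open>run M w k\<close> is the subdistribution of the configuration after exactly \<open>k\<close> steps. The mass of
  computations that halted after fewer than \<open>k\<close> steps is removed, so the events of halting
  at step \<open>k\<close>, for different \<open>k\<close>, are disjoint.
\<close>

primrec run :: "('c, 'a) two_qcfa \<Rightarrow> 'a list \<Rightarrow> nat \<Rightarrow> 'c config spmf" where
  "run M w 0 = return_spmf (init_config M)"
| "run M w (Suc k) =
    bind_spmf (run M w k)
      (\<lambda>x. if halted M x then return_pmf None else spmf_of_pmf (step M w x))"

definition accept_prob :: "('c, 'a) two_qcfa \<Rightarrow> 'a list \<Rightarrow> ennreal" where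
  "accept_prob M w = (\<Sum>k. emeasure (measure_spmf (run M w k)) {x. fst x \<in> accepting M})"

definition reject_prob :: "('c, 'a) two_qcfa \<Rightarrow> 'a list \<Rightarrow> ennreal" where
  "reject_prob M w = (\<Sum>k. emeasure (measure_spmf (run M w k)) {x. fst x \<in> rejecting M})"

definition halt_prob_at :: "('c, 'a) two_qcfa \<Rightarrow> 'a list \<Rightarrow> nat \<Rightarrow> ennreal" where
  "halt_prob_at M w k = emeasure (measure_spmf (run M w k)) {x. halted M x}"

text \<open>The second summand accounts for computations that never halt; note that \<open>\<infinity> * 0 = 0\<close>.\<close>

definition expected_time :: "('c, 'a) two_qcfa \<Rightarrow> 'a list \<Rightarrow> ennreal" where
  "expected_time M w =
    (\<Sum>k. of_nat k * halt_prob_at M w k) + \<infinity> * (1 - (\<Sum>k. halt_prob_at M w k))"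

definition coN2QCFA :: "'a set \<Rightarrow> (nat \<Rightarrow> real) \<Rightarrow> nat \<Rightarrow> complex set \<Rightarrow> 'a list set set" where
  "coN2QCFA \<Sigma> T d A =
    {L. L \<subseteq> lists \<Sigma> \<and>
       (\<exists>M :: (nat, 'a) two_qcfa.
          is_two_qcfa \<Sigma> M \<and> qdim M = d \<and> amplitudes_in \<Sigma> M A \<and>
          (\<exists>\<tau> \<in> O(T). \<forall>w\<in>lists \<Sigma>. expected_time M w \<le> ennreal (\<tau> (length w))) \<and>
          (\<forall>w\<in>lists \<Sigma>.
             accept_prob M w + reject_prob M w = 1 \<and>
             (w \<in> L \<longrightarrow> accept_prob M w = 1) \<and>
             (w \<notin> L \<longrightarrow> reject_prob M w > 0)))}"

definition C_tilde :: "complex set" where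
  "C_tilde = {z. algebraic z} \<union> {exp (complex_of_real (pi * r) * \<i>) | r :: real. algebraic r}"

end

theory Submission
  imports
    Defs
    "HOL-Complex_Analysis.Complex_Analysis"
    "HOL-Real_Asymp.Real_Asymp"
    "HOL-Number_Theory.Cong"
begin

no_notation fps_nth (infixl \<open>$\<close> 75)
no_notation Finite_Cartesian_Product.vec_nth (infixl \<open>$\<close> 90)

text \<open>
  Let \<open>\<tau> = exp (\<pi> i \<surd>2)\<close> and \<open>D = diag (\<tau>, 1)\<close>. The \<open>j\<close>-th free abelian factor of a free
  product acts on \<open>\<complex>\<^sup>2\<close> by the conjugates under \<open>D ^ j\<close> of the rotations given by the unit
  complex numbers \<open>(x + i) / (x - i)\<close> for \<open>x = 2 ^ 2 ^ k\<close>. As the Fermat numbers \<open>x\<^sup>2 + 1\<close> are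
  coprime, these are multiplicatively independent. Since \<open>\<tau>\<close> is transcendental (a case of the
  Gelfond-Schneider theorem), a comparison of leading terms in \<open>\<tau>\<close> shows that a nonempty
  reduced word maps the first basis vector to a vector with nonzero second component. So a
  single measurement separates the trivial element from all others with positive probability.

  The automaton tracks the coset of the prefix read so far classically, and it applies to the
  qubit the operators of the Schreier generators \<open>rep C * x * inv (rep (C * x))\<close>. It makes one
  such pass for each direct factor, and it rejects if a measurement or the final coset is wrong.
  As no bound on the rejection probability is asked for, only the support of the computation
  matters.
\<close>

section \<open>Integer matrices and lower bounds for algebraic numbers\<close>

text \<open>The permitted amplitudes dictate \<open>tau\<close>. Separating the factors calls for a
  number that satisfies no polynomial equation over the rationals, but beyond the algebraic numbers
  \<open>C_tilde\<close> offers only \<open>exp (\<pi> i r)\<close> with \<open>r\<close> real and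
  algebraic. So \<open>r\<close> must be irrational, and with \<open>\<surd>2\<close> the field to
  be handled stays simple. Rotations by Gaussian rational numbers have rational entries; after
  conjugation, products have entries that are Laurent polynomials in \<open>tau\<close> with
  rational coefficients, and to these transcendence applies.

  A faithful representation would not suffice: a nontrivial element might act as a diagonal matrix,
  which fixes the first basis vector up to a phase and is invisible to the measurement. This is why
  the second component of a vector is followed along the word.

  The transcendence proof replaces norms in number fields by integer matrices: an algebraic value
  acts by multiplication on a finitely generated module, and a nonzero integer constant term of a
  characteristic polynomial, after removal of powers of the variable, keeps the value away from
  0.\<close>

definition l1_norm :: "int poly \<Rightarrow> int" where
  "l1_norm p = sum_list (map abs (coeffs p))"

lemma l1_norm_0 [simp]: "l1_norm 0 = 0"
  by (simp add: l1_norm_def)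

lemma l1_norm_pCons [simp]: "l1_norm (pCons a p) = \<bar>a\<bar> + l1_norm p"
  by (auto simp: l1_norm_def cCons_def)

lemma l1_norm_nonneg [simp]: "0 \<le> l1_norm p"
  by (induction p) auto

lemma l1_norm_add: "l1_norm (p + q) \<le> l1_norm p + l1_norm q"
  by (induction p q rule: poly_induct2) auto

lemma l1_norm_smult: "l1_norm (Polynomial.smult c p) = \<bar>c\<bar> * l1_norm p"
  by (induction p) (auto simp: abs_mult algebra_simps)

lemma l1_norm_uminus: "l1_norm (- p) = l1_norm p"
  by (induction p) auto

lemma l1_norm_mult: "l1_norm (p * q) \<le> l1_norm p * l1_norm q"
proof (induction p)
  case (pCons a p)
  have "l1_norm (pCons a p * q) \<le> l1_norm (Polynomial.smult a q) + l1_norm (pCons 0 (p * q))"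
    by (simp only: mult_pCons_left l1_norm_add)
  also have "\<dots> \<le> l1_norm (pCons a p) * l1_norm q"
    using pCons.IH by (simp add: l1_norm_smult algebra_simps)
  finally show ?case .
qed simp

lemma l1_norm_sum: "l1_norm (\<Sum>i\<in>I. f i) \<le> (\<Sum>i\<in>I. l1_norm (f i))"
proof (induction I rule: infinite_finite_induct)
  case (insert x F)
  then show ?case using l1_norm_add[of "f x" "sum f F"] by simp
qed auto

lemma l1_norm_prod_le:
  assumes "finite I" "\<And>i. i \<in> I \<Longrightarrow> l1_norm (f i) \<le> c" "0 \<le> c"
  shows "l1_norm (\<Prod>i\<in>I. f i) \<le> c ^ card I"
  using assms(1,2)
proof (induction I)
  case empty
  then show ?case by (simp add: one_pCons)
next
  case (insert x F)
  have "l1_norm (f x * prod f F) \<le> l1_norm (f x) * l1_norm (prod f F)"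
    by (rule l1_norm_mult)
  also have "\<dots> \<le> c * c ^ card F"
    using insert assms(3) by (intro mult_mono) auto
  finally show ?case using insert by simp
qed

lemma norm_poly_le_l1_norm:
  assumes "cmod y \<le> 1"
  shows "cmod (poly (map_poly of_int p) y) \<le> l1_norm p"
proof (induction p)
  case (pCons a p)
  have "cmod (poly (map_poly of_int (pCons a p)) y) =
      cmod (of_int a + y * poly (map_poly of_int p) y)"
    using pCons.hyps by (simp add: map_poly_pCons)
  also have "\<dots> \<le> \<bar>real_of_int a\<bar> + cmod y * cmod (poly (map_poly of_int p) y)"
    by (rule order.trans[OF norm_triangle_ineq]) (simp add: norm_mult)
  also have "cmod y * cmod (poly (map_poly of_int p) y) \<le> 1 * real_of_int (l1_norm p)"
    using assms pCons.IH by (intro mult_mono) auto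
  finally show ?case by simp
qed simp

text \<open>Stripping factors of \<open>y\<close> leaves a nonzero integer constant term
  \<open>a\<close>, equal to \<open>- y\<close> times a value that is at most the coefficient sum on
  the unit disc.\<close>

lemma int_poly_root_lower_bound:
  assumes "p \<noteq> 0" "poly (map_poly of_int p) y = 0" "y \<noteq> 0" "cmod y \<le> 1"
  shows "1 \<le> cmod y * l1_norm p"
  using assms(1,2)
proof (induction p)
  case (pCons a p)
  have eq: "of_int a + y * poly (map_poly of_int p) y = 0"
    using pCons.prems(2) pCons.hyps by (simp add: map_poly_pCons)
  show ?case
  proof (cases "a = 0")
    case True
    then show ?thesis using eq pCons assms(3) by auto
  next
    case False
    have "1 \<le> \<bar>real_of_int a\<bar>" using False by linarith
    also have "\<dots> = cmod (of_int a)" by simp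
    also have "of_int a = - (y * poly (map_poly of_int p) y)"
      using eq by (simp add: eq_neg_iff_add_eq_0)
    also have "cmod \<dots> \<le> cmod y * l1_norm p"
      using norm_poly_le_l1_norm[OF assms(4), of p] by (simp add: norm_mult mult_left_mono)
    also have "\<dots> \<le> cmod y * l1_norm (pCons a p)"
      by (intro mult_left_mono) auto
    finally show ?thesis .
  qed
qed simp

text \<open>Leibniz expansion: \<open>fact n\<close> products of \<open>n\<close> entries, each of
  coefficient sum at most \<open>1 + a\<close>, where the 1 is due to the variable on the
  diagonal.\<close>

lemma l1_norm_char_poly_le:
  assumes A: "A \<in> carrier_mat n n" and a: "\<And>i j. i < n \<Longrightarrow> j < n \<Longrightarrow> \<bar>A $$ (i, j)\<bar> \<le> a"
    and a0: "0 \<le> a"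
  shows "l1_norm (char_poly A) \<le> fact n * (1 + a) ^ n"
proof -
  let ?C = "char_poly_matrix A" and ?P = "{p. p permutes {0..<n}}"
  have C: "?C \<in> carrier_mat n n" using A by simp
  have ent: "l1_norm (?C $$ (i, j)) \<le> 1 + a" if "i < n" "j < n" for i j
    using A that a[OF that] by (auto simp: char_poly_matrix_def one_pCons)
  have "char_poly A = (\<Sum>p\<in>?P. signof p * (\<Prod>i = 0..<n. ?C $$ (i, p i)))"
    unfolding char_poly_def by (rule det_def'[OF C])
  also have "l1_norm \<dots> \<le> (\<Sum>p\<in>?P. l1_norm (signof p * (\<Prod>i = 0..<n. ?C $$ (i, p i))))"
    by (rule l1_norm_sum)
  also have "\<dots> \<le> (\<Sum>p\<in>?P. (1 + a) ^ n)"
  proof (rule sum_mono)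
    fix p assume "p \<in> ?P"
    then have p: "p i < n" if "i < n" for i using that permutes_in_image[of p "{0..<n}" i] by auto
    have "l1_norm (\<Prod>i = 0..<n. ?C $$ (i, p i)) \<le> (1 + a) ^ card {0..<n}"
      using p a0 by (intro l1_norm_prod_le ent) auto
    then show "l1_norm (signof p * (\<Prod>i = 0..<n. ?C $$ (i, p i))) \<le> (1 + a) ^ n"
      by (cases "sign p = 1") (auto simp: sign_def l1_norm_uminus split: if_splits)
  qed
  also have "\<dots> = fact n * (1 + a) ^ n"
    by (simp add: card_permutations[OF refl])
  finally show ?thesis .
qed

lemma int_mat_eigenvalue_lower_bound:
  assumes A: "A \<in> carrier_mat n n" and a: "\<And>i j. i < n \<Longrightarrow> j < n \<Longrightarrow> \<bar>A $$ (i, j)\<bar> \<le> int a"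
    and ev: "eigenvalue (map_mat complex_of_int A) y" and y: "y \<noteq> 0" "cmod y \<le> 1"
  shows "1 \<le> cmod y * (fact n * (1 + real a) ^ n)"
proof -
  have "poly (char_poly (map_mat complex_of_int A)) y = 0"
    using eigenvalue_root_char_poly[of "map_mat complex_of_int A" n y] A ev by simp
  then have root: "poly (map_poly of_int (char_poly A)) y = 0"
    by (simp add: of_int_hom.char_poly_hom[OF A])
  have "char_poly A \<noteq> 0" using degree_monic_char_poly[OF A] by auto
  from int_poly_root_lower_bound[OF this root y]
  have "1 \<le> cmod y * real_of_int (l1_norm (char_poly A))" .
  also have "real_of_int (l1_norm (char_poly A)) \<le> real_of_int (fact n * (1 + int a) ^ n)"
    unfolding of_int_le_iff by (rule l1_norm_char_poly_le[OF A a]) auto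
  finally show ?thesis by (simp add: mult_left_mono)
qed

text \<open>
  The bound \<open>a\<close> serves as a height of \<open>y\<close>. It behaves well under ring operations, and the
  characteristic polynomial of the matrix turns it into a lower bound for a nonzero \<open>y\<close>.
\<close>

definition int_rep :: "nat \<Rightarrow> (nat \<Rightarrow> complex) \<Rightarrow> complex \<Rightarrow> nat \<Rightarrow> bool" where
  "int_rep n u y a \<longleftrightarrow> (\<exists>A :: nat \<Rightarrow> nat \<Rightarrow> int. (\<forall>i<n. \<forall>j<n. \<bar>A i j\<bar> \<le> int a) \<and>
     (\<forall>i<n. (\<Sum>j<n. of_int (A i j) * u j) = y * u i))"

lemma int_repE:
  assumes "int_rep n u y a"
  obtains A where "\<And>i j. i < n \<Longrightarrow> j < n \<Longrightarrow> \<bar>A i j\<bar> \<le> int a"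
    "\<And>i. i < n \<Longrightarrow> (\<Sum>j<n. of_int (A i j) * u j) = y * u i"
  using assms unfolding int_rep_def by blast

lemma int_rep_mono: "int_rep n u y a \<Longrightarrow> a \<le> b \<Longrightarrow> int_rep n u y b"
  unfolding int_rep_def by (meson of_nat_mono order.trans)

lemma int_rep_of_int: "int_rep n u (of_int m) (nat \<bar>m\<bar>)"
  unfolding int_rep_def
proof (intro exI[of _ "\<lambda>i j. if j = i then m else 0"] conjI allI impI)
  fix i assume i: "i < n"
  have "(\<Sum>j<n. of_int (if j = i then m else 0) * u j) = (\<Sum>j<n. if j = i then of_int m * u j else 0)"
    by (rule sum.cong) auto
  then show "(\<Sum>j<n. of_int (if j = i then m else 0) * u j) = of_int m * u i"
    using i by simp
qed auto

lemma int_rep_add: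
  assumes "int_rep n u x a" "int_rep n u y b"
  shows "int_rep n u (x + y) (a + b)"
proof -
  obtain A where A: "\<And>i j. i < n \<Longrightarrow> j < n \<Longrightarrow> \<bar>A i j\<bar> \<le> int a"
      "\<And>i. i < n \<Longrightarrow> (\<Sum>j<n. of_int (A i j) * u j) = x * u i"
    using assms(1) by (rule int_repE) blast
  obtain B where B: "\<And>i j. i < n \<Longrightarrow> j < n \<Longrightarrow> \<bar>B i j\<bar> \<le> int b"
      "\<And>i. i < n \<Longrightarrow> (\<Sum>j<n. of_int (B i j) * u j) = y * u i"
    using assms(2) by (rule int_repE) blast
  have "\<bar>A i j + B i j\<bar> \<le> int (a + b)" if "i < n" "j < n" for i j
    using A(1)[OF that] B(1)[OF that] by linarith
  moreover have "(\<Sum>j<n. of_int (A i j + B i j) * u j) = (x + y) * u i" if "i < n" for i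
    using A(2)[OF that] B(2)[OF that] by (simp add: distrib_right sum.distrib)
  ultimately show ?thesis
    unfolding int_rep_def by (intro exI[of _ "\<lambda>i j. A i j + B i j"]) simp
qed

text \<open>The factor \<open>n\<close> is the number of terms in an entry of the matrix
  product.\<close>

lemma int_rep_mult:
  assumes "int_rep n u x a" "int_rep n u y b"
  shows "int_rep n u (x * y) (n * a * b)"
proof -
  obtain A where A: "\<And>i j. i < n \<Longrightarrow> j < n \<Longrightarrow> \<bar>A i j\<bar> \<le> int a"
      "\<And>i. i < n \<Longrightarrow> (\<Sum>j<n. of_int (A i j) * u j) = x * u i"
    using assms(1) by (rule int_repE) blast
  obtain B where B: "\<And>i j. i < n \<Longrightarrow> j < n \<Longrightarrow> \<bar>B i j\<bar> \<le> int b"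
      "\<And>i. i < n \<Longrightarrow> (\<Sum>j<n. of_int (B i j) * u j) = y * u i"
    using assms(2) by (rule int_repE) blast
  show ?thesis unfolding int_rep_def
  proof (intro exI[of _ "\<lambda>i j. \<Sum>k<n. A i k * B k j"] conjI allI impI)
    fix i j assume "i < n" "j < n"
    then have "\<bar>A i k * B k j\<bar> \<le> int a * int b" if "k < n" for k
      using A(1)[of i k] B(1)[of k j] that by (auto simp: abs_mult intro!: mult_mono)
    then have "(\<Sum>k<n. \<bar>A i k * B k j\<bar>) \<le> (\<Sum>k<n. int a * int b)"
      by (intro sum_mono) auto
    then show "\<bar>\<Sum>k<n. A i k * B k j\<bar> \<le> int (n * a * b)"
      by (intro order.trans[OF sum_abs]) (simp add: mult.assoc)
  next
    fix i assume i: "i < n"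
    have "(\<Sum>j<n. of_int (\<Sum>k<n. A i k * B k j) * u j) =
        (\<Sum>j<n. \<Sum>k<n. of_int (A i k) * (of_int (B k j) * u j))"
      by (simp add: sum_distrib_left sum_distrib_right mult_ac)
    also have "\<dots> = (\<Sum>k<n. \<Sum>j<n. of_int (A i k) * (of_int (B k j) * u j))"
      by (rule sum.swap)
    also have "\<dots> = (\<Sum>k<n. of_int (A i k) * (y * u k))"
      by (simp add: sum_distrib_left[symmetric] B(2))
    also have "\<dots> = y * (\<Sum>k<n. of_int (A i k) * u k)"
      by (simp add: sum_distrib_left mult_ac)
    also have "\<dots> = x * y * u i" using A(2)[OF i] by simp
    finally show "(\<Sum>j<n. of_int (\<Sum>k<n. A i k * B k j) * u j) = x * y * u i" .
  qed
qed

lemma int_rep_power: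
  assumes "int_rep n u x a"
  shows "int_rep n u (x ^ k) ((n * a) ^ k)"
proof (induction k)
  case 0
  then show ?case using int_rep_of_int[of n u 1] by simp
next
  case (Suc k)
  then show ?case using int_rep_mult[OF assms Suc] by (simp add: mult_ac)
qed

lemma int_rep_sum:
  assumes "finite I" "\<And>i. i \<in> I \<Longrightarrow> int_rep n u (f i) (a i)"
  shows "int_rep n u (\<Sum>i\<in>I. f i) (\<Sum>i\<in>I. a i)"
  using assms
proof (induction I)
  case empty
  then show ?case using int_rep_of_int[of n u 0] by simp
next
  case (insert x F)
  then show ?case by (simp add: int_rep_add)
qed

lemma int_rep_smult:
  assumes "int_rep n u x a"
  shows "int_rep n u (of_int m * x) (nat \<bar>m\<bar> * a)"
proof -
  obtain A where A: "\<And>i j. i < n \<Longrightarrow> j < n \<Longrightarrow> \<bar>A i j\<bar> \<le> int a"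
      "\<And>i. i < n \<Longrightarrow> (\<Sum>j<n. of_int (A i j) * u j) = x * u i"
    using assms by (rule int_repE) blast
  show ?thesis unfolding int_rep_def
    using A by (intro exI[of _ "\<lambda>i j. m * A i j"])
      (auto simp: abs_mult mult_left_mono sum_distrib_left[symmetric] mult.assoc)
qed

text \<open>A nonzero \<open>u k\<close> makes the vector of the \<open>u j\<close> a genuine
  eigenvector for \<open>y\<close>, so the bound for eigenvalues of integer matrices
  applies.\<close>

lemma int_rep_lower_bound:
  assumes "int_rep n u y a" "k < n" "u k \<noteq> 0" "y \<noteq> 0" "cmod y \<le> 1"
  shows "1 \<le> cmod y * (fact n * (1 + real a) ^ n)"
proof -
  obtain A where A: "\<And>i j. i < n \<Longrightarrow> j < n \<Longrightarrow> \<bar>A i j\<bar> \<le> int a"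
      "\<And>i. i < n \<Longrightarrow> (\<Sum>j<n. of_int (A i j) * u j) = y * u i"
    using assms(1) by (rule int_repE) blast
  let ?A = "mat n n (\<lambda>(i, j). A i j)" and ?v = "vec n u"
  have eq: "map_mat complex_of_int ?A *\<^sub>v ?v = y \<cdot>\<^sub>v ?v"
    by (rule eq_vecI) (auto simp: scalar_prod_def A(2)[symmetric] lessThan_atLeast0)
  have "?v $ k \<noteq> 0\<^sub>v n $ k" using assms(2,3) by simp
  then have "?v \<noteq> 0\<^sub>v n" by metis
  with eq have "eigenvalue (map_mat complex_of_int ?A) y"
    unfolding eigenvalue_def eigenvector_def by (intro exI[of _ ?v]) auto
  then show ?thesis using A(1) assms(4,5)
    by (intro int_mat_eigenvalue_lower_bound[of ?A]) auto
qed

text \<open>Pigeonhole: the vectors with entries in \<open>{0..H}\<close> outnumber the possible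
  values of the linear forms, and the difference of two vectors with equal values solves the
  system.\<close>

lemma siegel:
  fixes a :: "'j \<Rightarrow> 'i \<Rightarrow> int"
  assumes I: "finite I" "I \<noteq> {}" and J: "finite J" and IJ: "2 * card J \<le> card I"
    and a: "\<And>j i. j \<in> J \<Longrightarrow> i \<in> I \<Longrightarrow> \<bar>a j i\<bar> \<le> int A"
    and A: "A \<ge> 1"
  obtains c where "\<exists>i\<in>I. c i \<noteq> 0" "\<And>i. i \<in> I \<Longrightarrow> \<bar>c i\<bar> \<le> int (2 * card I * A)"
    "\<And>j. j \<in> J \<Longrightarrow> (\<Sum>i\<in>I. c i * a j i) = 0"
proof -
  \<comment> \<open>This choice gives \<open>2 * h = H * H\<close>, hence
    \<open>2 * h + 1 < (H + 1)\<^sup>2\<close>; the square is matched by the two unknowns per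
    equation.\<close>
  define H where "H = 2 * card I * A"
  define h where "h = card I * H * A"
  have H0: "H \<ge> 1" using I A by (auto simp: H_def Suc_le_eq card_gt_0_iff)
  let ?F = "PiE I (\<lambda>_. {0..int H})" and ?T = "PiE J (\<lambda>_. {- int h..int h})"
  let ?g = "\<lambda>c. restrict (\<lambda>j. \<Sum>i\<in>I. c i * a j i) J"
  have "2 * h + 1 = H * H + 1" by (simp add: h_def H_def)
  also have "\<dots> < (H + 1) ^ 2" using H0 by (simp add: power2_eq_square)
  finally have lt: "2 * h + 1 < (H + 1) ^ 2" .
  have "card ?T = (2 * h + 1) ^ card J" using J by (simp add: card_PiE nat_add_distrib nat_mult_distrib)
  also have "\<dots> < (H + 1) ^ card I"
  proof (cases "card J = 0")
    case True
    moreover have "1 < (H + 1) ^ card I"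
      using H0 I by (intro one_less_power) (auto simp: card_gt_0_iff)
    ultimately show ?thesis by simp
  next
    case False
    have "(2 * h + 1) ^ card J < ((H + 1) ^ 2) ^ card J"
      using lt False by (intro power_strict_mono) auto
    also have "\<dots> \<le> (H + 1) ^ card I"
      unfolding power_mult[symmetric] using IJ by (intro power_increasing) auto
    finally show ?thesis .
  qed
  also have "\<dots> = card ?F" using I by (simp add: card_PiE nat_add_distrib)
  finally have card: "card ?T < card ?F" .
  have "?g ` ?F \<subseteq> ?T"
  proof (rule image_subsetI)
    fix c assume c: "c \<in> ?F"
    have "\<bar>\<Sum>i\<in>I. c i * a j i\<bar> \<le> int h" if j: "j \<in> J" for j
    proof -
      have "\<bar>\<Sum>i\<in>I. c i * a j i\<bar> \<le> (\<Sum>i\<in>I. \<bar>c i * a j i\<bar>)" by (rule sum_abs)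
      also have "\<dots> \<le> (\<Sum>i\<in>I. int H * int A)"
      proof (rule sum_mono)
        fix i assume i: "i \<in> I"
        have "c i \<in> {0..int H}" using c i by blast
        then show "\<bar>c i * a j i\<bar> \<le> int H * int A"
          using a[OF j i] by (auto simp: abs_mult intro!: mult_mono)
      qed
      finally show ?thesis by (simp add: h_def)
    qed
    then show "?g c \<in> ?T" by (auto simp: abs_le_iff minus_le_iff)
  qed
  moreover have "finite ?T" using J by (simp add: finite_PiE)
  ultimately have "\<not> inj_on ?g ?F"
    using card card_inj_on_le[of ?g ?F ?T] by linarith
  then obtain c d where cd: "c \<in> ?F" "d \<in> ?F" "?g c = ?g d" "c \<noteq> d"
    unfolding inj_on_def by blast
  show ?thesis
  proof (rule that[of "\<lambda>i. c i - d i"])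
    show "\<exists>i\<in>I. c i - d i \<noteq> 0" using cd PiE_ext[of c I _ d] by force
  next
    fix i assume "i \<in> I"
    then have "c i \<in> {0..int H}" "d i \<in> {0..int H}" using cd by blast+
    then show "\<bar>c i - d i\<bar> \<le> int (2 * card I * A)" unfolding H_def[symmetric] by auto
  next
    fix j assume "j \<in> J"
    then have "(\<Sum>i\<in>I. c i * a j i) = (\<Sum>i\<in>I. d i * a j i)"
      using fun_cong[OF cd(3), of j] by simp
    then show "(\<Sum>i\<in>I. (c i - d i) * a j i) = 0" by (simp add: left_diff_distrib sum_subtractf)
  qed
qed

section \<open>Entire functions with many zeros\<close>

lemma entire_factor:
  assumes "finite Z" "f holomorphic_on UNIV" "\<And>z. z \<in> Z \<Longrightarrow> f z = 0"
  obtains g where "g holomorphic_on UNIV" "\<And>z. f z = g z * (\<Prod>\<zeta>\<in>Z. z - \<zeta>)"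
  using assms
proof (induction Z arbitrary: f thesis)
  case empty
  show ?case by (rule empty.prems(1)[of f]) (use empty in auto)
next
  case (insert x Z)
  \<comment> \<open>The quotient by \<open>z - x\<close> with its removable singularity filled in;
    it still vanishes on \<open>Z\<close>, as \<open>x\<close> is not in \<open>Z\<close>.\<close>
  define h where "h = (\<lambda>z. if z = x then deriv f x else (f z - f x) / (z - x))"
  have "h holomorphic_on UNIV"
    unfolding h_def by (rule pole_lemma_open) (use insert in auto)
  moreover have "h z = 0" if "z \<in> Z" for z using that insert by (auto simp: h_def)
  ultimately obtain g where g: "g holomorphic_on UNIV" "\<And>z. h z = g z * (\<Prod>\<zeta>\<in>Z. z - \<zeta>)"
    using insert.IH by metis
  have "f z = g z * (\<Prod>\<zeta>\<in>insert x Z. z - \<zeta>)" for z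
  proof -
    have "f z = h z * (z - x)" using insert.prems(3)[of x] by (auto simp: h_def)
    then show ?thesis using insert.hyps by (simp add: g(2))
  qed
  then show ?case using insert.prems(1) g(1) by blast
qed

text \<open>Divide by the zeros and use the maximum principle: a factor \<open>z - \<zeta>\<close>
  has modulus at least \<open>2 * D\<close> on the circle of radius \<open>3 * D\<close> but at most
  \<open>D\<close> at \<open>z0\<close>, so each zero gains a factor 2.\<close>

lemma schwarz_many_zeros:
  assumes f: "f holomorphic_on UNIV" and Z: "finite Z" "\<And>z. z \<in> Z \<Longrightarrow> f z = 0"
    and D: "D > 0" "\<And>z. z \<in> Z \<Longrightarrow> cmod z \<le> D" "\<And>z. z \<in> Z \<Longrightarrow> cmod (z0 - z) \<le> D"
    and z0: "cmod z0 \<le> 3 * D"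
    and B: "\<And>z. cmod z = 3 * D \<Longrightarrow> cmod (f z) \<le> B"
  shows "cmod (f z0) * 2 ^ card Z \<le> B"
proof -
  obtain g where g: "g holomorphic_on UNIV" "\<And>z. f z = g z * (\<Prod>\<zeta>\<in>Z. z - \<zeta>)"
    using entire_factor[OF Z(1) f Z(2)] by blast
  define m where "m = card Z"
  have bound: "cmod (g z) \<le> B / (2 * D) ^ m" if z: "cmod z = 3 * D" for z
  proof -
    have "(2 * D) ^ m \<le> (\<Prod>\<zeta>\<in>Z. cmod (z - \<zeta>))"
      unfolding m_def prod_constant[symmetric]
    proof (rule prod_mono)
      fix \<zeta> assume "\<zeta> \<in> Z"
      then show "0 \<le> 2 * D \<and> 2 * D \<le> cmod (z - \<zeta>)"
        using norm_triangle_ineq2[of z \<zeta>] D z by fastforce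
    qed
    then have "cmod (g z) * (2 * D) ^ m \<le> cmod (g z) * (\<Prod>\<zeta>\<in>Z. cmod (z - \<zeta>))"
      by (intro mult_left_mono) auto
    also have "\<dots> = cmod (f z)" by (simp add: g(2) norm_mult prod_norm)
    also have "\<dots> \<le> B" by (rule B[OF z])
    finally show ?thesis using D(1) by (simp add: field_simps)
  qed
  have "cmod (g z0) \<le> B / (2 * D) ^ m"
  proof (rule maximum_modulus_frontier[of g "cball 0 (3 * D)"])
    show "g holomorphic_on interior (cball 0 (3 * D))"
      using g(1) holomorphic_on_subset by blast
    show "continuous_on (closure (cball 0 (3 * D))) g"
      using g(1) holomorphic_on_imp_continuous_on holomorphic_on_subset by blast
    show "cmod (g z) \<le> B / (2 * D) ^ m" if "z \<in> frontier (cball 0 (3 * D))" for z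
      by (rule bound) (use that D(1) in auto)
  qed (use z0 in auto)
  moreover have "(\<Prod>\<zeta>\<in>Z. cmod (z0 - \<zeta>)) \<le> D ^ m"
    unfolding m_def prod_constant[symmetric] by (rule prod_mono) (use D in auto)
  ultimately have "cmod (f z0) \<le> B / (2 * D) ^ m * D ^ m"
    unfolding g(2) norm_mult prod_norm[symmetric]
    by (intro mult_mono) (auto intro: prod_nonneg order.trans[OF norm_ge_zero])
  then show ?thesis using D(1) by (simp add: m_def field_simps power_mult_distrib)
qed

section \<open>Transcendence of \<open>exp (\<pi> i \<surd>2)\<close>\<close>

lemma abs_coeff_le_l1_norm: "\<bar>coeff p i\<bar> \<le> l1_norm p"
proof (induction p arbitrary: i)
  case (pCons a p)
  have "\<bar>coeff p j\<bar> \<le> \<bar>a\<bar> + l1_norm p" for j using pCons.IH[of j] by linarith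
  then show ?case by (auto simp: coeff_pCons split: nat.split)
qed simp

lemma sum_lessThan_double:
  fixes f :: "nat \<Rightarrow> 'a :: comm_monoid_add"
  shows "(\<Sum>j<2 * d. f j) = (\<Sum>k<d. f (2 * k) + f (2 * k + 1))"
  by (induction d) (simp_all add: add_ac)

text \<open>\<open>u\<close> lists the products of 1 and \<open>\<surd>2\<close> with the powers of
  \<open>\<tau>\<close> below the degree of an integer polynomial that vanishes at
  \<open>\<tau>\<close>. Their integer span is stable under \<open>\<surd>2\<close>, and the leading
  coefficient \<open>q\<close> clears the denominators of multiplication by
  \<open>\<tau>\<close>.\<close>

lemma algebraic_int_rep:
  fixes \<tau> :: complex
  assumes "algebraic \<tau>"
  obtains n u q h where "n \<ge> 1" "u 0 = 1" "q \<noteq> 0" "int_rep n u (complex_of_real (sqrt 2)) 2"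
    "int_rep n u (of_int q * \<tau>) h"
proof -
  obtain p where p: "p \<noteq> 0" "poly (map_poly of_int p) \<tau> = 0" using assms by (rule algebraicE')
  define d where "d = degree p"
  define q where "q = coeff p d"
  define s where "s = complex_of_real (sqrt 2)"
  define u where "u = (\<lambda>k. s ^ (k mod 2) * \<tau> ^ (k div 2))"
  have q0: "q \<noteq> 0" using p(1) by (simp add: q_def d_def)
  have s2: "s * s = 2" by (simp add: s_def flip: of_real_mult)
  have d0: "d \<ge> 1"
  proof (rule ccontr)
    assume "\<not> d \<ge> 1"
    then obtain a where "p = [:a:]" using degree_eq_zeroE d_def by (metis One_nat_def not_less_eq_eq le0 le_antisym)
    then show False using p by simp
  qed
  have root: "(\<Sum>k<d. of_int (coeff p k) * \<tau> ^ k) = - (of_int q * \<tau> ^ d)"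
  proof -
    have "0 = (\<Sum>k\<le>d. of_int (coeff p k) * \<tau> ^ k)"
      using p(2) by (simp add: poly_altdef d_def)
    also have "{..d} = insert d {..<d}" by auto
    finally show ?thesis by (simp add: q_def add_eq_0_iff)
  qed
  have "int_rep (2 * d) u s 2"
    unfolding int_rep_def
  \<comment> \<open>Multiplication by \<open>\<surd>2\<close> sends an even index to its odd
    neighbour, and an odd one back with factor 2.\<close>
  proof (intro exI[of _ "\<lambda>i j. if even i then (if j = i + 1 then 1 else 0) else (if j = i - 1 then 2 else 0)"]
      conjI allI impI)
    fix i assume i: "i < 2 * d"
    show "(\<Sum>j<2 * d. of_int (if even i then (if j = i + 1 then 1 else 0) else (if j = i - 1 then 2 else 0)) * u j) = s * u i"
    proof (cases "even i")
      case True
      then have "i + 1 < 2 * d" using i by presburger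
      moreover have "(\<Sum>j<2 * d. of_int (if j = i + 1 then 1 else 0) * u j) = (\<Sum>j<2 * d. if j = i + 1 then u j else 0)"
        by (rule sum.cong) auto
      moreover have "u (i + 1) = s * u i" using True by (auto simp: u_def elim!: evenE)
      ultimately show ?thesis using True by simp
    next
      case False
      have "(\<Sum>j<2 * d. of_int (if j = i - 1 then 2 else 0) * u j) = (\<Sum>j<2 * d. if j = i - 1 then 2 * u j else 0)"
        by (rule sum.cong) auto
      moreover have "2 * u (i - 1) = s * u i"
        using False by (auto simp: u_def s2 elim!: oddE simp flip: mult.assoc)
      ultimately show ?thesis using False i by simp
    qed
  qed auto
  moreover have "int_rep (2 * d) u (of_int q * \<tau>) (nat (l1_norm p))"
    unfolding int_rep_def
  \<comment> \<open>One more power of \<open>\<tau>\<close> is a shift by two indices; past the top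
    power the polynomial is used, within the same parity class.\<close>
  proof (intro exI[of _ "\<lambda>i j. if i div 2 + 1 < d then (if j = i + 2 then q else 0)
        else (if even j = even i then - coeff p (j div 2) else 0)"] conjI allI impI)
    fix i assume i: "i < 2 * d"
    show "(\<Sum>j<2 * d. of_int (if i div 2 + 1 < d then (if j = i + 2 then q else 0)
        else (if even j = even i then - coeff p (j div 2) else 0)) * u j) = of_int q * \<tau> * u i"
    proof (cases "i div 2 + 1 < d")
      case True
      then have "i + 2 < 2 * d" by linarith
      moreover have "(\<Sum>j<2 * d. of_int (if j = i + 2 then q else 0) * u j) = (\<Sum>j<2 * d. if j = i + 2 then of_int q * u j else 0)"
        by (rule sum.cong) auto
      moreover have "u (i + 2) = \<tau> * u i" by (simp add: u_def)
      ultimately show ?thesis using True by simp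
    next
      case False
      then have id: "i div 2 + 1 = d" using i by linarith
      have "(\<Sum>j<2 * d. of_int (if even j = even i then - coeff p (j div 2) else 0) * u j)
          = (\<Sum>k<d. - (s ^ (i mod 2) * (of_int (coeff p k) * \<tau> ^ k)))"
        unfolding sum_lessThan_double
      proof (rule sum.cong[OF refl])
        fix k
        show "of_int (if even (2 * k) = even i then - coeff p (2 * k div 2) else 0) * u (2 * k) +
            of_int (if even (2 * k + 1) = even i then - coeff p ((2 * k + 1) div 2) else 0) * u (2 * k + 1) =
            - (s ^ (i mod 2) * (of_int (coeff p k) * \<tau> ^ k))"
          by (cases "even i") (simp_all add: u_def mod2_eq_if)
      qed
      also have "\<dots> = s ^ (i mod 2) * (of_int q * \<tau> ^ d)"
        by (simp add: sum_negf root flip: sum_distrib_left)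
      also have "\<dots> = of_int q * \<tau> * u i" by (simp add: u_def mult_ac flip: id)
      finally show ?thesis using False by simp
    qed
  qed (auto simp: abs_coeff_le_l1_norm q_def)
  ultimately show ?thesis using that[of "2 * d" u q] d0 q0 by (simp add: u_def s_def)
qed

lemma sqrt_2_irrational: "sqrt 2 \<notin> \<rat>"
proof
  assume "sqrt 2 \<in> \<rat>"
  then obtain m n :: nat where n: "n \<noteq> 0" and sq: "\<bar>sqrt 2\<bar> = m / n" and cop: "coprime m n"
    by (rule Rats_abs_nat_div_natE)
  from n and sq have "m = sqrt 2 * n" by (simp add: field_simps)
  then have "(real m)\<^sup>2 = 2 * (real n)\<^sup>2" by (simp add: power_mult_distrib)
  then have eq: "m\<^sup>2 = 2 * n\<^sup>2" by (metis of_nat_eq_iff of_nat_mult of_nat_numeral of_nat_power)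
  then have "even m" by (metis dvd_triv_left even_power)
  then obtain k where "m = 2 * k" by (rule evenE)
  with eq have "n\<^sup>2 = 2 * k\<^sup>2" by (simp add: power_mult_distrib)
  then have "even n" by (metis dvd_triv_left even_power)
  with coprime_common_divisor[OF cop \<open>even m\<close>] show False by simp
qed

lemma nat_sqrt_2_eqD:
  assumes "real a + real b * sqrt 2 = real a' + real b' * sqrt 2"
  shows "a = a' \<and> b = b'"
proof -
  have "b = b'"
  proof (rule ccontr)
    assume ne: "b \<noteq> b'"
    then have "sqrt 2 = (real a' - real a) / (real b - real b')"
      using assms by (simp add: field_simps)
    moreover have "\<dots> \<in> \<rat>" by (intro Rats_divide Rats_diff) auto
    ultimately show False using sqrt_2_irrational by simp
  qed
  then show ?thesis using assms by simp
qed

section \<open>The auxiliary function and its values on the grid\<close>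

definition tau :: complex where
  "tau = exp (complex_of_real (pi * sqrt 2) * \<i>)"

lemma norm_tau [simp]: "cmod tau = 1"
  by (simp add: tau_def norm_exp_eq_Re)

text \<open>Equal powers have exponents that differ by a multiple of \<open>2 \<pi> i\<close>, which
  would make \<open>\<surd>2\<close> rational.\<close>

lemma inj_tau_power: "inj (\<lambda>b. tau ^ b)"
proof (rule injI)
  fix b b' :: nat assume "tau ^ b = tau ^ b'"
  then have "exp (of_nat b * (complex_of_real (pi * sqrt 2) * \<i>)) = exp (of_nat b' * (complex_of_real (pi * sqrt 2) * \<i>))"
    by (simp add: tau_def exp_of_nat_mult)
  then obtain k :: int where "of_nat b * (complex_of_real (pi * sqrt 2) * \<i>) =
      of_nat b' * (complex_of_real (pi * sqrt 2) * \<i>) + (of_int (2 * k) * pi) * \<i>"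
    unfolding exp_eq by blast
  then have "real b * (pi * sqrt 2) = real b' * (pi * sqrt 2) + 2 * k * pi"
    by (auto simp: complex_eq_iff)
  then have "pi * (real b * sqrt 2) = pi * (real b' * sqrt 2 + 2 * k)"
    by (simp add: algebra_simps)
  then have eq: "real b * sqrt 2 = real b' * sqrt 2 + 2 * k" by simp
  show "b = b'"
  proof (rule ccontr)
    assume "b \<noteq> b'"
    then have "sqrt 2 = (2 * k) / (real b - real b')" using eq by (simp add: field_simps)
    moreover have "\<dots> \<in> \<rat>" by (intro Rats_divide Rats_diff Rats_mult) auto
    ultimately show False using sqrt_2_irrational by simp
  qed
qed

definition grid_pt :: "nat \<Rightarrow> nat \<Rightarrow> complex" where
  "grid_pt a b = of_nat a + of_nat b * complex_of_real (sqrt 2)"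

lemma grid_pt_of_real: "grid_pt a b = complex_of_real (real a + real b * sqrt 2)"
  by (simp add: grid_pt_def)

lemma grid_pt_inj: "grid_pt a b = grid_pt a' b' \<longleftrightarrow> a = a' \<and> b = b'"
  unfolding grid_pt_of_real of_real_eq_iff using nat_sqrt_2_eqD by auto

definition aux_fun :: "nat \<Rightarrow> nat \<Rightarrow> (nat \<times> nat \<Rightarrow> int) \<Rightarrow> complex \<Rightarrow> complex" where
  "aux_fun D1 D2 c z = (\<Sum>(k, l)\<in>{..<D1} \<times> {..<D2}.
     of_int (c (k, l)) * (z ^ k * exp (complex_of_real pi * \<i> * of_nat l * z)))"

text \<open>The value of \<open>z ^ k * exp (\<pi> i l z)\<close> at \<open>grid_pt a b\<close>: the
  integer part of the point contributes the sign, the multiple of \<open>\<surd>2\<close> the power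
  of \<open>tau\<close>.\<close>

definition grid_val :: "nat \<Rightarrow> nat \<Rightarrow> nat \<times> nat \<Rightarrow> complex" where
  "grid_val a b = (\<lambda>(k, l). grid_pt a b ^ k * ((-1) ^ (l * a) * tau ^ (l * b)))"

lemma exp_pi_i_grid_pt: "exp (complex_of_real pi * \<i> * of_nat l * grid_pt a b) = (-1) ^ (l * a) * tau ^ (l * b)"
proof -
  have "complex_of_real pi * \<i> * of_nat l * grid_pt a b =
      of_nat (l * a) * (complex_of_real pi * \<i>) + of_nat (l * b) * (complex_of_real (pi * sqrt 2) * \<i>)"
    by (simp add: grid_pt_def algebra_simps)
  then show ?thesis by (simp only: exp_add exp_of_nat_mult tau_def exp_pi_i)
qed

lemma aux_fun_grid_pt:
  "aux_fun D1 D2 c (grid_pt a b) = (\<Sum>i\<in>{..<D1} \<times> {..<D2}. of_int (c i) * grid_val a b i)"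
  unfolding aux_fun_def by (rule sum.cong) (auto simp: grid_val_def exp_pi_i_grid_pt)

lemma aux_fun_holomorphic: "aux_fun D1 D2 c holomorphic_on UNIV"
  unfolding aux_fun_def case_prod_beta by (intro holomorphic_intros)

lemma norm_aux_fun_le:
  assumes c: "\<And>i. i \<in> {..<D1} \<times> {..<D2} \<Longrightarrow> \<bar>c i\<bar> \<le> int H" and r: "cmod z \<le> r" "r \<ge> 1"
  shows "cmod (aux_fun D1 D2 c z) \<le> D1 * D2 * (H * (r ^ D1 * exp (pi * D2 * r)))"
proof -
  have "cmod (aux_fun D1 D2 c z) \<le> (\<Sum>i\<in>{..<D1} \<times> {..<D2}. H * (r ^ D1 * exp (pi * D2 * r)))"
    unfolding aux_fun_def case_prod_beta
  proof (rule sum_norm_le)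
    fix i assume i: "i \<in> {..<D1} \<times> {..<D2}"
    define k l where "k = fst i" and "l = snd i"
    have kl: "k \<in> {..<D1}" "l \<in> {..<D2}" using i by (auto simp: k_def l_def)
    have "cmod z ^ k \<le> r ^ k" using r by (intro power_mono) auto
    also have "\<dots> \<le> r ^ D1" using r kl by (intro power_increasing) auto
    finally have 1: "cmod (z ^ k) \<le> r ^ D1" by (simp add: norm_power)
    have "Re (complex_of_real pi * \<i> * of_nat l * z) \<le> cmod (complex_of_real pi * \<i> * of_nat l * z)"
      by (rule complex_Re_le_cmod)
    also have "\<dots> = pi * (l * cmod z)" by (simp add: norm_mult)
    also have "\<dots> \<le> pi * (D2 * r)" using kl r by (intro mult_left_mono mult_mono) auto
    finally have 2: "cmod (exp (complex_of_real pi * \<i> * of_nat l * z)) \<le> exp (pi * D2 * r)"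
      by (simp add: norm_exp_eq_Re mult.assoc)
    have 3: "real_of_int \<bar>c (k, l)\<bar> \<le> H" using c[of "(k, l)"] kl by simp
    show "cmod (of_int (c (fst i, snd i)) * (z ^ fst i * exp (complex_of_real pi * \<i> * of_nat (snd i) * z)))
        \<le> H * (r ^ D1 * exp (pi * D2 * r))"
      unfolding k_def[symmetric] l_def[symmetric] norm_mult using 1 2 3 r by (intro mult_mono) auto
  qed
  then show ?thesis by simp
qed

text \<open>For even \<open>a\<close> the sign in \<open>grid_val\<close> disappears. Then, for each
  fixed \<open>b\<close>, a polynomial in \<open>z\<close> has infinitely many zeros; its
  coefficients are polynomials in \<open>tau ^ b\<close>, and these in turn vanish at infinitely
  many points.\<close>

lemma aux_fun_nontrivial:
  assumes "\<And>a b. aux_fun D1 D2 c (grid_pt a b) = 0" and i: "i \<in> {..<D1} \<times> {..<D2}"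
  shows "c i = 0"
proof -
  obtain k l where kl: "i = (k, l)" "k < D1" "l < D2" using i by auto
  define P where "P = (\<lambda>b k. \<Sum>l<D2. complex_of_int (c (k, l)) * (tau ^ b) ^ l)"
  have P0: "P b k = 0" if "k < D1" for b k
  proof -
    define Q where "Q = (\<Sum>k<D1. monom (P b k) k)"
    have "poly Q (grid_pt (2 * a) b) = 0" for a
    proof -
      have "poly Q (grid_pt (2 * a) b) = (\<Sum>k<D1. \<Sum>l<D2. of_int (c (k, l)) * grid_val (2 * a) b (k, l))"
        by (simp add: Q_def poly_sum poly_monom P_def grid_val_def sum_distrib_left sum_distrib_right
            mult_ac power_mult flip: power_mult)
      also have "\<dots> = (\<Sum>i\<in>{..<D1} \<times> {..<D2}. of_int (c i) * grid_val (2 * a) b i)"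
        by (simp add: sum.cartesian_product)
      finally show ?thesis using assms(1)[of "2 * a" b] by (simp add: aux_fun_grid_pt)
    qed
    then have "range (\<lambda>a. grid_pt (2 * a) b) \<subseteq> {z. poly Q z = 0}" by auto
    moreover have "infinite (range (\<lambda>a. grid_pt (2 * a) b))"
      by (rule range_inj_infinite) (auto intro!: injI simp: grid_pt_inj)
    ultimately have "Q = 0" using poly_roots_finite[of Q] finite_subset by blast
    then have "coeff Q k = 0" by simp
    then show ?thesis using that by (simp add: Q_def coeff_sum)
  qed
  define R where "R = (\<Sum>l<D2. monom (complex_of_int (c (k, l))) l)"
  have "range (\<lambda>b. tau ^ b) \<subseteq> {z. poly R z = 0}"
    using P0[OF kl(2)] by (auto simp: R_def P_def poly_sum poly_monom)
  moreover have "infinite (range (\<lambda>b. tau ^ b))" by (rule range_inj_infinite[OF inj_tau_power])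
  ultimately have "R = 0" using poly_roots_finite[of R] finite_subset by blast
  then have "coeff R l = 0" by simp
  then show ?thesis using kl by (simp add: R_def coeff_sum)
qed

text \<open>Of the common denominator \<open>q ^ (D2 * m)\<close>, the part
  \<open>q ^ (l * b)\<close> is absorbed by \<open>tau ^ (l * b)\<close> and the rest is an integer
  factor. The single constant \<open>c\<close> bounds \<open>n\<close>, \<open>h\<close> and the
  modulus of \<open>q\<close>.\<close>

lemma grid_val_int_rep:
  assumes rep: "int_rep n u (complex_of_real (sqrt 2)) 2" "int_rep n u (of_int q * tau) h"
    and c: "n \<le> c" "h \<le> c" "nat \<bar>q\<bar> \<le> c" "c \<ge> 1"
    and i: "i \<in> {..<D1} \<times> {..<D2}" and ab: "a \<le> m" "b \<le> m" "m \<ge> 1"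
  shows "int_rep n u (of_int (q ^ (D2 * m)) * grid_val a b i) (c * (3 * c * m) ^ D1 * c ^ (2 * (D2 * m)))"
proof -
  obtain k l where kl: "i = (k, l)" "k < D1" "l < D2" using i by auto
  define E where "E = D2 * m"
  have lb: "l * b \<le> E" unfolding E_def using kl ab by (intro mult_mono) auto
  have "int_rep n u (of_int (int a) + of_int (int b) * complex_of_real (sqrt 2)) (nat \<bar>int a\<bar> + nat \<bar>int b\<bar> * 2)"
    by (intro int_rep_add int_rep_smult int_rep_of_int rep)
  \<comment> \<open>\<open>m\<close> for the integer part and \<open>2 * m\<close> for the other,
    because \<open>\<surd>2\<close> has matrix entries up to 2.\<close>
  then have "int_rep n u (grid_pt a b) (3 * m)"
    by (rule_tac int_rep_mono) (use ab in \<open>auto simp: grid_pt_def\<close>)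
  then have "int_rep n u (grid_pt a b ^ k) ((n * (3 * m)) ^ k)" by (rule int_rep_power)
  moreover have "(n * (3 * m)) ^ k \<le> (3 * c * m) ^ D1"
  proof -
    have "(n * (3 * m)) ^ k \<le> (3 * c * m) ^ k" using c by (intro power_mono) auto
    also have "\<dots> \<le> (3 * c * m) ^ D1" using c ab kl by (intro power_increasing) auto
    finally show ?thesis .
  qed
  ultimately have 1: "int_rep n u (grid_pt a b ^ k) ((3 * c * m) ^ D1)" by (rule int_rep_mono)
  have "int_rep n u (of_int ((-1) ^ (l * a) * q ^ (E - l * b)) * (of_int q * tau) ^ (l * b))
      (nat \<bar>(-1) ^ (l * a) * q ^ (E - l * b)\<bar> * (n * h) ^ (l * b))"
    by (intro int_rep_smult int_rep_power rep)
  moreover have "nat \<bar>(-1) ^ (l * a) * q ^ (E - l * b)\<bar> * (n * h) ^ (l * b) \<le> c ^ (2 * E)"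
  proof -
    have "nat \<bar>(-1) ^ (l * a) * q ^ (E - l * b)\<bar> = nat \<bar>q\<bar> ^ (E - l * b)"
      by (simp add: abs_mult power_abs nat_power_eq)
    also have "\<dots> \<le> c ^ (E - l * b)" using c by (intro power_mono) auto
    also have "\<dots> \<le> c ^ (2 * (E - l * b))" using c by (intro power_increasing) auto
    finally have "nat \<bar>(-1) ^ (l * a) * q ^ (E - l * b)\<bar> \<le> c ^ (2 * (E - l * b))" .
    moreover have "(n * h) ^ (l * b) \<le> (c * c) ^ (l * b)" using c by (intro power_mono mult_mono) auto
    then have "(n * h) ^ (l * b) \<le> c ^ (2 * (l * b))" by (simp add: power_mult power2_eq_square)
    ultimately have "nat \<bar>(-1) ^ (l * a) * q ^ (E - l * b)\<bar> * (n * h) ^ (l * b) \<le>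
        c ^ (2 * (E - l * b)) * c ^ (2 * (l * b))" by (rule mult_mono) auto
    also have "\<dots> = c ^ (2 * (E - l * b) + 2 * (l * b))" by (simp only: power_add)
    also have "2 * (E - l * b) + 2 * (l * b) = 2 * E" using lb by simp
    finally show ?thesis .
  qed
  ultimately have 2: "int_rep n u (of_int ((-1) ^ (l * a) * q ^ (E - l * b)) * (of_int q * tau) ^ (l * b)) (c ^ (2 * E))"
    by (rule int_rep_mono)
  have "(of_int q :: complex) ^ (E - l * b) * of_int q ^ (l * b) = of_int q ^ E"
    using lb by (simp flip: power_add)
  then have "of_int (q ^ E) * grid_val a b i =
     grid_pt a b ^ k * (of_int ((-1) ^ (l * a) * q ^ (E - l * b)) * (of_int q * tau) ^ (l * b))"
    by (simp add: grid_val_def kl power_mult_distrib mult_ac)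
  moreover have "int_rep n u \<dots> (n * (3 * c * m) ^ D1 * c ^ (2 * E))"
    by (rule int_rep_mult[OF 1 2])
  ultimately show ?thesis
    unfolding E_def[symmetric] using c by (auto elim!: int_rep_mono)
qed

text \<open>
  The logarithm of the product of all upper bounds in Schneider's argument on a grid of side \<open>x\<close>,
  when the degrees of the auxiliary function are as large as \<open>x\<close> permits.
\<close>

definition height_exponent :: "nat \<Rightarrow> real \<Rightarrow> real" where
  "height_exponent c x = ln c + x powr (3/2) * ln (3 * c * x) + 4 * c * x powr (3/2) * ln c"

definition schneider_exponent :: "nat \<Rightarrow> real \<Rightarrow> real" where
  "schneider_exponent c x = 2 * c * x powr (3/2) * ln c + (ln (8 * c^2 * x^4) + height_exponent c x) +
     x powr (3/2) * ln (9 * x) + 18 * pi * c * x powr (3/2) + ln (fact c) +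
     c * (ln (9 * c^2 * x^4) + 2 * height_exponent c x)"

text \<open>The left side has order at most \<open>x powr (3/2) * ln x\<close>; the right side is
  the gain from \<open>x\<^sup>2\<close> zeros.\<close>

lemma schneider_growth:
  assumes "c \<ge> 3"
  shows "eventually (\<lambda>x. schneider_exponent c x < x^2 * ln 2) at_top"
proof -
  define C L F where "C = real c" and "L = ln C" and "F = ln (fact c :: real)"
  have C: "C > 0" using assms by (simp add: C_def)
  have "eventually (\<lambda>x::real.
    2 * C * x powr (3/2) * L +
      (ln (8 * C^2 * x^4) + (L + x powr (3/2) * ln (3 * C * x) + 4 * C * x powr (3/2) * L)) +
    x powr (3/2) * ln (9 * x) + 18 * pi * C * x powr (3/2) + F +
    C * (ln (9 * C^2 * x^4) + 2 * (L + x powr (3/2) * ln (3 * C * x) + 4 * C * x powr (3/2) * L))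
     < x^2 * ln 2) at_top"
    using C by real_asymp
  then show ?thesis
    by (simp add: schneider_exponent_def height_exponent_def C_def L_def F_def)
qed

lemma power_le_exp:
  fixes b :: real
  assumes "1 \<le> b" "real e \<le> y"
  shows "b ^ e \<le> exp (y * ln b)"
proof -
  have "b ^ e = exp (real e * ln b)" using assms(1) by (simp add: exp_of_nat_mult)
  also have "\<dots> \<le> exp (y * ln b)" using assms by (simp add: mult_right_mono)
  finally show ?thesis .
qed

text \<open>The three factors bound the denominator, the auxiliary function on the large circle, and
  the loss in the lower bound for algebraic values. From \<open>X ^ 2 \<le> m\<close> it follows
  that \<open>X ^ 3\<close> and \<open>X * m\<close> are at most
  \<open>x powr (3/2)\<close>.\<close>

lemma schneider_numeric:
  fixes c n X m N H :: nat and x V :: real and W :: "nat \<Rightarrow> nat"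
  defines "x \<equiv> real m"
  defines "V \<equiv> height_exponent c x"
  defines "N \<equiv> X ^ 3 * (2 * n * X)"
  defines "W \<equiv> (\<lambda>m. c * (3 * c * m) ^ (X ^ 3) * c ^ (2 * (2 * n * X * m)))"
  defines "H \<equiv> 2 * N * W (X ^ 2)"
  assumes c: "c \<ge> 3" and n: "n \<le> c" and X: "X \<ge> 1" and m: "X ^ 2 \<le> m"
    and growth: "schneider_exponent c x < x^2 * ln 2"
  shows "real c ^ (2 * n * X * m) * (N * (H * ((9 * x) ^ (X ^ 3) * exp (pi * real (2 * n * X) * (9 * x))))) *
      (fact n * (1 + real (N * H * W m)) ^ n) < 2 ^ (m * m)"
proof -
  define y where "y = x powr (3/2)"
  have "1 \<le> X ^ 2" using X by simp
  then have m1: "m \<ge> 1" using m by linarith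
  then have x1: "x \<ge> 1" by (simp add: x_def)
  have c0: "real c \<ge> 3" using c by simp
  have Xs: "real X \<le> x powr (1/2)"
  proof -
    have "real X ^ 2 \<le> x" using m unfolding x_def by (metis of_nat_le_iff of_nat_power)
    then have "real X \<le> sqrt x" by (rule real_le_rsqrt)
    then show ?thesis using x1 by (simp add: powr_half_sqrt)
  qed
  have X3: "real (X ^ 3) \<le> y"
  proof -
    have "real X ^ 3 \<le> (x powr (1/2)) ^ 3" using Xs by (intro power_mono) auto
    also have "\<dots> = y" using x1 by (simp add: y_def powr_powr flip: powr_realpow)
    finally show ?thesis by simp
  qed
  have Xm: "real X * x \<le> y"
  proof -
    have "real X * x \<le> x powr (1/2) * x powr 1" using Xs x1 by (intro mult_mono) auto
    also have "\<dots> = x powr (1/2 + 1)" by (rule powr_add[symmetric])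
    also have "\<dots> = y" by (simp add: y_def)
    finally show ?thesis .
  qed
  have nXm: "real (n * X * m) \<le> c * y"
  proof -
    have "real (n * X * m) = real n * (real X * x)" by (simp add: x_def)
    also have "\<dots> \<le> c * y" using n Xm x1 by (intro mult_mono) auto
    finally show ?thesis .
  qed
  have y0: "y \<ge> 0" by (simp add: y_def)
  have V: "V = ln c + y * ln (3 * c * x) + 4 * c * y * ln c" by (simp add: V_def height_exponent_def y_def)
  have "3 * c * x \<ge> 1 * 1" using c0 x1 by (intro mult_mono) auto
  then have cx: "3 * c * x \<ge> 1" by simp
  have V0: "V \<ge> 0" unfolding V using y0 c0 cx by (intro add_nonneg_nonneg mult_nonneg_nonneg) auto
  have Wm: "real (W m) \<le> exp V"
  proof -
    have "real (W m) = c * (3 * c * x) ^ (X ^ 3) * real c ^ (2 * (2 * n * X * m))"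
      by (simp add: W_def x_def)
    also have "\<dots> \<le> exp (ln c) * exp (y * ln (3 * c * x)) * exp (4 * c * y * ln c)"
    proof (intro mult_mono power_le_exp)
      show "real (2 * (2 * n * X * m)) \<le> 4 * c * y" using nXm by simp
    qed (use c0 cx X3 x1 in \<open>auto intro!: zero_le_power\<close>)
    also have "\<dots> = exp V" by (simp add: V exp_add)
    finally show ?thesis .
  qed
  have W0: "W (X ^ 2) \<le> W m" unfolding W_def
    using m c by (intro mult_mono power_mono power_increasing) auto
  have N: "real N ^ 2 \<le> 4 * c ^ 2 * x ^ 4"
  proof -
    have "N = 2 * n * (X ^ 2) ^ 2" by (simp add: N_def power_numeral_reduce)
    also have "\<dots> \<le> 2 * c * m ^ 2" using n m by (intro mult_mono power_mono) auto
    finally have "real N \<le> real (2 * c * m ^ 2)" by (simp only: of_nat_le_iff)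
    also have "\<dots> = 2 * c * x ^ 2" by (simp add: x_def)
    finally have "real N ^ 2 \<le> (2 * c * x ^ 2) ^ 2" by (intro power_mono) auto
    then show ?thesis by (simp add: power_mult_distrib flip: power_mult)
  qed
  have NH: "real N * real H \<le> 8 * c ^ 2 * x ^ 4 * exp V"
  proof -
    have "real N * real H = 2 * real N ^ 2 * real (W (X ^ 2))" by (simp add: H_def power2_eq_square)
    also have "\<dots> \<le> 2 * (4 * c ^ 2 * x ^ 4) * exp V"
      using N W0 Wm by (intro mult_mono) auto
    finally show ?thesis by simp
  qed
  have T: "1 + real (N * H * W m) \<le> 9 * c ^ 2 * x ^ 4 * exp (2 * V)"
  proof -
    have "real (N * H * W m) = real N * real H * real (W m)" by simp
    also have "\<dots> \<le> 8 * c ^ 2 * x ^ 4 * exp V * exp V"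
      by (rule mult_mono[OF NH Wm]) auto
    also have "\<dots> = 8 * (c ^ 2 * x ^ 4 * exp (2 * V))" by (simp add: exp_double power2_eq_square)
    finally have "real (N * H * W m) \<le> 8 * (c ^ 2 * x ^ 4 * exp (2 * V))" .
    moreover have "1 * 1 * 1 \<le> c ^ 2 * x ^ 4 * exp (2 * V)"
      using c0 x1 V0 by (intro mult_mono one_le_power) auto
    ultimately show ?thesis by simp
  qed
  define P where "P = real N * real H"
  have P0: "0 \<le> P" by (simp add: P_def)
  have c9: "1 \<le> 9 * c ^ 2 * x ^ 4 * exp (2 * V)" using T by linarith
  have "real c ^ (2 * n * X * m) * (N * (H * ((9 * x) ^ (X ^ 3) * exp (pi * real (2 * n * X) * (9 * x))))) *
      (fact n * (1 + real (N * H * W m)) ^ n) =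
    real c ^ (2 * n * X * m) * (P * ((9 * x) ^ (X ^ 3) * exp (pi * real (2 * n * X) * (9 * x)))) *
      (fact n * (1 + real (N * H * W m)) ^ n)"
    by (simp only: mult.assoc P_def)
  also have "\<dots> \<le> exp (2 * c * y * ln c) * ((8 * c ^ 2 * x ^ 4 * exp V) * (exp (y * ln (9 * x)) * exp (18 * pi * c * y))) *
      (fact c * (9 * c ^ 2 * x ^ 4 * exp (2 * V)) ^ c)"
  proof (intro mult_mono power_le_exp NH[folded P_def])
    show "real (2 * n * X * m) \<le> 2 * c * y" using nXm by simp
    have "pi * (18 * real (n * X * m)) \<le> pi * (18 * (c * y))"
      using nXm by (intro mult_left_mono) auto
    then show "exp (pi * real (2 * n * X) * (9 * x)) \<le> exp (18 * pi * c * y)"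
      by (simp add: x_def mult_ac)
    show "fact n \<le> (fact c :: real)" using n by (rule fact_mono)
    have "(1 + real (N * H * W m)) ^ n \<le> (9 * c ^ 2 * x ^ 4 * exp (2 * V)) ^ n"
      using T by (intro power_mono) auto
    also have "\<dots> \<le> (9 * c ^ 2 * x ^ 4 * exp (2 * V)) ^ c"
      by (rule power_increasing[OF n c9])
    finally show "(1 + real (N * H * W m)) ^ n \<le> (9 * c ^ 2 * x ^ 4 * exp (2 * V)) ^ c" .
  qed (use c0 x1 X3 P0 in \<open>auto intro!: mult_nonneg_nonneg\<close>)
  also have "\<dots> = exp (2 * c * y * ln c + (ln (8 * c^2 * x^4) + V) +
      y * ln (9 * x) + 18 * pi * c * y + ln (fact c) + c * (ln (9 * c^2 * x^4) + 2 * V))"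
  proof -
    have 1: "exp (ln (8 * c^2 * x^4)) = 8 * c^2 * x^4" using c0 x1 by (subst exp_ln) auto
    have 2: "exp (ln (9 * c^2 * x^4)) = 9 * c^2 * x^4" using c0 x1 by (subst exp_ln) auto
    have 3: "exp (ln (fact c)) = (fact c :: real)" by (subst exp_ln) auto
    show ?thesis
      by (simp only: exp_add exp_of_nat_mult 1 2 3)
  qed
  also have "\<dots> < exp (x ^ 2 * ln 2)"
    using growth unfolding schneider_exponent_def V_def y_def by simp
  also have "\<dots> = 2 ^ (m * m)"
    by (simp add: x_def power2_eq_square exp_of_nat_mult flip: of_nat_mult)
  finally show ?thesis .
qed

text \<open>
  Schneider's method for the functions \<open>z\<close> and \<open>exp (\<pi> i z)\<close> on the points \<open>a + b \<surd>2\<close>, all of whose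
  values would lie in the number field generated by \<open>\<surd>2\<close> and \<open>tau\<close>. There is no need for a zero
  estimate: the zeros of the auxiliary function propagate from a square to the whole grid.
\<close>

theorem tau_not_algebraic: "\<not> algebraic tau"
proof
  assume "algebraic tau"
  then obtain n u q h where n: "n \<ge> 1" and u0: "u 0 = 1" and q: "q \<noteq> 0"
    and rep: "int_rep n u (complex_of_real (sqrt 2)) 2" "int_rep n u (of_int q * tau) h"
    by (rule algebraic_int_rep)
  define c where "c = n + h + nat \<bar>q\<bar> + 3"
  have c: "n \<le> c" "h \<le> c" "nat \<bar>q\<bar> \<le> c" "c \<ge> 1" "c \<ge> 3" by (auto simp: c_def)
  obtain X0 where X0: "\<And>x. x \<ge> X0 \<Longrightarrow> schneider_exponent c x < x^2 * ln 2"
    using schneider_growth[OF c(5)] unfolding eventually_at_top_linorder by blast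
  \<comment> \<open>\<open>X\<close> fixes the degrees beyond the threshold of the growth estimate;
    afterwards only the grid size \<open>m\<close> grows.\<close>
  define X where "X = nat \<lceil>X0\<rceil> + 1"
  define M where "M = X ^ 2"
  define D1 where "D1 = X ^ 3"
  \<comment> \<open>The \<open>M\<close> by \<open>M\<close> grid yields \<open>n * X ^ 4\<close>
    integer equations, \<open>n\<close> for each point, against
    \<open>D1 * D2 = 2 * n * X ^ 4\<close> unknowns.\<close>
  define D2 where "D2 = 2 * n * X"
  define N where "N = D1 * D2"
  define W where "W = (\<lambda>m. c * (3 * c * m) ^ D1 * c ^ (2 * (D2 * m)))"
  define H where "H = 2 * N * W M"
  define I where "I = {..<D1} \<times> {..<D2}"
  have X1: "X \<ge> 1" by (simp add: X_def)
  have M1: "M \<ge> 1" using X1 by (simp add: M_def)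
  have cI: "card I = N" by (simp add: I_def N_def)
  have N0: "N > 0" using X1 n by (simp add: N_def D1_def D2_def)
  have grep: "int_rep n u (of_int (q ^ (D2 * m)) * grid_val a b i) (W m)"
    if "i \<in> I" "a \<le> m" "b \<le> m" "m \<ge> 1" for a b i m
    unfolding W_def using grid_val_int_rep[OF rep c(1-4)] that unfolding I_def by blast
  define good where "good = (\<lambda>a b i v. (\<forall>j<n. \<bar>v j :: int\<bar> \<le> int (W M)) \<and>
    (\<Sum>j<n. of_int (v j) * u j) = of_int (q ^ (D2 * M)) * grid_val a b i)"
  have "\<exists>v. good a b i v" if ab: "a < M" "b < M" "i \<in> I" for a b i
  proof -
    have "int_rep n u (of_int (q ^ (D2 * M)) * grid_val a b i) (W M)"
      using ab M1 by (intro grep) auto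
    then obtain A where "\<And>i j. i < n \<Longrightarrow> j < n \<Longrightarrow> \<bar>A i j\<bar> \<le> int (W M)"
      "\<And>k. k < n \<Longrightarrow> (\<Sum>j<n. of_int (A k j) * u j) = of_int (q ^ (D2 * M)) * grid_val a b i * u k"
      by (rule int_repE) blast
    \<comment> \<open>As \<open>u 0 = 1\<close>, row 0 of the matrix holds coordinates of the value
      itself.\<close>
    then have "good a b i (A 0)" using n u0 unfolding good_def by auto
    then show ?thesis by (rule exI[of "good a b i" "A 0"])
  qed
  from someI_ex[OF this] obtain v where good: "\<And>a b i. a < M \<Longrightarrow> b < M \<Longrightarrow> i \<in> I \<Longrightarrow> good a b i (v a b i)"
    by (rule that)
  have v: "\<And>a b i j. a < M \<Longrightarrow> b < M \<Longrightarrow> i \<in> I \<Longrightarrow> j < n \<Longrightarrow> \<bar>v a b i j :: int\<bar> \<le> int (W M)"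
    "\<And>a b i. a < M \<Longrightarrow> b < M \<Longrightarrow> i \<in> I \<Longrightarrow> (\<Sum>j<n. of_int (v a b i j) * u j) = of_int (q ^ (D2 * M)) * grid_val a b i"
    using good unfolding good_def by simp_all
  let ?J = "{..<M} \<times> {..<M} \<times> {..<n}"
  \<comment> \<open>Requiring every coordinate along \<open>u\<close> to vanish turns one complex
    equation into \<open>n\<close> integer ones.\<close>
  obtain cc where cc: "\<exists>i\<in>I. cc i \<noteq> 0" "\<And>i. i \<in> I \<Longrightarrow> \<bar>cc i\<bar> \<le> int (2 * card I * W M)"
    "\<And>j. j \<in> ?J \<Longrightarrow> (\<Sum>i\<in>I. cc i * (case j of (a, b, k) \<Rightarrow> v a b i k)) = 0"
  proof (rule siegel[of I ?J "\<lambda>j i. case j of (a, b, k) \<Rightarrow> v a b i k" "W M"])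
    show "finite I" by (simp add: I_def)
    show "I \<noteq> {}" using N0 cI by auto
    show "2 * card ?J \<le> card I"
      by (simp add: cI N_def D1_def D2_def M_def power_numeral_reduce)
    show "W M \<ge> 1" using c(4) M1 by (simp add: W_def)
  qed (use v(1) in auto)
  have ccH: "\<bar>cc i\<bar> \<le> int H" if "i \<in> I" for i
    using cc(2)[OF that] by (simp add: H_def cI)
  let ?F = "aux_fun D1 D2 cc"
  have vanish_base: "?F (grid_pt a b) = 0" if ab: "a < M" "b < M" for a b
  proof -
    have "of_int (q ^ (D2 * M)) * ?F (grid_pt a b) =
        (\<Sum>i\<in>I. of_int (cc i) * (of_int (q ^ (D2 * M)) * grid_val a b i))"
      by (simp add: aux_fun_grid_pt I_def sum_distrib_left mult_ac)
    also have "\<dots> = (\<Sum>i\<in>I. of_int (cc i) * (\<Sum>j<n. of_int (v a b i j) * u j))"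
      by (rule sum.cong) (use v(2) ab in auto)
    also have "\<dots> = (\<Sum>i\<in>I. \<Sum>j<n. of_int (cc i * v a b i j) * u j)"
      by (simp add: sum_distrib_left mult_ac)
    also have "\<dots> = (\<Sum>j<n. \<Sum>i\<in>I. of_int (cc i * v a b i j) * u j)"
      by (rule sum.swap)
    also have "\<dots> = (\<Sum>j<n. of_int (\<Sum>i\<in>I. cc i * v a b i j) * u j)"
      by (simp only: of_int_sum sum_distrib_right)
    also have "\<dots> = 0"
      by (rule sum.neutral) (use cc(3) ab in force)
    finally show ?thesis using q by simp
  qed
  have pt: "cmod (grid_pt a b) \<le> 3 * real m" "cmod (grid_pt a b - grid_pt a' b') \<le> 3 * real m"
    if "a \<le> m" "b \<le> m" "a' \<le> m" "b' \<le> m" for a b a' b' m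
  proof -
    have s2: "sqrt 2 \<le> 2" by (rule real_le_lsqrt) auto
    have bd: "0 \<le> real a + real b * sqrt 2 \<and> real a + real b * sqrt 2 \<le> 3 * real m"
      if "a \<le> m" "b \<le> m" for a b
    proof -
      have "real b * sqrt 2 \<le> real m * 2" using that s2 by (intro mult_mono) auto
      then show ?thesis using that by simp
    qed
    show "cmod (grid_pt a b) \<le> 3 * real m"
      unfolding grid_pt_of_real norm_of_real using bd[of a b] that by simp
    show "cmod (grid_pt a b - grid_pt a' b') \<le> 3 * real m"
      unfolding grid_pt_of_real of_real_diff[symmetric] norm_of_real
      using bd[of a b] bd[of a' b'] that by linarith
  qed
  \<comment> \<open>The zeros on a square of side \<open>m\<close> make the values at the adjacent
    points too small for nonzero numbers with such integer matrices.\<close>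
  have vanish_step: "?F (grid_pt a b) = 0"
    if IH: "\<And>a b. a < m \<Longrightarrow> b < m \<Longrightarrow> ?F (grid_pt a b) = 0" and m: "M \<le> m" and ab: "a \<le> m" "b \<le> m" for m a b
  proof (rule ccontr)
    assume nz: "?F (grid_pt a b) \<noteq> 0"
    define E where "E = D2 * m"
    define y where "y = of_int (q ^ E) * ?F (grid_pt a b)"
    define T where "T = N * H * W m"
    \<comment> \<open>The grid and its differences are bounded by \<open>3 * m\<close>, and
      \<open>schwarz_many_zeros\<close> uses a circle three times as large.\<close>
    define B where "B = N * (H * ((9 * real m) ^ D1 * exp (pi * D2 * (9 * real m))))"
    have m1: "m \<ge> 1" using m M1 by linarith
    have y0: "y \<noteq> 0" using nz q by (simp add: y_def)
    have "y = (\<Sum>i\<in>I. of_int (cc i) * (of_int (q ^ E) * grid_val a b i))"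
      by (simp add: y_def aux_fun_grid_pt I_def sum_distrib_left mult_ac)
    moreover have "int_rep n u \<dots> (\<Sum>i\<in>I. nat \<bar>cc i\<bar> * W m)"
      unfolding E_def using ab m1 by (intro int_rep_sum int_rep_smult grep) (auto simp: I_def)
    moreover have "(\<Sum>i\<in>I. nat \<bar>cc i\<bar> * W m) \<le> (\<Sum>i\<in>I. H * W m)"
      using ccH by (intro sum_mono mult_right_mono) (auto simp: nat_le_iff)
    ultimately have yrep: "int_rep n u y T"
      by (simp add: cI T_def mult.assoc) (rule int_rep_mono)
    let ?Z = "(\<lambda>(a, b). grid_pt a b) ` ({..<m} \<times> {..<m})"
    have "cmod (?F (grid_pt a b)) * 2 ^ card ?Z \<le> B"
    proof (rule schwarz_many_zeros[OF aux_fun_holomorphic, where D = "3 * real m"])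
      show "cmod (?F z) \<le> B" if "cmod z = 3 * (3 * real m)" for z
      proof -
        have "cmod z \<le> 9 * real m" "9 * real m \<ge> 1" using that m1 by auto
        from norm_aux_fun_le[OF ccH[unfolded I_def] this] show ?thesis
          by (simp add: B_def N_def)
      qed
      show "cmod (grid_pt a b) \<le> 3 * (3 * real m)"
        using pt(1)[of a m b 0 0] ab by simp
    qed (use IH pt(1) pt(2) ab m1 in \<open>auto intro: less_imp_le\<close>)
    moreover have "card ?Z = m * m"
      by (subst card_image) (auto simp: inj_on_def grid_pt_inj)
    ultimately have FB: "cmod (?F (grid_pt a b)) * 2 ^ (m * m) \<le> B" by simp
    have "\<bar>real_of_int q\<bar> \<le> real c" using c(3) by linarith
    then have "\<bar>real_of_int q\<bar> ^ E \<le> real c ^ E" by (intro power_mono) auto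
    then have "\<bar>real_of_int q\<bar> ^ E * (cmod (?F (grid_pt a b)) * 2 ^ (m * m)) \<le> real c ^ E * B"
      using FB by (intro mult_mono) auto
    then have yB: "cmod y * 2 ^ (m * m) \<le> real c ^ E * B"
      by (simp add: y_def norm_mult norm_power mult_ac)
    define K where "K = fact n * (1 + real T) ^ n"
    have "(1::real) * 1 \<le> K" unfolding K_def by (intro mult_mono one_le_power fact_ge_1) auto
    then have K1: "K \<ge> 1" by simp
    have "X0 \<le> real X" unfolding X_def by linarith
    also have "X \<le> M" using X1 by (simp add: M_def power2_eq_square)
    then have "real X \<le> real m" using m by linarith
    finally have "X0 \<le> real m" .
    from schneider_numeric[OF c(5) c(1) X1 _ X0[OF this]] m
    have num: "real c ^ E * B * K < 2 ^ (m * m)"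
      unfolding E_def B_def K_def T_def H_def N_def W_def D1_def D2_def M_def
      by (simp add: mult_ac)
    have "cmod y * K * 2 ^ (m * m) \<le> real c ^ E * B * K"
      using mult_right_mono[OF yB, of K] K1 by (simp add: mult_ac)
    also have "\<dots> < 1 * 2 ^ (m * m)" using num by simp
    finally have lt: "cmod y * K < 1" by (simp only: mult_less_cancel_right_pos zero_less_power zero_less_numeral)
    \<comment> \<open>The lower bound is stated inside the unit disc, so \<open>y\<close> has to be
      placed there first.\<close>
    have "cmod y * 1 \<le> cmod y * K" using K1 by (intro mult_left_mono) auto
    then have "cmod y \<le> 1" using lt by linarith
    from int_rep_lower_bound[OF yrep _ _ y0 this, of 0] n u0 have "1 \<le> cmod y * K"
      by (simp add: K_def)
    then show False using lt by linarith
  qed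
  have all: "\<forall>a<m. \<forall>b<m. ?F (grid_pt a b) = 0" if "M \<le> m" for m
    using that
  proof (induction m rule: dec_induct)
    case base
    then show ?case using vanish_base by blast
  next
    case (step m)
    then show ?case using vanish_step[of m] by (auto simp: less_Suc_eq_le)
  qed
  have "?F (grid_pt a b) = 0" for a b
    using all[of "M + a + b + 1"] by simp
  then have "cc i = 0" if "i \<in> I" for i
    using that aux_fun_nontrivial unfolding I_def by blast
  then show False using cc(1) by blast
qed

section \<open>Computations of bounded length\<close>

text \<open>It quantifies over supports, hence over possible runs rather than probabilities. With
  \<open>P\<close> as a parameter, both termination and certain acceptance are instances.\<close>

primrec sure_halt :: "('c, 'a) two_qcfa \<Rightarrow> 'a list \<Rightarrow> ('c config \<Rightarrow> bool) \<Rightarrow> nat \<Rightarrow> 'c config \<Rightarrow> bool" where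
  "sure_halt M w P 0 x \<longleftrightarrow> halted M x \<and> P x"
| "sure_halt M w P (Suc n) x \<longleftrightarrow>
    (if halted M x then P x else \<forall>y\<in>set_pmf (step M w x). sure_halt M w P n y)"

lemma sure_halt_halted [simp]: "halted M x \<Longrightarrow> sure_halt M w P n x \<longleftrightarrow> P x"
  by (cases n) auto

lemma set_spmf_run_Suc:
  "set_spmf (run M w (Suc k)) = (\<Union>x\<in>set_spmf (run M w k) \<inter> {x. \<not> halted M x}. set_pmf (step M w x))"
  by (auto simp: set_bind_spmf bind_UNION split: if_splits)

lemma sure_halt_run:
  assumes "sure_halt M w P T (init_config M)" "k \<le> T" "x \<in> set_spmf (run M w k)"
  shows "sure_halt M w P (T - k) x"
  using assms(2,3)
proof (induction k arbitrary: x)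
  case 0
  then show ?case using assms(1) by simp
next
  case (Suc k)
  then obtain y where y: "y \<in> set_spmf (run M w k)" "\<not> halted M y" "x \<in> set_pmf (step M w y)"
    by (auto simp only: set_spmf_run_Suc)
  have "sure_halt M w P (Suc (T - Suc k)) y" using Suc y by (simp add: Suc_diff_Suc)
  then show ?case using y by simp
qed

lemma run_eq_empty:
  assumes "sure_halt M w P T (init_config M)" "T < k"
  shows "set_spmf (run M w k) = {}"
  using assms(2)
proof (induction k)
  case (Suc k)
  show ?case
  proof (cases "k = T")
    case True
    have "halted M x" if "x \<in> set_spmf (run M w T)" for x
      using sure_halt_run[OF assms(1) le_refl that] by simp
    then show ?thesis using True by (auto simp only: set_spmf_run_Suc)
  next
    case False
    then have "set_spmf (run M w k) = {}" using Suc by simp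
    then show ?thesis by (simp only: set_spmf_run_Suc) simp
  qed
qed simp

text \<open>The mass lost in one step is the mass that has just halted, so the halting probabilities
  telescope.\<close>

lemma weight_run_Suc:
  "weight_spmf (run M w k) = measure (measure_spmf (run M w k)) {x. halted M x} + weight_spmf (run M w (Suc k))"
proof -
  let ?p = "run M w k"
  have "weight_spmf (run M w (Suc k)) = (\<integral>x. indicator {x. \<not> halted M x} x \<partial>measure_spmf ?p)"
    by (auto simp: weight_bind_spmf o_def indicator_def intro!: Bochner_Integration.integral_cong)
  also have "\<dots> = measure (measure_spmf ?p) {x. \<not> halted M x}" by simp
  finally have "weight_spmf (run M w (Suc k)) = measure (measure_spmf ?p) {x. \<not> halted M x}" .
  moreover have "weight_spmf ?p = measure (measure_spmf ?p) ({x. halted M x} \<union> {x. \<not> halted M x})"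
    by (simp add: weight_spmf_def space_measure_spmf Un_def)
  moreover have "\<dots> = measure (measure_spmf ?p) {x. halted M x} + measure (measure_spmf ?p) {x. \<not> halted M x}"
    by (rule measure_spmf.finite_measure_Union) auto
  ultimately show ?thesis by simp
qed

context
  fixes M :: "('c, 'a) two_qcfa" and w :: "'a list" and T :: nat
  assumes halts: "sure_halt M w (\<lambda>_. True) T (init_config M)"
begin

lemma run_late:
  assumes "T < k"
  shows "run M w k = return_pmf None"
  by (rule spmf_eqI) (simp add: spmf_eq_0_set_spmf run_eq_empty[OF halts assms])

lemma run_prob_late:
  assumes "T < k"
  shows "emeasure (measure_spmf (run M w k)) A = 0"
  by (simp add: run_late[OF assms])

lemma halt_prob_sum: "(\<Sum>k. halt_prob_at M w k) = 1"
proof -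
  have "(\<Sum>k<n. measure (measure_spmf (run M w k)) {x. halted M x}) = 1 - weight_spmf (run M w n)" for n
  proof (induction n)
    case (Suc n)
    have "(\<Sum>k<Suc n. measure (measure_spmf (run M w k)) {x. halted M x}) =
        1 - weight_spmf (run M w n) + measure (measure_spmf (run M w n)) {x. halted M x}"
      by (simp only: sum.lessThan_Suc Suc)
    then show ?case using weight_run_Suc[of M w n] by linarith
  qed simp
  from this[of "Suc T"]
  have "(\<Sum>k<Suc T. measure (measure_spmf (run M w k)) {x. halted M x}) = 1"
    by (simp only: run_late[OF lessI]) simp
  then have "(\<Sum>k<Suc T. halt_prob_at M w k) = 1"
    by (simp add: halt_prob_at_def measure_spmf.emeasure_eq_measure sum_ennreal del: sum.lessThan_Suc run.simps(2))
  then show ?thesis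
    by (subst suminf_finite[of "{..<Suc T}"]) (auto simp: halt_prob_at_def run_prob_late not_less)
qed

lemma expected_time_le: "expected_time M w \<le> ennreal (real T)"
proof -
  have "(\<Sum>k. of_nat k * halt_prob_at M w k) \<le> (\<Sum>k. of_nat T * halt_prob_at M w k)"
  proof (rule suminf_le)
    fix k show "of_nat k * halt_prob_at M w k \<le> of_nat T * halt_prob_at M w k"
      by (cases "k \<le> T") (auto simp: halt_prob_at_def run_prob_late intro!: mult_right_mono)
  qed auto
  also have "\<dots> = ennreal (real T)" by (simp add: halt_prob_sum ennreal_of_nat_eq_real_of_nat)
  finally show ?thesis by (simp add: expected_time_def halt_prob_sum)
qed

lemma accept_reject_sum:
  assumes "accepting M \<inter> rejecting M = {}"
  shows "accept_prob M w + reject_prob M w = 1"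
proof -
  have "accept_prob M w + reject_prob M w = (\<Sum>k. halt_prob_at M w k)"
    unfolding accept_prob_def reject_prob_def halt_prob_at_def
  proof (subst suminf_add)
    have "{x. halted M x} = {x. fst x \<in> accepting M} \<union> {x. fst x \<in> rejecting M}"
      by (auto simp: halted_def)
    moreover have "emeasure (measure_spmf (run M w k)) ({x. fst x \<in> accepting M} \<union> {x. fst x \<in> rejecting M}) =
        emeasure (measure_spmf (run M w k)) {x. fst x \<in> accepting M} +
        emeasure (measure_spmf (run M w k)) {x. fst x \<in> rejecting M}" for k
      using assms by (intro plus_emeasure[symmetric]) auto
    ultimately show "(\<Sum>k. emeasure (measure_spmf (run M w k)) {x. fst x \<in> accepting M} +
          emeasure (measure_spmf (run M w k)) {x. fst x \<in> rejecting M}) =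
        (\<Sum>k. emeasure (measure_spmf (run M w k)) {x. halted M x})" by simp
  qed auto
  then show ?thesis by (simp add: halt_prob_sum)
qed

lemma accept_prob_eq_1:
  assumes acc: "sure_halt M w (\<lambda>x. fst x \<in> accepting M) T (init_config M)"
    and disj: "accepting M \<inter> rejecting M = {}"
  shows "accept_prob M w = 1"
proof -
  have "emeasure (measure_spmf (run M w k)) {x. fst x \<in> rejecting M} = 0" for k
  proof (cases "k \<le> T")
    case True
    have "x \<notin> set_spmf (run M w k)" if "fst x \<in> rejecting M" for x
    proof
      assume "x \<in> set_spmf (run M w k)"
      from sure_halt_run[OF acc True this] that disj show False by (auto simp: halted_def)
    qed
    then show ?thesis
      by (simp add: measure_spmf.emeasure_eq_measure measure_measure_spmf_conv_measure_pmf measure_pmf_zero_iff)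
        (auto simp: in_set_spmf)
  qed (simp add: run_prob_late)
  then have "reject_prob M w = 0" by (simp add: reject_prob_def)
  then show ?thesis using accept_reject_sum[OF disj] by simp
qed

text \<open>Choose at each step a successor that still violates the claim; since halting is certain,
  this ends in a halted configuration outside \<open>P\<close>.\<close>

lemma reachable_violation:
  assumes "x \<in> set_spmf (run M w k)" "sure_halt M w (\<lambda>_. True) n x" "\<not> sure_halt M w P n x"
  shows "\<exists>k y. y \<in> set_spmf (run M w k) \<and> halted M y \<and> \<not> P y"
  using assms
proof (induction n arbitrary: k x)
  case 0
  then show ?case by (intro exI[of _ k] exI[of _ x]) auto
next
  case (Suc n)
  show ?case
  proof (cases "halted M x")
    case True
    then show ?thesis using Suc.prems by (intro exI[of _ k] exI[of _ x]) auto
  next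
    case False
    then obtain y where y: "y \<in> set_pmf (step M w x)" "\<not> sure_halt M w P n y" "sure_halt M w (\<lambda>_. True) n y"
      using Suc.prems by auto
    have "y \<in> set_spmf (run M w (Suc k))"
      using Suc.prems(1) False y(1) by (auto simp only: set_spmf_run_Suc)
    then show ?thesis using Suc.IH y by blast
  qed
qed

lemma reject_prob_pos:
  assumes "\<not> sure_halt M w (\<lambda>x. fst x \<in> accepting M) T (init_config M)"
  shows "reject_prob M w > 0"
proof -
  obtain k y where y: "y \<in> set_spmf (run M w k)" "fst y \<in> rejecting M"
    using reachable_violation[OF _ halts assms, of 0] by (auto simp: halted_def)
  have "0 < ennreal (spmf (run M w k) y)" using y(1) by (simp add: in_set_spmf_iff_spmf less_le)
  also have "\<dots> = emeasure (measure_spmf (run M w k)) {y}" by (rule emeasure_spmf_single[symmetric])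
  also have "\<dots> \<le> emeasure (measure_spmf (run M w k)) {x. fst x \<in> rejecting M}"
    using y(2) by (intro emeasure_mono) auto
  also have "\<dots> \<le> reject_prob M w"
    unfolding reject_prob_def
    using sum_le_suminf[of "\<lambda>k. emeasure (measure_spmf (run M w k)) {x. fst x \<in> rejecting M}" "{k}"] by simp
  finally show ?thesis .
qed

end

section \<open>An automaton that makes several passes\<close>

definition unit2 :: "complex Matrix.vec \<Rightarrow> bool" where
  "unit2 v \<longleftrightarrow> v \<in> carrier_vec 2 \<and> (cmod (v $ 0))\<^sup>2 + (cmod (v $ 1))\<^sup>2 = 1"

text \<open>Writing squared moduli as \<open>z * cnj z\<close> turns the claim into polynomial
  algebra in which the inner products of the columns can be replaced.\<close>

lemma orthonormal_columns_norm:
  fixes a b c d x y :: complex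
  assumes "cnj a * a + cnj c * c = 1" "cnj b * b + cnj d * d = 1" "cnj a * b + cnj c * d = 0"
  shows "(cmod (a * x + b * y))\<^sup>2 + (cmod (c * x + d * y))\<^sup>2 = (cmod x)\<^sup>2 + (cmod y)\<^sup>2"
proof -
  have 4: "cnj b * a + cnj d * c = 0" using arg_cong[OF assms(3), of cnj] by (simp add: mult.commute)
  have "complex_of_real ((cmod (a * x + b * y))\<^sup>2 + (cmod (c * x + d * y))\<^sup>2) =
      (a * x + b * y) * cnj (a * x + b * y) + (c * x + d * y) * cnj (c * x + d * y)"
    by (simp only: of_real_add complex_norm_square)
  also have "\<dots> = x * cnj x * (cnj a * a + cnj c * c) + y * cnj y * (cnj b * b + cnj d * d) +
      y * cnj x * (cnj a * b + cnj c * d) + x * cnj y * (cnj b * a + cnj d * c)"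
    by (simp add: algebra_simps)
  also have "\<dots> = complex_of_real ((cmod x)\<^sup>2 + (cmod y)\<^sup>2)"
    by (simp only: assms 4 of_real_add complex_norm_square) simp
  finally show ?thesis by (simp only: of_real_eq_iff)
qed

lemma mat_mult_vec_2:
  assumes "U \<in> carrier_mat 2 2" "v \<in> carrier_vec 2" "i < 2"
  shows "(U *\<^sub>v v) $ i = U $$ (i, 0) * v $ 0 + U $$ (i, 1) * v $ 1"
  using assms by (auto simp: scalar_prod_def numeral_2_eq_2)

lemma one_less_numeral_2: "(1 :: nat) < 2"
  by simp

lemma unit2_mult:
  assumes U: "unitary_mat 2 U" and v: "unit2 v"
  shows "unit2 (U *\<^sub>v v)"
proof -
  have Uc: "U \<in> carrier_mat 2 2" and ad: "mat_adjoint U * U = 1\<^sub>m 2"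
    using U by (auto simp: unitary_mat_def)
  have ent: "cnj (U $$ (0, i)) * U $$ (0, j) + cnj (U $$ (1, i)) * U $$ (1, j) = (if i = j then 1 else 0)"
    if "i < 2" "j < 2" for i j
  proof -
    have "(mat_adjoint U * U) $$ (i, j) = cnj (U $$ (0, i)) * U $$ (0, j) + cnj (U $$ (1, i)) * U $$ (1, j)"
      using Uc that by (auto simp: mat_adjoint_def scalar_prod_def numeral_2_eq_2 mat_of_rows_index)
    then show ?thesis using that by (simp add: ad)
  qed
  have vc: "v \<in> carrier_vec 2" using v by (simp add: unit2_def)
  have "(cmod ((U *\<^sub>v v) $ 0))\<^sup>2 + (cmod ((U *\<^sub>v v) $ 1))\<^sup>2 = (cmod (v $ 0))\<^sup>2 + (cmod (v $ 1))\<^sup>2"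
    unfolding mat_mult_vec_2[OF Uc vc pos2] mat_mult_vec_2[OF Uc vc one_less_numeral_2]
    by (rule orthonormal_columns_norm) (use ent[of 0 0] ent[of 1 1] ent[of 0 1] in simp_all)
  then show ?thesis using v Uc by (simp add: unit2_def)
qed

lemma unitary_mat_one [simp]: "unitary_mat d (1\<^sub>m d)"
proof -
  have "mat_adjoint (1\<^sub>m d :: complex mat) = 1\<^sub>m d"
    by (rule eq_matI) (auto simp: mat_adjoint_def mat_of_rows_index)
  then show ?thesis by (simp add: unitary_mat_def)
qed

lemma partition_on_2: "partition_on {..<2} {{0}, {1 :: nat}}"
  by (auto simp: partition_on_def disjoint_def)

lemma set_outcome_pmf_2:
  assumes "unit2 v"
  shows "set_pmf (outcome_pmf {{0}, {1}} v) = {B. \<exists>i\<in>{0, 1}. B = {i} \<and> v $ i \<noteq> 0}"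
proof -
  have dim: "dim_vec v = 2" using assms by (auto simp: unit2_def)
  have sum: "(\<Sum>i<dim_vec v. (cmod (v $ i))\<^sup>2) = 1"
    using assms by (simp add: dim unit2_def numeral_2_eq_2)
  have "pmf (outcome_pmf {{0}, {1}} v) B = (if B \<in> {{0}, {1}} then outcome_prob v B else 0)" for B
    by (rule pmf_outcome_pmf[OF _ sum]) (simp only: dim partition_on_2)
  note pmf = this
  show ?thesis unfolding set_eq_iff set_pmf_iff pmf
    by (auto simp: outcome_prob_def split: if_splits)
qed

text \<open>Outcome 0 restores the start vector up to a phase, so the next pass can begin without a
  reset of the register.\<close>

lemma collapse_0:
  assumes "unit2 v" "v $ 0 \<noteq> 0"
  shows "\<exists>\<alpha>. cmod \<alpha> = 1 \<and> collapse v {0} = \<alpha> \<cdot>\<^sub>v unit_vec 2 0"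
proof (intro exI conjI)
  have dim: "dim_vec v = 2" using assms by (auto simp: unit2_def)
  show "cmod (v $ 0 / complex_of_real (cmod (v $ 0))) = 1" using assms(2) by (simp add: norm_divide)
  show "collapse v {0} = (v $ 0 / complex_of_real (cmod (v $ 0))) \<cdot>\<^sub>v unit_vec 2 0"
    by (rule eq_vecI) (auto simp: collapse_def dim outcome_prob_def)
qed

lemma sure_halt_unitary:
  assumes "\<not> halted M (c, h, v)" "trans_fun M c (tape w ! h) = Unitary_Step U c' k"
  shows "sure_halt M w P (Suc n) (c, h, v) \<longleftrightarrow> sure_halt M w P n (c', nat (int h + k), U *\<^sub>v v)"
  using assms by (simp add: step_def)

lemma C_tilde_0_1 [simp]: "0 \<in> C_tilde" "1 \<in> C_tilde"
  by (auto simp: C_tilde_def)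

text \<open>\<open>Return i\<close> walks back to the left end marker before pass \<open>i\<close>;
  \<open>Scan i c j\<close> is in pass \<open>i\<close> with classical value \<open>c\<close>, after
  \<open>j\<close> operators of the current letter. Countability supplies the coding by natural
  numbers that \<open>coN2QCFA\<close> asks for.\<close>

datatype control = Accept | Reject | Scan nat nat nat | Return nat

instance control :: countable
  by countable_datatype

lemma tape_nth_Suc: "h < length w \<Longrightarrow> tape w ! Suc h = Letter (w ! h)"
  by (simp add: tape_def nth_append)

lemma tape_nth_0 [simp]: "tape w ! 0 = Left_End"
  by (simp add: tape_def)

lemma tape_nth_end [simp]: "tape w ! Suc (length w) = Right_End"
  by (simp add: tape_def nth_append)

lemma tape_nth_neq_Left_End: "0 < h \<Longrightarrow> h \<le> Suc (length w) \<Longrightarrow> tape w ! h \<noteq> Left_End"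
  by (cases h) (auto simp: tape_def nth_append split: nat.splits)

abbreviation apply_ops :: "complex mat list \<Rightarrow> complex Matrix.vec \<Rightarrow> complex Matrix.vec" where
  "apply_ops \<equiv> fold (\<lambda>U v. U *\<^sub>v v)"

text \<open>The classical values below \<open>q\<close> are updated by \<open>\<delta>\<close> from
  \<open>c0\<close> and tested against \<open>F\<close>. All letters have the same number
  \<open>J\<close> of operators, so that the duration of a scan depends only on the length of the
  input.\<close>

locale pass_automaton =
  fixes \<Sigma> :: "'a set" and t q J c0 :: nat and \<delta> :: "nat \<Rightarrow> 'a \<Rightarrow> nat"
    and ops :: "nat \<Rightarrow> nat \<Rightarrow> 'a \<Rightarrow> complex mat list" and F :: "nat set"
  assumes finite_alphabet: "finite \<Sigma>" and c0: "c0 < q"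
    and \<delta>: "\<And>c x. c < q \<Longrightarrow> x \<in> \<Sigma> \<Longrightarrow> \<delta> c x < q"
    and length_ops: "\<And>i c x. i < t \<Longrightarrow> c < q \<Longrightarrow> x \<in> \<Sigma> \<Longrightarrow> length (ops i c x) = J"
    and unitary_ops: "\<And>i c x U. i < t \<Longrightarrow> c < q \<Longrightarrow> x \<in> \<Sigma> \<Longrightarrow> U \<in> set (ops i c x) \<Longrightarrow> unitary_mat 2 U"
    and amplitudes_ops: "\<And>i c x U a b. i < t \<Longrightarrow> c < q \<Longrightarrow> x \<in> \<Sigma> \<Longrightarrow> U \<in> set (ops i c x) \<Longrightarrow>
      a < 2 \<Longrightarrow> b < 2 \<Longrightarrow> U $$ (a, b) \<in> C_tilde"
begin

primrec evolve :: "nat \<Rightarrow> nat \<Rightarrow> complex Matrix.vec \<Rightarrow> 'a list \<Rightarrow> nat \<times> complex Matrix.vec" where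
  "evolve i c v [] = (c, v)"
| "evolve i c v (x # w) = evolve i (\<delta> c x) (apply_ops (ops i c x) v) w"

fun control_step :: "control \<Rightarrow> 'a tape_symbol \<Rightarrow> nat action" where
  "control_step (Return i) Left_End =
     Unitary_Step (1\<^sub>m 2) (to_nat (if i < t then Scan i c0 0 else Accept)) 0"
| "control_step (Return i) \<sigma> = Unitary_Step (1\<^sub>m 2) (to_nat (Return i)) (-1)"
| "control_step (Scan i c j) Left_End = Unitary_Step (1\<^sub>m 2) (to_nat (Scan i c j)) 1"
| "control_step (Scan i c j) (Letter x) =
     (if j < J then Unitary_Step (ops i c x ! j) (to_nat (Scan i c (Suc j))) 0
      else Unitary_Step (1\<^sub>m 2) (to_nat (Scan i (\<delta> c x) 0)) 1)"
| "control_step (Scan i c j) Right_End = Measure_Step {{0}, {1}}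
     (\<lambda>B. (if B = {0} \<and> c \<in> F then to_nat (Return (Suc i)) else to_nat Reject, 0))"
| "control_step _ _ = Unitary_Step (1\<^sub>m 2) (to_nat Reject) 0"

definition controls :: "control set" where
  "controls = {Accept, Reject} \<union> Return ` {..t} \<union>
     (\<Union>i<t. \<Union>c<q. Scan i c ` {..J})"

definition machine :: "(nat, 'a) two_qcfa" where
  "machine = \<lparr>qdim = 2, cstates = to_nat ` controls, qstart = 0, cstart = to_nat (Return 0),
     accepting = {to_nat Accept}, rejecting = {to_nat Reject},
     trans_fun = (\<lambda>c. control_step (from_nat c))\<rparr>"

lemma mem_controls [simp]:
  "Accept \<in> controls" "Reject \<in> controls" "Return i \<in> controls \<longleftrightarrow> i \<le> t"
  "Scan i c j \<in> controls \<longleftrightarrow> i < t \<and> c < q \<and> j \<le> J"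
  by (auto simp: controls_def)

lemma to_nat_mem_image [simp]: "to_nat s \<in> to_nat ` controls \<longleftrightarrow> s \<in> controls"
  by (rule inj_image_mem_iff) simp

lemma machine_simps [simp]:
  "qdim machine = 2" "accepting machine = {to_nat Accept}" "rejecting machine = {to_nat Reject}"
  by (simp_all add: machine_def)

lemma control_step_valid:
  assumes s: "s \<in> controls" "s \<noteq> Accept" "s \<noteq> Reject" and \<sigma>: "\<sigma> \<in> tape_alphabet \<Sigma>"
  shows "valid_action 2 (to_nat ` controls) \<sigma> (control_step s \<sigma>)"
proof -
  consider i where "s = Return i" "i \<le> t" | i c j where "s = Scan i c j" "i < t" "c < q" "j \<le> J"
    using s by (auto simp: controls_def)
  then show ?thesis
  proof cases
    case 1
    then show ?thesis using \<sigma> c0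
      by (cases \<sigma>) (auto simp: valid_move_def)
  next
    case 2
    then show ?thesis using \<sigma> \<delta> length_ops unitary_ops partition_on_2
      by (cases \<sigma>) (auto simp: valid_move_def tape_alphabet_def)
  qed
qed

lemma machine_is_two_qcfa: "is_two_qcfa \<Sigma> machine"
proof -
  have "finite controls" by (simp add: controls_def)
  moreover have "Return 0 \<in> controls" by (auto simp: controls_def)
  moreover have "Accept \<in> controls" "Reject \<in> controls" by (auto simp: controls_def)
  ultimately show ?thesis
    using finite_alphabet control_step_valid
    by (auto simp: is_two_qcfa_def machine_def active_states_def)
qed

lemma machine_amplitudes: "amplitudes_in \<Sigma> machine C_tilde"
proof -
  have "U $$ (a, b) \<in> C_tilde"
    if s: "s \<in> controls" "s \<noteq> Accept" "s \<noteq> Reject" and \<sigma>: "\<sigma> \<in> tape_alphabet \<Sigma>"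
      and U: "control_step s \<sigma> = Unitary_Step U c' k" and ab: "a < 2" "b < 2" for s \<sigma> U c' k a b
  proof -
    consider i where "s = Return i" "i \<le> t" | i c j where "s = Scan i c j" "i < t" "c < q" "j \<le> J"
      using s by (auto simp: controls_def)
    then show ?thesis
    proof cases
      case 1
      then show ?thesis using U ab by (cases \<sigma>) auto
    next
      case 2
      then show ?thesis using \<sigma> U ab length_ops amplitudes_ops
        by (cases \<sigma>) (auto simp: tape_alphabet_def split: if_splits)
    qed
  qed
  then show ?thesis by (auto simp: amplitudes_in_def machine_def active_states_def)
qed

lemma halted_machine: "halted machine (to_nat s, h, v) \<longleftrightarrow> s = Accept \<or> s = Reject"
  by (auto simp: halted_def machine_def)

lemma trans_fun_machine [simp]: "trans_fun machine (to_nat s) \<sigma> = control_step s \<sigma>"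
  by (simp add: machine_def)

lemma apply_ops_unit2: "(\<And>U. U \<in> set us \<Longrightarrow> unitary_mat 2 U) \<Longrightarrow> unit2 v \<Longrightarrow> unit2 (apply_ops us v)"
  by (induction us arbitrary: v) (auto simp: unit2_mult)

lemma apply_ops_carrier:
  "(\<And>U. U \<in> set us \<Longrightarrow> unitary_mat 2 U) \<Longrightarrow> v \<in> carrier_vec 2 \<Longrightarrow> apply_ops us v \<in> carrier_vec 2"
  by (induction us arbitrary: v) (auto simp: unitary_mat_def intro!: mult_mat_vec_carrier)

lemma apply_ops_smult:
  "(\<And>U. U \<in> set us \<Longrightarrow> unitary_mat 2 U) \<Longrightarrow> v \<in> carrier_vec 2 \<Longrightarrow>
    apply_ops us (\<alpha> \<cdot>\<^sub>v v) = \<alpha> \<cdot>\<^sub>v apply_ops us v"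
proof (induction us arbitrary: v)
  case (Cons U us)
  have U: "U \<in> carrier_mat 2 2" using Cons.prems(1)[of U] by (auto simp: unitary_mat_def)
  have "U *\<^sub>v (\<alpha> \<cdot>\<^sub>v v) = \<alpha> \<cdot>\<^sub>v (U *\<^sub>v v)" using U Cons.prems by (intro mult_mat_vec) auto
  moreover have "U *\<^sub>v v \<in> carrier_vec 2" using U Cons.prems by (auto intro!: mult_mat_vec_carrier)
  ultimately show ?case using Cons by simp
qed simp

lemma evolve_unit2:
  "i < t \<Longrightarrow> c < q \<Longrightarrow> w \<in> lists \<Sigma> \<Longrightarrow> unit2 v \<Longrightarrow> unit2 (snd (evolve i c v w))"
  by (induction w arbitrary: c v) (auto simp: \<delta> apply_ops_unit2 unitary_ops)

lemma evolve_smult: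
  "i < t \<Longrightarrow> c < q \<Longrightarrow> w \<in> lists \<Sigma> \<Longrightarrow> v \<in> carrier_vec 2 \<Longrightarrow>
    evolve i c (\<alpha> \<cdot>\<^sub>v v) w = (fst (evolve i c v w), \<alpha> \<cdot>\<^sub>v snd (evolve i c v w))"
  by (induction w arbitrary: c v) (auto simp: \<delta> apply_ops_smult apply_ops_carrier unitary_ops)

text \<open>The fuel \<open>Suc (J - j)\<close> counts the operators still to be applied and the
  head move that follows them.\<close>

lemma scan_letter:
  assumes i: "i < t" "c < q" and x: "x \<in> \<Sigma>" and h: "tape w ! h = Letter x" and v: "v \<in> carrier_vec 2"
    and j: "j \<le> J"
  shows "sure_halt machine w P (Suc (J - j) + n) (to_nat (Scan i c j), h, v) \<longleftrightarrow>
    sure_halt machine w P n (to_nat (Scan i (\<delta> c x) 0), Suc h, apply_ops (drop j (ops i c x)) v)"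
  using j v
proof (induction j arbitrary: v rule: inc_induct)
  case base
  then show ?case using h length_ops[OF i x]
    by (simp add: sure_halt_unitary[where k = 1 and U = "1\<^sub>m 2" and c' = "to_nat (Scan i (\<delta> c x) 0)"]
        halted_machine nat_add_distrib del: sure_halt.simps)
next
  case (step j)
  let ?U = "ops i c x ! j"
  have U: "unitary_mat 2 ?U" using step.hyps length_ops[OF i x] by (intro unitary_ops[OF i x]) auto
  have Uv: "?U *\<^sub>v v \<in> carrier_vec 2" using U step.prems by (auto simp: unitary_mat_def intro!: mult_mat_vec_carrier)
  have "sure_halt machine w P (Suc (J - j) + n) (to_nat (Scan i c j), h, v) \<longleftrightarrow>
      sure_halt machine w P (J - j + n) (to_nat (Scan i c (Suc j)), h, ?U *\<^sub>v v)"
    using step.hyps h by (simp add: sure_halt_unitary[where k = 0 and U = ?U] halted_machine del: sure_halt.simps)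
  also have "J - j + n = Suc (J - Suc j) + n" using step.hyps by simp
  also have "sure_halt machine w P (Suc (J - Suc j) + n) (to_nat (Scan i c (Suc j)), h, ?U *\<^sub>v v) \<longleftrightarrow>
      sure_halt machine w P n (to_nat (Scan i (\<delta> c x) 0), Suc h, apply_ops (drop (Suc j) (ops i c x)) (?U *\<^sub>v v))"
    by (rule step.IH[OF Uv])
  also have "apply_ops (drop (Suc j) (ops i c x)) (?U *\<^sub>v v) = apply_ops (drop j (ops i c x)) v"
    using step.hyps length_ops[OF i x] by (simp add: Cons_nth_drop_Suc[symmetric])
  finally show ?case .
qed

lemma scan_word:
  assumes "i < t" "c < q" "w2 \<in> lists \<Sigma>" "v \<in> carrier_vec 2" "w = w1 @ w2"
  shows "sure_halt machine w P (length w2 * Suc J + n) (to_nat (Scan i c 0), Suc (length w1), v) \<longleftrightarrow>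
    sure_halt machine w P n (to_nat (Scan i (fst (evolve i c v w2)) 0), Suc (length w), snd (evolve i c v w2))"
  using assms
proof (induction w2 arbitrary: w1 c v)
  case (Cons x w2)
  have x: "x \<in> \<Sigma>" using Cons.prems by simp
  have tp: "tape w ! Suc (length w1) = Letter x" using Cons.prems by (simp add: tape_nth_Suc)
  have v: "apply_ops (ops i c x) v \<in> carrier_vec 2"
    using Cons.prems x unitary_ops by (intro apply_ops_carrier) auto
  have "length (x # w2) * Suc J + n = Suc (J - 0) + (length w2 * Suc J + n)" by simp
  then have "sure_halt machine w P (length (x # w2) * Suc J + n) (to_nat (Scan i c 0), Suc (length w1), v) \<longleftrightarrow>
      sure_halt machine w P (length w2 * Suc J + n)
        (to_nat (Scan i (\<delta> c x) 0), Suc (length (w1 @ [x])), apply_ops (ops i c x) v)"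
    using scan_letter[OF Cons.prems(1,2) x tp Cons.prems(4) le0, of P "length w2 * Suc J + n"]
    by (simp only:) simp
  also have "\<dots> \<longleftrightarrow> sure_halt machine w P n (to_nat (Scan i (fst (evolve i c v (x # w2))) 0),
      Suc (length w), snd (evolve i c v (x # w2)))"
    using Cons.IH[of "\<delta> c x" "apply_ops (ops i c x) v" "w1 @ [x]"] Cons.prems v \<delta>[OF _ x] by simp
  finally show ?case .
qed simp

lemma return_left:
  assumes "h \<le> Suc (length w)" "v \<in> carrier_vec 2"
  shows "sure_halt machine w P (h + n) (to_nat (Return i), h, v) \<longleftrightarrow>
    sure_halt machine w P n (to_nat (Return i), 0, v)"
  using assms(1)
proof (induction h)
  case (Suc h)
  have "control_step (Return i) (tape w ! Suc h) = Unitary_Step (1\<^sub>m 2) (to_nat (Return i)) (-1)"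
    using tape_nth_neq_Left_End[of "Suc h" w] Suc.prems by (cases "tape w ! Suc h") auto
  then have "sure_halt machine w P (Suc (h + n)) (to_nat (Return i), Suc h, v) \<longleftrightarrow>
      sure_halt machine w P (h + n) (to_nat (Return i), h, v)"
    using assms(2) by (subst sure_halt_unitary) (auto simp: halted_machine simp del: sure_halt.simps)
  then show ?case using Suc by simp
qed simp

text \<open>The only branching of the computation: an outcome occurs if and only if its amplitude is
  nonzero. \<open>b\<close> is the truth value of \<open>P\<close> at the rejecting state.\<close>

lemma measure_end:
  assumes v: "unit2 v" and P: "\<And>h v. P (to_nat Reject, h, v) \<longleftrightarrow> b"
  shows "sure_halt machine w P (Suc n) (to_nat (Scan i c j), Suc (length w), v) \<longleftrightarrow>
    (v $ 0 \<noteq> 0 \<longrightarrow> (if c \<in> F then sure_halt machine w P n (to_nat (Return (Suc i)), Suc (length w), collapse v {0}) else b))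
    \<and> (v $ 1 \<noteq> 0 \<longrightarrow> b)"
proof -
  let ?\<delta> = "\<lambda>B. if B = {0} \<and> c \<in> F then to_nat (Return (Suc i)) else to_nat Reject"
  have shift: "nat (int (length w) + 1) = Suc (length w)" by simp
  have "set_pmf (step machine w (to_nat (Scan i c j), Suc (length w), v)) =
      (\<lambda>B. (?\<delta> B, Suc (length w), collapse v B)) ` {B. \<exists>i\<in>{0, 1}. B = {i} \<and> v $ i \<noteq> 0}"
    unfolding set_outcome_pmf_2[OF v, symmetric] using shift by (simp add: step_def add.commute)
  then have "sure_halt machine w P (Suc n) (to_nat (Scan i c j), Suc (length w), v) \<longleftrightarrow>
      (\<forall>i\<in>{0, 1}. v $ i \<noteq> 0 \<longrightarrow> sure_halt machine w P n (?\<delta> {i}, Suc (length w), collapse v {i}))"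
    by (auto simp: halted_machine)
  also have "\<dots> \<longleftrightarrow> (v $ 0 \<noteq> 0 \<longrightarrow> sure_halt machine w P n (?\<delta> {0}, Suc (length w), collapse v {0})) \<and>
      (v $ 1 \<noteq> 0 \<longrightarrow> sure_halt machine w P n (to_nat Reject, Suc (length w), collapse v {1}))"
    by simp
  finally show ?thesis using P by (simp add: halted_machine del: sure_halt.simps)
qed

text \<open>Each letter costs \<open>J\<close> operators, one move right and one move left. The 4
  stands for the start of the pass, the move off the left marker, the measurement, and the move back
  off the right marker.\<close>

definition pass_time :: "nat \<Rightarrow> nat" where
  "pass_time n = n * (J + 2) + 4"

text \<open>\<open>b = True\<close> gives termination in the stated time, \<open>b = False\<close>
  the exact condition for certain acceptance. The phase \<open>\<alpha>\<close> is what a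
  measurement leaves behind; the final \<open>+ 1\<close> is the step into the accepting
  state.\<close>

lemma passes:
  assumes w: "w \<in> lists \<Sigma>" and i: "i \<le> t" and \<alpha>: "cmod \<alpha> = 1"
    and P: "\<And>h v. P (to_nat Reject, h, v) \<longleftrightarrow> b" "\<And>h v. P (to_nat Accept, h, v)"
  shows "sure_halt machine w P ((t - i) * pass_time (length w) + 1)
      (to_nat (Return i), 0, \<alpha> \<cdot>\<^sub>v unit_vec 2 0) \<longleftrightarrow>
    b \<or> (\<forall>k. i \<le> k \<and> k < t \<longrightarrow> fst (evolve k c0 (unit_vec 2 0) w) \<in> F \<and> snd (evolve k c0 (unit_vec 2 0) w) $ 1 = 0)"
  using i \<alpha>
proof (induction i arbitrary: \<alpha> rule: inc_induct)
  case base
  show ?case using P by (auto simp: step_def halted_machine)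
next
  case (step i)
  let ?e = "unit_vec 2 0 :: complex Matrix.vec" and ?l = "length w"
  let ?v = "\<alpha> \<cdot>\<^sub>v ?e"
  let ?c' = "fst (evolve i c0 ?e w)" and ?u = "snd (evolve i c0 ?e w)"
  let ?R = "(t - Suc i) * pass_time ?l + 1"
  let ?cond = "\<lambda>k. fst (evolve k c0 ?e w) \<in> F \<and> snd (evolve k c0 ?e w) $ 1 = 0"
  have e: "unit2 ?e" "?e \<in> carrier_vec 2" by (auto simp: unit2_def)
  have v: "unit2 ?v" "?v \<in> carrier_vec 2" using step.prems by (auto simp: unit2_def norm_mult)
  have ev: "evolve i c0 ?v w = (?c', \<alpha> \<cdot>\<^sub>v ?u)"
    by (rule evolve_smult[OF step.hyps(2) c0 w e(2)])
  have u: "unit2 ?u" by (rule evolve_unit2[OF step.hyps(2) c0 w e(1)])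
  have dim: "dim_vec ?u = 2" using u by (auto simp: unit2_def)
  have u': "unit2 (\<alpha> \<cdot>\<^sub>v ?u)" using u step.prems dim by (auto simp: unit2_def norm_mult)
  have \<alpha>0: "\<alpha> \<noteq> 0" using step.prems by auto
  have time: "(t - i) * pass_time ?l + 1 = Suc (Suc (?l * Suc J + Suc (Suc ?l + ?R)))"
  proof -
    have "t - i = Suc (t - Suc i)" using step.hyps by simp
    then show ?thesis by (simp add: pass_time_def)
  qed
  have "sure_halt machine w P ((t - i) * pass_time ?l + 1) (to_nat (Return i), 0, ?v) \<longleftrightarrow>
      sure_halt machine w P (Suc (?l * Suc J + Suc (Suc ?l + ?R))) (to_nat (Scan i c0 0), 0, ?v)"
    unfolding time using step.hyps v
    by (subst sure_halt_unitary[where k = 0 and U = "1\<^sub>m 2" and c' = "to_nat (Scan i c0 0)"])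
      (auto simp: halted_machine simp del: sure_halt.simps)
  also have "\<dots> \<longleftrightarrow> sure_halt machine w P (?l * Suc J + Suc (Suc ?l + ?R)) (to_nat (Scan i c0 0), Suc (length ([] :: 'a list)), ?v)"
    using v by (subst sure_halt_unitary[where k = 1 and U = "1\<^sub>m 2" and c' = "to_nat (Scan i c0 0)"])
      (auto simp: halted_machine simp del: sure_halt.simps)
  also have "\<dots> \<longleftrightarrow> sure_halt machine w P (Suc (Suc ?l + ?R)) (to_nat (Scan i ?c' 0), Suc ?l, \<alpha> \<cdot>\<^sub>v ?u)"
    by (subst scan_word[OF step.hyps(2) c0 w v(2)]) (simp_all only: ev append_Nil fst_conv snd_conv)
  also have "\<dots> \<longleftrightarrow> (?u $ 0 \<noteq> 0 \<longrightarrow> (if ?c' \<in> F then sure_halt machine w P (Suc ?l + ?R)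
        (to_nat (Return (Suc i)), Suc ?l, collapse (\<alpha> \<cdot>\<^sub>v ?u) {0}) else b)) \<and> (?u $ 1 \<noteq> 0 \<longrightarrow> b)"
    unfolding measure_end[where P = P and b = b, OF u' P(1)] using \<alpha>0 dim by simp
  also have "\<dots> \<longleftrightarrow> (?u $ 0 \<noteq> 0 \<longrightarrow> (if ?c' \<in> F then
        b \<or> (\<forall>k. Suc i \<le> k \<and> k < t \<longrightarrow> ?cond k) else b)) \<and> (?u $ 1 \<noteq> 0 \<longrightarrow> b)"
  proof (cases "?u $ 0 = 0")
    case False
    then have "(\<alpha> \<cdot>\<^sub>v ?u) $ 0 \<noteq> 0" using \<alpha>0 dim by simp
    from collapse_0[OF u' this] obtain \<beta> where \<beta>: "cmod \<beta> = 1" "collapse (\<alpha> \<cdot>\<^sub>v ?u) {0} = \<beta> \<cdot>\<^sub>v ?e"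
      by blast
    have "sure_halt machine w P (Suc ?l + ?R) (to_nat (Return (Suc i)), Suc ?l, \<beta> \<cdot>\<^sub>v ?e) \<longleftrightarrow>
        sure_halt machine w P ?R (to_nat (Return (Suc i)), 0, \<beta> \<cdot>\<^sub>v ?e)"
      by (rule return_left) auto
    also have "\<dots> \<longleftrightarrow> b \<or> (\<forall>k. Suc i \<le> k \<and> k < t \<longrightarrow> ?cond k)" by (rule step.IH[OF \<beta>(1)])
    finally show ?thesis unfolding \<beta>(2) by simp
  qed simp
  also have "\<dots> \<longleftrightarrow> b \<or> (\<forall>k. i \<le> k \<and> k < t \<longrightarrow> ?cond k)"
  proof -
    \<comment> \<open>Excludes that both implications hold vacuously: if \<open>?u $ 1 = 0\<close>,
      then outcome 0 does occur.\<close>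
    have "?u $ 0 \<noteq> 0 \<or> ?u $ 1 \<noteq> 0" using u by (auto simp: unit2_def)
    moreover have "(\<forall>k. i \<le> k \<and> k < t \<longrightarrow> ?cond k) \<longleftrightarrow> ?cond i \<and> (\<forall>k. Suc i \<le> k \<and> k < t \<longrightarrow> ?cond k)"
      using step.hyps by (metis le_eq_less_or_eq Suc_le_eq)
    ultimately show ?thesis by (auto split: if_splits)
  qed
  finally show ?case .
qed

definition language :: "'a list set" where
  "language = {w \<in> lists \<Sigma>. \<forall>k<t. fst (evolve k c0 (unit_vec 2 0) w) \<in> F \<and>
     snd (evolve k c0 (unit_vec 2 0) w) $ 1 = 0}"

theorem language_in_coN2QCFA: "language \<in> coN2QCFA \<Sigma> (\<lambda>n. real n) 2 C_tilde"
proof -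
  define T where "T = (\<lambda>n. t * pass_time n + 1)"
  have init: "init_config machine = (to_nat (Return 0), 0, 1 \<cdot>\<^sub>v unit_vec 2 0)"
    by (simp add: init_config_def machine_def)
  have halt: "sure_halt machine w (\<lambda>_. True) (T (length w)) (init_config machine)" if "w \<in> lists \<Sigma>" for w
    using passes[OF that, of 0 1 "\<lambda>_. True" True] by (simp add: T_def init del: sure_halt.simps)
  have acc: "sure_halt machine w (\<lambda>x. fst x \<in> accepting machine) (T (length w)) (init_config machine) \<longleftrightarrow> w \<in> language"
    if "w \<in> lists \<Sigma>" for w
    using passes[OF that, of 0 1 "\<lambda>x. fst x \<in> accepting machine" False] that
    by (simp add: T_def init language_def del: sure_halt.simps)
  have disj: "accepting machine \<inter> rejecting machine = {}" by (simp add: machine_def)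
  have "(\<lambda>n. real (T n)) \<in> O(\<lambda>n. real n)"
  proof (rule bigoI)
    \<comment> \<open>\<open>T\<close> is affine with nonnegative coefficients, so
      \<open>T 1\<close> serves as slope for all \<open>n \<ge> 1\<close>.\<close>
    show "eventually (\<lambda>n. norm (real (T n)) \<le> real (T 1) * norm (real n)) at_top"
      using eventually_ge_at_top[of 1]
    proof eventually_elim
      case (elim n)
      then have "T n \<le> T 1 * n" by (cases n) (auto simp: T_def pass_time_def algebra_simps)
      then have "real (T n) \<le> real (T 1 * n)" by (simp only: of_nat_le_iff)
      then show ?case by simp
    qed
  qed
  then show ?thesis
    unfolding coN2QCFA_def
  proof (intro CollectI conjI exI[of _ machine] bexI[of _ "\<lambda>n. real (T n)"] ballI impI)
    fix w assume w: "w \<in> lists \<Sigma>"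
    show "expected_time machine w \<le> ennreal (real (T (length w)))"
      by (rule expected_time_le[OF halt[OF w]])
    show "accept_prob machine w + reject_prob machine w = 1"
      by (rule accept_reject_sum[OF halt[OF w] disj])
    show "accept_prob machine w = 1" if "w \<in> language"
      using accept_prob_eq_1[OF halt[OF w] _ disj] acc[OF w] that by blast
    show "0 < reject_prob machine w" if "w \<notin> language"
      using reject_prob_pos[OF halt[OF w]] acc[OF w] that by blast
  qed (auto simp: machine_is_two_qcfa machine_amplitudes language_def)
qed

end

section \<open>Free products of free abelian groups as unitary groups\<close>

definition fermat_base :: "nat \<Rightarrow> int" where
  "fermat_base k = 2 ^ (2 ^ k)"

lemma prime_dvd_fermat:
  assumes "prime p" "p dvd (fermat_base k)\<^sup>2 + 1"
  shows "\<not> p dvd fermat_base k" "\<not> p dvd 2"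
proof -
  show 1: "\<not> p dvd fermat_base k"
  proof
    assume "p dvd fermat_base k"
    then have "p dvd (fermat_base k)\<^sup>2" by (simp add: power2_eq_square)
    then have "p dvd 1" using assms(2) by (simp add: dvd_add_right_iff)
    then show False using assms(1) by (simp add: not_prime_unit)
  qed
  have "2 dvd fermat_base k" by (simp add: fermat_base_def)
  then show "\<not> p dvd 2" using 1 dvd_trans by blast
qed

text \<open>For \<open>x = fermat_base k\<close>, \<open>x\<^sup>2 + 1\<close> is the Fermat number
  of index \<open>k + 1\<close>. If \<open>x\<^sup>2\<close> is -1 modulo \<open>p\<close> at index
  \<open>i\<close>, repeated squaring makes it 1 at any larger index, so a second divisibility would
  force \<open>p\<close> to divide 2.\<close>

lemma prime_dvd_two_fermat:
  assumes p: "prime p" "p dvd (fermat_base i)\<^sup>2 + 1" "p dvd (fermat_base j)\<^sup>2 + 1"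
  shows "i = j"
proof -
  have False if ij: "i < j" and pi: "p dvd (fermat_base i)\<^sup>2 + 1" and pj: "p dvd (fermat_base j)\<^sup>2 + 1" for i j
  proof -
    have "fermat_base j = fermat_base i ^ (2 ^ (j - i))"
      using ij by (simp add: fermat_base_def flip: power_mult power_add)
    then have eq: "(fermat_base j)\<^sup>2 = ((fermat_base i)\<^sup>2) ^ (2 ^ (j - i))"
      by (simp add: mult.commute flip: power_mult)
    have "[(fermat_base i)\<^sup>2 = -1] (mod p)" using pi by (simp add: cong_iff_dvd_diff)
    then have "[((fermat_base i)\<^sup>2) ^ (2 ^ (j - i)) = (-1) ^ (2 ^ (j - i))] (mod p)" by (rule cong_pow)
    then have "[(fermat_base j)\<^sup>2 = 1] (mod p)" using ij by (simp add: eq)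
    then have "p dvd (fermat_base j)\<^sup>2 - 1" by (simp add: cong_iff_dvd_diff)
    then have "p dvd ((fermat_base j)\<^sup>2 + 1) - ((fermat_base j)\<^sup>2 - 1)" using pj by (rule_tac dvd_diff)
    then show False using prime_dvd_fermat(2)[OF p(1) pj] by simp
  qed
  then show ?thesis using p by (meson linorder_neqE_nat)
qed

text \<open>This is \<open>(x + i)\<^sup>2 / (x\<^sup>2 + 1)\<close> for
  \<open>x = fermat_base k\<close>: a Gaussian rational of modulus 1 whose denominator has only
  primes of one Fermat number.\<close>

definition circle_base :: "nat \<Rightarrow> complex" where
  "circle_base k = (of_int (fermat_base k) + \<i>) / (of_int (fermat_base k) - \<i>)"

definition circle_elem :: "nat \<Rightarrow> (nat \<Rightarrow> int) \<Rightarrow> complex" where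
  "circle_elem r a = (\<Prod>k<r. circle_base k powi a k)"

lemma of_int_neq_i [simp]: "complex_of_int x \<noteq> \<i>" "complex_of_int x + \<i> \<noteq> 0" "complex_of_int x + \<i> \<noteq> 0" "complex_of_int x - \<i> \<noteq> 0"
  by (simp_all add: complex_eq_iff)

lemma circle_base_nonzero [simp]: "circle_base k \<noteq> 0"
  by (simp add: circle_base_def)

lemma norm_circle_base [simp]: "cmod (circle_base k) = 1"
proof -
  have "cmod (of_int (fermat_base k) + \<i>) = cmod (cnj (of_int (fermat_base k) - \<i>))" by simp
  also have "\<dots> = cmod (of_int (fermat_base k) - \<i>)" by (rule complex_mod_cnj)
  finally show ?thesis by (simp add: circle_base_def norm_divide)
qed

lemma norm_circle_elem [simp]: "cmod (circle_elem r a) = 1"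
  by (simp add: circle_elem_def norm_power_int flip: prod_norm)

lemma circle_elem_add:
  assumes "\<And>k. k < r \<Longrightarrow> c k = a k + b k"
  shows "circle_elem r c = circle_elem r a * circle_elem r b"
  unfolding circle_elem_def prod.distrib[symmetric]
  by (rule prod.cong) (auto simp: assms power_int_add)

lemma circle_elem_0: "(\<And>k. k < r \<Longrightarrow> a k = 0) \<Longrightarrow> circle_elem r a = 1"
  by (simp add: circle_elem_def)

definition gauss_rat :: "complex \<Rightarrow> bool" where
  "gauss_rat z \<longleftrightarrow> Re z \<in> \<rat> \<and> Im z \<in> \<rat>"

lemma gauss_rat_1 [simp]: "gauss_rat 1"
  by (simp add: gauss_rat_def)

lemma gauss_rat_mult: "gauss_rat z \<Longrightarrow> gauss_rat w \<Longrightarrow> gauss_rat (z * w)"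
  by (auto simp: gauss_rat_def)

lemma gauss_rat_inverse: "gauss_rat z \<Longrightarrow> gauss_rat (inverse z)"
  by (auto simp: gauss_rat_def intro!: Rats_divide Rats_add Rats_power Rats_minus_iff[THEN iffD2])

lemma gauss_rat_power: "gauss_rat z \<Longrightarrow> gauss_rat (z ^ n)"
  by (induction n) (auto simp: gauss_rat_mult)

lemma gauss_rat_circle_elem: "gauss_rat (circle_elem r a)"
proof -
  have "gauss_rat (circle_base k)" for k
    unfolding circle_base_def divide_inverse
    by (intro gauss_rat_mult gauss_rat_inverse) (auto simp: gauss_rat_def)
  then have pw: "gauss_rat (circle_base k powi a k)" for k
    by (auto simp: power_int_def gauss_rat_power gauss_rat_inverse)
  have "gauss_rat (\<Prod>k\<in>A. circle_base k powi a k)" if "finite A" for A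
    using that by induction (auto simp: pw gauss_rat_mult)
  then show ?thesis by (simp add: circle_elem_def)
qed

text \<open>\<open>w\<close> is a Gaussian integer that reduces to \<open>v\<close> modulo \<open>p\<close> when \<open>i\<close> is sent to \<open>s\<close>.\<close>

definition gauss_red :: "int \<Rightarrow> int \<Rightarrow> complex \<Rightarrow> int \<Rightarrow> bool" where
  "gauss_red p s w v \<longleftrightarrow> (\<exists>A B. w = of_int A + of_int B * \<i> \<and> [A + s * B = v] (mod p))"

lemma gauss_red_mult:
  assumes s: "[s * s = -1] (mod p)" and "gauss_red p s w v" "gauss_red p s w' v'"
  shows "gauss_red p s (w * w') (v * v')"
proof -
  obtain A B A' B' where AB: "w = of_int A + of_int B * \<i>" "[A + s * B = v] (mod p)"
    "w' = of_int A' + of_int B' * \<i>" "[A' + s * B' = v'] (mod p)"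
    using assms(2,3) unfolding gauss_red_def by auto
  have "[(A * A' + s * (A * B' + B * A')) + (-1) * (B * B') =
      (A * A' + s * (A * B' + B * A')) + (s * s) * (B * B')] (mod p)"
    using s by (intro cong_add cong_mult) (auto intro: cong_sym)
  also have "(A * A' + s * (A * B' + B * A')) + (s * s) * (B * B') = (A + s * B) * (A' + s * B')"
    by (simp add: algebra_simps)
  also have "[(A + s * B) * (A' + s * B') = v * v'] (mod p)" using AB by (intro cong_mult)
  finally have "[(A * A' - B * B') + s * (A * B' + B * A') = v * v'] (mod p)" by (simp add: algebra_simps)
  moreover have "w * w' = of_int (A * A' - B * B') + of_int (A * B' + B * A') * \<i>"
    using AB by (simp add: complex_eq_iff)
  ultimately show ?thesis unfolding gauss_red_def by blast
qed

lemma gauss_red_power: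
  assumes s: "[s * s = -1] (mod p)" and w: "gauss_red p s w v"
  shows "gauss_red p s (w ^ n) (v ^ n)"
proof (induction n)
  case 0
  show ?case unfolding gauss_red_def by (intro exI[of _ 1] exI[of _ 0]) auto
next
  case (Suc n)
  then show ?case using gauss_red_mult[OF s w] by simp
qed

lemma gauss_red_prod:
  assumes s: "[s * s = -1] (mod p)" and "finite I" "\<And>i. i \<in> I \<Longrightarrow> gauss_red p s (w i) (v i)"
  shows "gauss_red p s (\<Prod>i\<in>I. w i) (\<Prod>i\<in>I. v i)"
  using assms(2,3)
proof (induction I)
  case empty
  show ?case unfolding gauss_red_def by (intro exI[of _ 1] exI[of _ 0]) auto
next
  case (insert x F)
  then show ?case using gauss_red_mult[OF s] by simp
qed

text \<open>For a negative exponent the inverse of \<open>circle_base k\<close> is its conjugate,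
  whence the sign \<open>e\<close>.\<close>

lemma circle_base_powi:
  fixes a :: int and k :: nat
  defines "x \<equiv> fermat_base k" and "e \<equiv> (if a \<ge> 0 then 1 else -1 :: int)"
  shows "circle_base k powi a * of_int ((x\<^sup>2 + 1) ^ nat \<bar>a\<bar>) = (of_int x + of_int e * \<i>) ^ (2 * nat \<bar>a\<bar>)"
proof -
  have N: "complex_of_int (x\<^sup>2 + 1) = (of_int x + \<i>) * (of_int x - \<i>)"
    by (simp add: algebra_simps power2_eq_square)
  show ?thesis
  proof (cases "a \<ge> 0")
    case True
    have "circle_base k * of_int (x\<^sup>2 + 1) = (of_int x + \<i>)\<^sup>2"
      unfolding N by (simp add: circle_base_def x_def power2_eq_square)
    then have "(circle_base k * of_int (x\<^sup>2 + 1)) ^ nat a = (of_int x + \<i>) ^ (2 * nat a)"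
      by (simp only: power_mult)
    then show ?thesis using True by (simp add: e_def power_int_def power_mult_distrib)
  next
    case False
    have "inverse (circle_base k) * of_int (x\<^sup>2 + 1) = (of_int x - \<i>)\<^sup>2"
      unfolding N by (simp add: circle_base_def x_def power2_eq_square)
    then have "(inverse (circle_base k) * of_int (x\<^sup>2 + 1)) ^ nat (- a) = (of_int x - \<i>) ^ (2 * nat (- a))"
      by (simp only: power_mult)
    then show ?thesis using False by (simp add: e_def power_int_def power_mult_distrib)
  qed
qed

text \<open>Clear denominators and reduce modulo a prime \<open>p\<close> of the Fermat number of
  \<open>k\<close>, sending \<open>i\<close> to a square root of -1. The integer side becomes 0,
  while no factor of the Gaussian side does.\<close>

lemma circle_elem_eq_1:
  assumes eq: "circle_elem r a = 1" and k: "k < r"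
  shows "a k = 0"
proof (rule ccontr)
  assume ak: "a k \<noteq> 0"
  define e where "e = (\<lambda>k. if a k \<ge> 0 then 1 else -1 :: int)"
  let ?x = fermat_base and ?b = "\<lambda>k. nat \<bar>a k\<bar>"
  let ?N = "\<lambda>k. (?x k)\<^sup>2 + 1"
  have x0: "?x k \<noteq> 0" by (simp add: fermat_base_def)
  have "\<not> is_unit (?N k)"
  proof
    assume "is_unit (?N k)"
    then have "\<bar>?N k\<bar> = 1" by (simp add: zdvd1_eq)
    then have "(?x k)\<^sup>2 = 0" using zero_le_power2[of "?x k"] by linarith
    then show False using x0 by simp
  qed
  moreover have "?N k \<noteq> 0" using zero_le_power2[of "?x k"] by linarith
  ultimately obtain p where p: "prime p" "p dvd ?N k" using prime_divisor_exists by blast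
  \<comment> \<open>Of the two square roots of -1 modulo \<open>p\<close>, this one sends the factor
    of index \<open>k\<close> to \<open>2 * ?x k\<close>; the other one would send it to 0.\<close>
  define s where "s = e k * ?x k"
  have "e k * e k = 1" by (simp add: e_def)
  then have ss: "s * s = (?x k)\<^sup>2"
    by (auto simp: s_def power2_eq_square e_def)
  have s: "[s * s = -1] (mod p)" unfolding ss using p(2) by (simp add: cong_iff_dvd_diff)
  have "of_int (\<Prod>k<r. ?N k ^ ?b k) = circle_elem r a * of_int (\<Prod>k<r. ?N k ^ ?b k)" by (simp only: eq mult_1)
  also have "\<dots> = (\<Prod>k<r. circle_base k powi a k * of_int (?N k ^ ?b k))"
    by (simp only: circle_elem_def of_int_prod prod.distrib)
  also have "\<dots> = (\<Prod>k<r. (of_int (?x k) + of_int (e k) * \<i>) ^ (2 * ?b k))"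
    by (simp only: circle_base_powi e_def)
  finally have prod: "of_int (\<Prod>k<r. ?N k ^ ?b k) = (\<Prod>k<r. (of_int (?x k) + of_int (e k) * \<i>) ^ (2 * ?b k))" .
  have gred: "gauss_red p s (of_int (?x k) + of_int (e k) * \<i>) (?x k + s * e k)" for k
    unfolding gauss_red_def by (rule exI[of _ "?x k"], rule exI[of _ "e k"]) simp
  have "gauss_red p s (\<Prod>k<r. (of_int (?x k) + of_int (e k) * \<i>) ^ (2 * ?b k)) (\<Prod>k<r. (?x k + s * e k) ^ (2 * ?b k))"
    by (intro gauss_red_prod gauss_red_power s gred) auto
  then obtain A B where AB: "complex_of_int (\<Prod>k<r. ?N k ^ ?b k) = of_int A + of_int B * \<i>"
    "[A + s * B = (\<Prod>k<r. (?x k + s * e k) ^ (2 * ?b k))] (mod p)"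
    unfolding gauss_red_def prod by blast
  have "B = 0" using arg_cong[OF AB(1), of Im] by (simp del: of_int_prod)
  moreover have "A = (\<Prod>k<r. ?N k ^ ?b k)" using arg_cong[OF AB(1), of Re] by (simp del: of_int_prod)
  moreover have "p dvd (\<Prod>k<r. ?N k ^ ?b k)"
  proof -
    have "p dvd ?N k ^ ?b k" using p(2) ak by (intro dvd_power_le[of p "?N k" 1 "?b k", simplified]) auto
    also have "?N k ^ ?b k dvd (\<Prod>k<r. ?N k ^ ?b k)"
      using k dvd_prodI[of "{..<r}" k "\<lambda>k. ?N k ^ ?b k"] by simp
    finally show ?thesis .
  qed
  ultimately have "p dvd (\<Prod>k<r. (?x k + s * e k) ^ (2 * ?b k))"
    using AB(2) by (simp add: cong_dvd_iff)
  then obtain l where l: "l < r" "p dvd ?x l + s * e l"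
    using p(1) by (auto simp: prime_dvd_prod_iff dest: prime_dvd_power)
  show False
  proof (cases "l = k")
    case True
    have "s * e k = ?x k" using \<open>e k * e k = 1\<close> by (auto simp: s_def e_def)
    then have "p dvd 2 * ?x k" using l(2) True by simp
    then show False using p prime_dvd_fermat[OF p] by (simp add: prime_dvd_mult_iff)
  next
    case False
    have "e l * e l = 1" by (simp add: e_def)
    then have "(?x l + s * e l) * (?x l - s * e l) = (?x l)\<^sup>2 - s * s"
      by (simp add: algebra_simps power2_eq_square)
    then have "p dvd (?x l)\<^sup>2 - (?x k)\<^sup>2" using l(2) ss by (metis dvd_mult2)
    \<comment> \<open>The sum is \<open>(?x l)\<^sup>2 + 1\<close>, so \<open>p\<close> divides the
      Fermat numbers of two different indices.\<close>
    then have "p dvd ((?x l)\<^sup>2 - (?x k)\<^sup>2) + ?N k" using p(2) by (rule dvd_add)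
    then show False using prime_dvd_two_fermat[OF p(1) _ p(2), of l] False by simp
  qed
qed

text \<open>A real or purely imaginary number of modulus 1 has fourth power 1, but the fourth power
  is the element with exponents \<open>4 * a k\<close>.\<close>

lemma circle_elem_Re_Im_nonzero:
  assumes "k < r" "a k \<noteq> 0"
  shows "Re (circle_elem r a) \<noteq> 0" "Im (circle_elem r a) \<noteq> 0"
proof -
  let ?z = "circle_elem r a"
  have 4: "?z ^ 4 \<noteq> 1"
  proof
    assume "?z ^ 4 = 1"
    moreover have "circle_elem r (\<lambda>k. 4 * a k) = ?z ^ 4"
    proof -
      have "circle_elem r (\<lambda>k. 4 * a k) = (?z * ?z) * (?z * ?z)"
        by (subst circle_elem_add[where a = "\<lambda>k. 2 * a k" and b = "\<lambda>k. 2 * a k"], simp,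
            subst (1 2) circle_elem_add[where a = a and b = a]) simp_all
      then show ?thesis by (simp add: power4_eq_xxxx mult.assoc)
    qed
    ultimately have "4 * a k = 0" using circle_elem_eq_1[of r "\<lambda>k. 4 * a k" k] assms by simp
    then show False using assms by simp
  qed
  have norm: "(Re ?z)\<^sup>2 + (Im ?z)\<^sup>2 = 1" using cmod_power2[of ?z] by simp
  show "Re ?z \<noteq> 0"
  proof
    assume "Re ?z = 0"
    then have "?z\<^sup>2 = -1" using norm by (simp add: complex_eq_iff power2_eq_square)
    then have "(?z\<^sup>2)\<^sup>2 = 1" by simp
    then show False using 4 by (simp flip: power_mult)
  qed
  show "Im ?z \<noteq> 0"
  proof
    assume "Im ?z = 0"
    then have "?z\<^sup>2 = 1" using norm by (simp add: complex_eq_iff power2_eq_square)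
    then have "(?z\<^sup>2)\<^sup>2 = 1" by simp
    then show False using 4 by (simp flip: power_mult)
  qed
qed

section \<open>Action of free product words on pairs\<close>

lemma tau_cnj [simp]: "tau ^ j * cnj tau ^ j = 1" "cnj tau ^ j * tau ^ j = 1"
proof -
  have "tau * cnj tau = 1" by (simp add: complex_norm_square[symmetric])
  then show "tau ^ j * cnj tau ^ j = 1" by (simp flip: power_mult_distrib)
  then show "cnj tau ^ j * tau ^ j = 1" by (simp add: mult.commute)
qed

text \<open>\<open>D ^ j\<close>, the real rotation by the argument of \<open>z\<close>, and the
  inverse of \<open>D ^ j\<close>, multiplied in this order and applied to the column
  \<open>(p, q)\<close>; \<open>cnj tau\<close> is the inverse of \<open>tau\<close>.\<close>

fun letter_act :: "(nat \<Rightarrow> nat) \<Rightarrow> nat \<times> (nat \<Rightarrow> int) \<Rightarrow> complex \<times> complex \<Rightarrow> complex \<times> complex" where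
  "letter_act \<rho> (j, a) (p, q) = (let z = circle_elem (\<rho> j) a; p' = cnj tau ^ j * p in
     (tau ^ j * (of_real (Re z) * p' - of_real (Im z) * q), of_real (Im z) * p' + of_real (Re z) * q))"

lemma letter_act_1:
  assumes "\<And>k. k < \<rho> j \<Longrightarrow> a k = 0"
  shows "letter_act \<rho> (j, a) s = s"
  using circle_elem_0[of "\<rho> j" a] assms by (cases s) (simp add: mult.assoc[symmetric])

lemma letter_act_mult:
  assumes "\<And>k. k < \<rho> j \<Longrightarrow> c k = a k + b k"
  shows "letter_act \<rho> (j, b) (letter_act \<rho> (j, a) s) = letter_act \<rho> (j, c) s"
proof -
  obtain p q where s: "s = (p, q)" by (cases s)
  have z: "circle_elem (\<rho> j) c = circle_elem (\<rho> j) a * circle_elem (\<rho> j) b"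
    using assms by (rule circle_elem_add)
  have 1: "cnj tau ^ j * (tau ^ j * x) = x" for x by (simp add: mult.assoc[symmetric])
  show ?thesis
    by (simp add: s z Let_def 1) (simp add: algebra_simps)
qed

lemma fp_rel_letter_act:
  assumes "(u, v) \<in> fp_rel I (\<lambda>j. int_power_group (\<rho> j))"
  shows "fold (letter_act \<rho>) u s = fold (letter_act \<rho>) v s"
  using assms
proof (induction arbitrary: s)
  case (fp_one u v i)
  have "letter_act \<rho> (i, \<one>\<^bsub>int_power_group (\<rho> i)\<^esub>) s' = s'" for s'
    by (rule letter_act_1) (simp add: int_power_group_def)
  then show ?case by simp
next
  case (fp_mult u v i a b)
  have "letter_act \<rho> (i, b) (letter_act \<rho> (i, a) s') = letter_act \<rho> (i, a \<otimes>\<^bsub>int_power_group (\<rho> i)\<^esub> b) s'" for s'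
    by (rule letter_act_mult) (simp add: int_power_group_def)
  then show ?case by simp
qed auto

definition fp_reduced :: "('i \<Rightarrow> ('a, 'b) monoid_scheme) \<Rightarrow> ('i \<times> 'a) list \<Rightarrow> bool" where
  "fp_reduced H v \<longleftrightarrow> (\<forall>(i, a)\<in>set v. a \<noteq> \<one>\<^bsub>H i\<^esub>) \<and> distinct_adj (map fst v)"

lemma not_distinct_adj_mapD:
  "\<not> distinct_adj (map f xs) \<Longrightarrow> \<exists>u x y v. xs = u @ x # y # v \<and> f x = f y"
proof (induction xs)
  case (Cons x xs)
  show ?case
  proof (cases "distinct_adj (map f xs)")
    case True
    then obtain y ys where "xs = y # ys" "f x = f y" using Cons.prems by (cases xs) auto
    then show ?thesis by (intro exI[of _ "[]"]) auto
  next
    case False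
    with Cons.IH obtain u y z v where "xs = u @ y # z # v" "f y = f z" by blast
    then show ?thesis by (intro exI[of _ "x # u"]) auto
  qed
qed simp

text \<open>Deleting an identity letter and merging two neighbours from one factor both shorten the
  word.\<close>

lemma fp_reduce:
  assumes gr: "\<And>i. i \<in> I \<Longrightarrow> group (H i)"
  shows "u \<in> fp_words I H \<Longrightarrow> \<exists>v. (u, v) \<in> fp_rel I H \<and> fp_reduced H v"
proof (induction "length u" arbitrary: u rule: less_induct)
  case less
  show ?case
  proof (cases "fp_reduced H u")
    case True
    then show ?thesis using less.prems fp_refl by blast
  next
    case False
    then consider i where "(i, \<one>\<^bsub>H i\<^esub>) \<in> set u" | "\<not> distinct_adj (map fst u)"
      unfolding fp_reduced_def by blast
    then obtain u' where u': "(u, u') \<in> fp_rel I H" "length u' < length u"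
    proof cases
      case 1
      then obtain x y where u: "u = x @ (i, \<one>\<^bsub>H i\<^esub>) # y" by (meson split_list)
      then have "(u, x @ y) \<in> fp_rel I H" using less.prems fp_one[of x I H y i] by auto
      then show ?thesis using that u by auto
    next
      case 2
      then obtain x l l' y where u: "u = x @ l # l' # y" "fst l = fst l'"
        using not_distinct_adj_mapD by blast
      obtain i a b where l: "l = (i, a)" "l' = (i, b)" using u(2) by (cases l; cases l') auto
      have "(u, x @ [(i, a \<otimes>\<^bsub>H i\<^esub> b)] @ y) \<in> fp_rel I H"
        using less.prems u l fp_mult[of x I H y i a b] by auto
      then show ?thesis using that u by auto
    qed
    have "u' \<in> fp_words I H" using fp_rel_words[OF gr u'(1)] by simp
    then obtain v where "(u', v) \<in> fp_rel I H" "fp_reduced H v" using less.hyps u'(2) by blast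
    then show ?thesis using u'(1) fp_trans by blast
  qed
qed

text \<open>
  The two components are, up to a power of \<open>tau\<close>, polynomials in \<open>tau\<close> of the same degree. Passing
  to a letter of a different factor multiplies them by different powers of \<open>tau\<close> before mixing them
  with nonzero weights, so that no cancellation of leading terms occurs.
\<close>

definition leading_balanced :: "nat \<Rightarrow> complex \<times> complex \<Rightarrow> bool" where
  "leading_balanced j s \<longleftrightarrow> (\<exists>N P Q. (\<forall>i. coeff P i \<in> \<rat>) \<and> (\<forall>i. coeff Q i \<in> \<rat>) \<and> P \<noteq> 0 \<and> Q \<noteq> 0 \<and>
     degree P = degree Q \<and> tau ^ N * fst s = tau ^ j * poly P tau \<and> tau ^ N * snd s = poly Q tau)"

lemma of_real_Rats: "x \<in> \<rat> \<Longrightarrow> complex_of_real x \<in> \<rat>"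
  by (auto elim!: Rats_cases')

lemma letter_act_balanced_start:
  assumes "k < \<rho> j" "a k \<noteq> 0"
  shows "leading_balanced j (letter_act \<rho> (j, a) (1, 0))"
proof -
  let ?z = "circle_elem (\<rho> j) a"
  have nz: "Re ?z \<noteq> 0" "Im ?z \<noteq> 0" using circle_elem_Re_Im_nonzero[of k "\<rho> j" a] assms by auto
  have rat: "complex_of_real (Re ?z) \<in> \<rat>" "complex_of_real (Im ?z) \<in> \<rat>"
    using gauss_rat_circle_elem[of "\<rho> j" a] by (auto simp: gauss_rat_def of_real_Rats)
  have 1: "tau ^ j * (cnj tau ^ j * x) = x" for x by (simp add: mult.assoc[symmetric])
  show ?thesis unfolding leading_balanced_def
  \<comment> \<open>From \<open>(1, 0)\<close> both polynomials are constants, the cosine and the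
    sine of the rotation.\<close>
  proof (rule exI[of _ j], rule exI[of _ "[:complex_of_real (Re ?z):]"],
      rule exI[of _ "[:complex_of_real (Im ?z):]"], intro conjI)
    show "tau ^ j * fst (letter_act \<rho> (j, a) (1, 0)) = tau ^ j * poly [:complex_of_real (Re ?z):] tau"
      using 1[of "complex_of_real (Re ?z)"] 1[of "complex_of_real (Im ?z)"]
      by (simp add: Let_def mult_ac)
    show "tau ^ j * snd (letter_act \<rho> (j, a) (1, 0)) = poly [:complex_of_real (Im ?z):] tau"
      using 1[of "complex_of_real (Re ?z)"] 1[of "complex_of_real (Im ?z)"]
      by (simp add: Let_def mult_ac)
  qed (use nz rat in \<open>auto simp: coeff_pCons split: nat.splits\<close>)
qed

lemma degree_monom_mult_poly: "P \<noteq> 0 \<Longrightarrow> c \<noteq> 0 \<Longrightarrow> degree (monom (c :: complex) n * P) = n + degree P"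
  by (simp add: degree_mult_eq degree_monom_eq)

lemma letter_act_balanced:
  assumes s: "leading_balanced j' s" and j: "j \<noteq> j'" and a: "k < \<rho> j" "a k \<noteq> 0"
  shows "leading_balanced j (letter_act \<rho> (j, a) s)"
proof -
  let ?z = "circle_elem (\<rho> j) a"
  define c d where "c = complex_of_real (Re ?z)" and "d = complex_of_real (Im ?z)"
  have nz: "c \<noteq> 0" "d \<noteq> 0" using circle_elem_Re_Im_nonzero[of k "\<rho> j" a] a by (auto simp: c_def d_def)
  have rat: "c \<in> \<rat>" "d \<in> \<rat>"
    using gauss_rat_circle_elem[of "\<rho> j" a] by (auto simp: gauss_rat_def of_real_Rats c_def d_def)
  obtain N P Q where PQ: "\<And>i. coeff P i \<in> \<rat>" "\<And>i. coeff Q i \<in> \<rat>" "P \<noteq> 0" "Q \<noteq> 0" "degree P = degree Q"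
    "tau ^ N * fst s = tau ^ j' * poly P tau" "tau ^ N * snd s = poly Q tau"
    using s unfolding leading_balanced_def by blast
  obtain p q where pq: "s = (p, q)" by (cases s)
  \<comment> \<open>The summands have degrees \<open>j' + degree P\<close> and
    \<open>j + degree P\<close>, which differ, so the larger one survives for all nonzero
    weights.\<close>
  have deg: "degree (monom x j' * P + monom y j * Q) = max j j' + degree P" if "x \<noteq> 0" "y \<noteq> 0" for x y
  proof (cases "j < j'")
    case True
    then show ?thesis using that PQ by (subst degree_add_eq_left) (auto simp: degree_monom_mult_poly)
  next
    case False
    then show ?thesis using that j PQ by (subst degree_add_eq_right) (auto simp: degree_monom_mult_poly)
  qed
  have nz2: "monom x j' * P + monom y j * Q \<noteq> 0" if "x \<noteq> 0" "y \<noteq> 0" for x y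
  proof
    assume z: "monom x j' * P + monom y j * Q = 0"
    then have "monom x j' * P = - (monom y j * Q)" by (simp add: eq_neg_iff_add_eq_0)
    then have "degree (monom x j' * P) = degree (monom y j * Q)" by (metis degree_minus)
    then show False using that PQ j by (simp add: degree_monom_mult_poly)
  qed
  have rat2: "coeff (monom x j' * P + monom y j * Q) i \<in> \<rat>" if "x \<in> \<rat>" "y \<in> \<rat>" for x y i
    using that PQ by (auto simp: coeff_monom_mult)
  have P': "tau ^ N * p = tau ^ j' * poly P tau" and Q': "tau ^ N * q = poly Q tau"
    using PQ by (auto simp: pq)
  have cn: "tau ^ (N + j) * (cnj tau ^ j * p) = tau ^ j' * poly P tau"
  proof -
    have "tau ^ (N + j) * (cnj tau ^ j * p) = (tau ^ j * cnj tau ^ j) * (tau ^ N * p)"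
      by (simp only: power_add mult_ac)
    then show ?thesis by (simp add: P')
  qed
  have qn: "tau ^ (N + j) * q = tau ^ j * poly Q tau"
    by (simp add: power_add mult.assoc mult.left_commute[of "tau ^ N"] Q')
  show ?thesis unfolding leading_balanced_def
  \<comment> \<open>The additional \<open>j\<close> compensates the factor
    \<open>cnj tau ^ j\<close> on the first component; the second one then carries
    \<open>tau ^ j\<close>.\<close>
  proof (rule exI[of _ "N + j"], rule exI[of _ "monom c j' * P + monom (-d) j * Q"],
      rule exI[of _ "monom d j' * P + monom c j * Q"], intro conjI allI)
    have "tau ^ (N + j) * fst (letter_act \<rho> (j, a) s) =
        tau ^ j * (c * (tau ^ (N + j) * (cnj tau ^ j * p)) - d * (tau ^ (N + j) * q))"
      by (simp add: pq Let_def c_def d_def algebra_simps)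
    also have "\<dots> = tau ^ j * poly (monom c j' * P + monom (-d) j * Q) tau"
      unfolding cn qn by (simp add: poly_monom algebra_simps)
    finally show "tau ^ (N + j) * fst (letter_act \<rho> (j, a) s) =
        tau ^ j * poly (monom c j' * P + monom (-d) j * Q) tau" .
    have "tau ^ (N + j) * snd (letter_act \<rho> (j, a) s) =
        d * (tau ^ (N + j) * (cnj tau ^ j * p)) + c * (tau ^ (N + j) * q)"
      by (simp add: pq Let_def c_def d_def algebra_simps)
    also have "\<dots> = poly (monom d j' * P + monom c j * Q) tau"
      unfolding cn qn by (simp add: poly_monom algebra_simps)
    finally show "tau ^ (N + j) * snd (letter_act \<rho> (j, a) s) = poly (monom d j' * P + monom c j * Q) tau" .
    show "degree (monom c j' * P + monom (- d) j * Q) = degree (monom d j' * P + monom c j * Q)"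
      using deg[of c "-d"] deg[of d c] nz by simp
  qed (use nz2 rat2 nz rat in auto)
qed

text \<open>This is where the transcendence of \<open>tau\<close> enters: it is no root of the
  nonzero rational polynomial \<open>Q\<close>.\<close>

lemma leading_balanced_snd_nonzero:
  assumes "leading_balanced j s"
  shows "snd s \<noteq> 0"
proof
  assume "snd s = 0"
  then obtain Q where "\<And>i. coeff Q i \<in> \<rat>" "Q \<noteq> 0" "poly Q tau = 0"
    using assms unfolding leading_balanced_def by auto
  then have "algebraic tau" by (rule algebraicI')
  then show False using tau_not_algebraic by simp
qed

lemma int_power_group_nontrivial:
  assumes "a \<in> carrier (int_power_group r)" "a \<noteq> \<one>\<^bsub>int_power_group r\<^esub>"
  shows "\<exists>k<r. a k \<noteq> 0"
proof (rule ccontr)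
  assume "\<not> (\<exists>k<r. a k \<noteq> 0)"
  then have "a = \<one>\<^bsub>int_power_group r\<^esub>"
    using assms(1) by (auto simp: int_power_group_def fun_eq_iff PiE_def extensional_def)
  then show False using assms(2) by simp
qed

text \<open>The last letter acts last, hence the induction from the right; reducedness provides the
  change of factor that \<open>letter_act_balanced\<close> requires.\<close>

lemma reduced_word_balanced:
  assumes "v \<in> fp_words I (\<lambda>j. int_power_group (\<rho> j))" "fp_reduced (\<lambda>j. int_power_group (\<rho> j)) v" "v \<noteq> []"
  shows "leading_balanced (fst (last v)) (fold (letter_act \<rho>) v (1, 0))"
  using assms
proof (induction v rule: rev_induct)
  case (snoc x v)
  obtain j a where x: "x = (j, a)" by (cases x)
  have "a \<in> carrier (int_power_group (\<rho> j))" "a \<noteq> \<one>\<^bsub>int_power_group (\<rho> j)\<^esub>"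
    using snoc.prems x by (auto simp: fp_reduced_def)
  then obtain k where k: "k < \<rho> j" "a k \<noteq> 0" using int_power_group_nontrivial by blast
  show ?case
  proof (cases "v = []")
    case True
    then show ?thesis using letter_act_balanced_start[of k \<rho> j a] k x by (simp del: letter_act.simps)
  next
    case False
    have red: "fp_reduced (\<lambda>j. int_power_group (\<rho> j)) v" and "fst (last v) \<noteq> j"
      using snoc.prems(2) False x by (auto simp: fp_reduced_def distinct_adj_append_iff last_map)
    then show ?thesis
      using letter_act_balanced[OF snoc.IH[OF _ red False], of j k \<rho> a] snoc.prems(1) k x
      by (auto simp del: letter_act.simps)
  qed
qed simp

lemma group_int_power_group: "group (int_power_group r)"
  unfolding int_power_group_def by (simp add: product_group)

text \<open>An equivalent reduced word acts in the same way, and a nonempty one would give a nonzero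
  second component.\<close>

theorem letter_act_faithful:
  assumes u: "u \<in> fp_words I (\<lambda>j. int_power_group (\<rho> j))"
  shows "snd (fold (letter_act \<rho>) u (1, 0)) = 0 \<longleftrightarrow> (u, []) \<in> fp_rel I (\<lambda>j. int_power_group (\<rho> j))"
    (is "?L \<longleftrightarrow> ?R")
proof
  assume ?R
  then show ?L using fp_rel_letter_act[of u "[]"] by simp
next
  assume L: ?L
  obtain v where v: "(u, v) \<in> fp_rel I (\<lambda>j. int_power_group (\<rho> j))"
    "fp_reduced (\<lambda>j. int_power_group (\<rho> j)) v"
    using fp_reduce[of I "\<lambda>j. int_power_group (\<rho> j)", OF group_int_power_group u] by blast
  have vw: "v \<in> fp_words I (\<lambda>j. int_power_group (\<rho> j))"
    using fp_rel_words[OF group_int_power_group v(1)] by simp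
  have "v = []"
  proof (rule ccontr)
    assume "v \<noteq> []"
    from leading_balanced_snd_nonzero[OF reduced_word_balanced[OF vw v(2) this]]
    show False using L fp_rel_letter_act[OF v(1)] by simp
  qed
  then show ?R using v(1) by simp
qed

section \<open>Reduction of the word problem to the passes\<close>

definition vec2 :: "complex \<times> complex \<Rightarrow> complex Matrix.vec" where
  "vec2 s = Matrix.vec 2 (\<lambda>i. if i = 0 then fst s else snd s)"

definition mat2 :: "complex \<Rightarrow> complex \<Rightarrow> complex \<Rightarrow> complex \<Rightarrow> complex mat" where
  "mat2 a b c d = mat 2 2 (\<lambda>(i, j). if i = 0 then (if j = 0 then a else b) else (if j = 0 then c else d))"

lemma vec2_carrier [simp]: "vec2 s \<in> carrier_vec 2"
  by (simp add: vec2_def)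

lemma vec2_nth [simp]: "vec2 s $ 0 = fst s" "vec2 s $ Suc 0 = snd s"
  by (simp_all add: vec2_def)

lemma mat2_carrier [simp]: "mat2 a b c d \<in> carrier_mat 2 2"
  by (simp add: mat2_def)

lemma mat2_nth [simp]:
  "mat2 a b c d $$ (0, 0) = a" "mat2 a b c d $$ (0, Suc 0) = b"
  "mat2 a b c d $$ (Suc 0, 0) = c" "mat2 a b c d $$ (Suc 0, Suc 0) = d"
  by (simp_all add: mat2_def)

lemma less_2_cases: "(i :: nat) < 2 \<longleftrightarrow> i = 0 \<or> i = Suc 0"
  by auto

lemma mat2_mult_vec2: "mat2 a b c d *\<^sub>v vec2 s = vec2 (a * fst s + b * snd s, c * fst s + d * snd s)"
proof (rule eq_vecI)
  fix i assume "i < dim_vec (vec2 (a * fst s + b * snd s, c * fst s + d * snd s))"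
  then have i: "i < 2" by (simp add: vec2_def)
  show "(mat2 a b c d *\<^sub>v vec2 s) $ i = vec2 (a * fst s + b * snd s, c * fst s + d * snd s) $ i"
    unfolding mat_mult_vec_2[OF mat2_carrier vec2_carrier i] using i by (auto simp: less_2_cases)
qed (simp add: vec2_def mat2_def)

lemma mat2_mult: "mat2 a b c d * mat2 a' b' c' d' = mat2 (a * a' + b * c') (a * b' + b * d') (c * a' + d * c') (c * b' + d * d')"
  by (rule eq_matI) (auto simp: mat2_def scalar_prod_def numeral_2_eq_2 less_Suc_eq)

lemma mat2_one: "mat2 1 0 0 1 = 1\<^sub>m 2"
  by (rule eq_matI) (auto simp: mat2_def less_2_cases)

lemma mat2_adjoint: "mat_adjoint (mat2 a b c d) = mat2 (cnj a) (cnj c) (cnj b) (cnj d)"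
  by (rule eq_matI) (auto simp: mat2_def mat_adjoint_def mat_of_rows_index less_2_cases)

lemma unitary_diag: "cmod x = 1 \<Longrightarrow> unitary_mat 2 (mat2 x 0 0 1)"
  by (simp add: unitary_mat_def mat2_adjoint mat2_mult mat2_one complex_norm_square[symmetric] mult.commute[of "cnj x"])

lemma unitary_rotation:
  assumes "cmod z = 1"
  shows "unitary_mat 2 (mat2 (of_real (Re z)) (- of_real (Im z)) (of_real (Im z)) (of_real (Re z)))"
proof -
  have "complex_of_real (Re z) * of_real (Re z) + of_real (Im z) * of_real (Im z) = of_real ((Re z)\<^sup>2 + (Im z)\<^sup>2)"
    by (simp add: power2_eq_square)
  also have "\<dots> = 1" using cmod_power2[of z] assms by simp
  finally show ?thesis
    by (simp add: unitary_mat_def mat2_adjoint mat2_mult add.commute mat2_one flip: mat2_one)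
qed

text \<open>The three factors are applied separately because each has entries in
  \<open>C_tilde\<close>; an entry of their product, a rational multiple of \<open>tau ^ j\<close>,
  need not lie there.\<close>

fun letter_ops :: "(nat \<Rightarrow> nat) \<Rightarrow> nat \<times> (nat \<Rightarrow> int) \<Rightarrow> complex mat list" where
  "letter_ops \<rho> (j, a) = (let z = circle_elem (\<rho> j) a in
     [mat2 (cnj tau ^ j) 0 0 1,
      mat2 (of_real (Re z)) (- of_real (Im z)) (of_real (Im z)) (of_real (Re z)),
      mat2 (tau ^ j) 0 0 1])"

abbreviation word_ops :: "(nat \<Rightarrow> nat) \<Rightarrow> (nat \<times> (nat \<Rightarrow> int)) list \<Rightarrow> complex mat list" where
  "word_ops \<rho> u \<equiv> concat (map (letter_ops \<rho>) u)"

lemma apply_letter_ops: "apply_ops (letter_ops \<rho> x) (vec2 s) = vec2 (letter_act \<rho> x s)"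
proof -
  obtain j a where "x = (j, a)" by (cases x)
  moreover obtain p q where "s = (p, q)" by (cases s)
  ultimately show ?thesis by (simp add: Let_def mat2_mult_vec2)
qed

lemma apply_word_ops: "apply_ops (word_ops \<rho> u) (vec2 s) = vec2 (fold (letter_act \<rho>) u s)"
  by (induction u arbitrary: s) (simp_all add: apply_letter_ops del: letter_act.simps letter_ops.simps)

lemma algebraic_sqrt_2_mult: "algebraic (sqrt 2 * of_int k :: real)"
proof (rule algebraicI)
  show "poly [:- of_int (2 * k\<^sup>2), 0, 1:] (sqrt 2 * of_int k :: real) = 0"
    by (simp add: power2_eq_square[symmetric] power_mult_distrib flip: mult.assoc)
qed (auto simp: coeff_pCons split: nat.splits)

lemma tau_power_C_tilde: "tau ^ j \<in> C_tilde" "cnj tau ^ j \<in> C_tilde"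
proof -
  have 1: "tau ^ j = exp (complex_of_real (pi * (sqrt 2 * of_int (int j))) * \<i>)"
    by (simp add: tau_def mult_ac flip: exp_of_nat_mult)
  have 2: "cnj tau ^ j = exp (complex_of_real (pi * (sqrt 2 * of_int (- int j))) * \<i>)"
    by (simp add: tau_def exp_cnj mult_ac flip: exp_of_nat_mult)
  show "tau ^ j \<in> C_tilde" "cnj tau ^ j \<in> C_tilde"
    unfolding 1 2 C_tilde_def using algebraic_sqrt_2_mult by blast+
qed

lemma Rats_C_tilde: "x \<in> \<rat> \<Longrightarrow> complex_of_real x \<in> C_tilde" "x \<in> \<rat> \<Longrightarrow> - complex_of_real x \<in> C_tilde"
  by (auto simp: C_tilde_def intro!: rat_imp_algebraic of_real_Rats)

lemma word_ops_props:
  assumes "U \<in> set (word_ops \<rho> u)"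
  shows "unitary_mat 2 U" "i < 2 \<Longrightarrow> j < 2 \<Longrightarrow> U $$ (i, j) \<in> C_tilde"
proof -
  obtain l a where "U \<in> set (letter_ops \<rho> (l, a))" using assms by auto
  then consider "U = mat2 (cnj tau ^ l) 0 0 1" | "U = mat2 (tau ^ l) 0 0 1" |
    z where "z = circle_elem (\<rho> l) a"
      "U = mat2 (of_real (Re z)) (- of_real (Im z)) (of_real (Im z)) (of_real (Re z))"
    by (auto simp: Let_def)
  note cases = this
  show "unitary_mat 2 U"
    using cases by cases (auto intro!: unitary_diag unitary_rotation simp: norm_power)
  show "U $$ (i, j) \<in> C_tilde" if ij: "i < 2" "j < 2"
  proof -
    show ?thesis
      using cases
    proof cases
      case 3
      then have "Re z \<in> \<rat>" "Im z \<in> \<rat>" using gauss_rat_circle_elem by (auto simp: gauss_rat_def)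
      then show ?thesis using 3 ij Rats_C_tilde by (auto simp: less_2_cases)
    qed (use ij tau_power_C_tilde in \<open>auto simp: less_2_cases\<close>)
  qed
qed

text \<open>For the identity matrices that pad the operator lists: folding over a
  \<open>replicate\<close> becomes a function power.\<close>

lemma one_mat_funpow:
  fixes v :: "complex Matrix.vec"
  shows "v \<in> carrier_vec d \<Longrightarrow> ((\<lambda>v. 1\<^sub>m d *\<^sub>v v) ^^ n) v = v"
  by (induction n) auto

theorem theorem4:
  fixes G :: "('g, 'b) monoid_scheme"
    and S :: "'s set" and \<gamma> :: "'s \<Rightarrow> 'g"
    and K :: "'g set"
    and t :: nat and m :: "nat \<Rightarrow> nat" and r :: "nat \<Rightarrow> nat \<Rightarrow> nat"
    and L :: "(nat \<Rightarrow> (nat \<times> (nat \<Rightarrow> int)) list set) set"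
  assumes "group G"
    and "finite S" and "\<gamma> \<in> S \<rightarrow> carrier G" and "generate G (\<gamma> ` S) = carrier G"
    and "t \<ge> 1" and "\<And>i. i < t \<Longrightarrow> m i \<ge> 1"
    and "subgroup K G" and "finite (rcosets\<^bsub>G\<^esub> K)"
    and "subgroup L (prod_free_prod_abelian t m r)"
    and "\<exists>X. finite X \<and> X \<subseteq> L \<and> generate (prod_free_prod_abelian t m r) X = L"
    and "G\<lparr>carrier := K\<rparr> \<cong> (prod_free_prod_abelian t m r)\<lparr>carrier := L\<rparr>"
  shows "word_problem G S \<gamma> \<in> coN2QCFA (S <+> S) (\<lambda>n. real n) 2 C_tilde"
proof -
  interpret G: group G by fact
  interpret K: subgroup K G by fact
  define \<Sigma> where "\<Sigma> = S <+> S"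
  have fin\<Sigma>: "finite \<Sigma>" using assms(2) by (simp add: \<Sigma>_def)
  let ?H = "\<lambda>i j. int_power_group (r i j)"
  let ?FP = "\<lambda>i. free_product {..<m i} (?H i)"
  let ?R = "\<lambda>i. fp_rel {..<m i} (?H i)"
  let ?W = "\<lambda>i. fp_words {..<m i} (?H i)"
  define P where "P = prod_free_prod_abelian t m r"
  have P_eq: "P = product_group {..<t} ?FP" by (simp add: P_def prod_free_prod_abelian_def)
  have gFP: "group (?FP i)" for i by (rule group_free_product[OF group_int_power_group])
  interpret P: group P unfolding P_eq by (rule product_group[OF gFP])
  interpret L: subgroup L P using assms(9) by (simp add: P_def)
  obtain \<phi> where \<phi>: "\<phi> \<in> iso (G\<lparr>carrier := K\<rparr>) (P\<lparr>carrier := L\<rparr>)"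
    using assms(11) unfolding is_iso_def P_def by blast
  have \<phi>_mult: "\<phi> (k \<otimes>\<^bsub>G\<^esub> k') = \<phi> k \<otimes>\<^bsub>P\<^esub> \<phi> k'" and \<phi>_car: "\<phi> k \<in> carrier P"
    if "k \<in> K" "k' \<in> K" for k k'
    using \<phi> that L.subset by (auto simp: iso_def hom_def)
  have inj\<phi>: "inj_on \<phi> K" using \<phi> by (auto simp: iso_def bij_betw_def)
  have \<phi>_one: "\<phi> \<one>\<^bsub>G\<^esub> = \<one>\<^bsub>P\<^esub>"
  proof -
    have "\<phi> \<one>\<^bsub>G\<^esub> \<otimes>\<^bsub>P\<^esub> \<phi> \<one>\<^bsub>G\<^esub> = \<phi> \<one>\<^bsub>G\<^esub>"
      using \<phi>_mult[of "\<one>\<^bsub>G\<^esub>" "\<one>\<^bsub>G\<^esub>"] by simp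
    then show ?thesis using \<phi>_car[of "\<one>\<^bsub>G\<^esub>" "\<one>\<^bsub>G\<^esub>"] P.l_cancel_one by simp
  qed

  define val where "val = word_val G \<gamma>"
  have lv: "letter_val G \<gamma> x \<in> carrier G" if "x \<in> \<Sigma>" for x
    using that assms(3) by (auto simp: \<Sigma>_def letter_val_def Pi_iff)
  have val_Cons: "val (x # w) = letter_val G \<gamma> x \<otimes>\<^bsub>G\<^esub> val w" for x w by (simp add: val_def word_val_def)
  have val_Nil: "val [] = \<one>\<^bsub>G\<^esub>" by (simp add: val_def word_val_def)
  have val_car: "val w \<in> carrier G" if "w \<in> lists \<Sigma>" for w
    using that by induction (auto simp: val_Cons val_Nil lv)

  \<comment> \<open>Right cosets and Schreier elements\<close>
  define Q where "Q = rcosets\<^bsub>G\<^esub> K"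
  obtain enc where enc: "bij_betw enc Q {..<card Q}"
    using ex_bij_betw_finite_nat[of Q] assms(8) by (auto simp: Q_def lessThan_atLeast0)
  define dec where "dec = inv_into Q enc"
  have dec_enc: "dec (enc C) = C" and enc_less: "enc C < card Q" if "C \<in> Q" for C
    using enc that by (auto simp: dec_def bij_betw_def)
  have dec_Q: "dec n \<in> Q" and enc_dec: "enc (dec n) = n" if "n < card Q" for n
    using enc that by (auto simp: dec_def bij_betw_def inv_into_into f_inv_into_f)
  have KQ: "K \<in> Q" unfolding Q_def by (rule K.subgroup_in_rcosets[OF assms(1)])
  have Q_sub: "C \<subseteq> carrier G" if "C \<in> Q" for C
    using that K.subset by (auto simp: Q_def RCOSETS_def r_coset_def)
  \<comment> \<open>With the identity as representative of \<open>K\<close>, an element of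
    \<open>K\<close> is its own Schreier element at \<open>K\<close>.\<close>
  define rep where "rep = (\<lambda>C. if C = K then \<one>\<^bsub>G\<^esub> else SOME g. g \<in> C)"
  have rep_in: "rep C \<in> C" if C: "C \<in> Q" for C
  proof -
    obtain a where "a \<in> carrier G" "C = K #>\<^bsub>G\<^esub> a" using C by (auto simp: Q_def RCOSETS_def)
    then have "a \<in> C" using G.rcos_self assms(7) by blast
    then show ?thesis by (auto simp: rep_def intro: someI)
  qed
  have rep_car: "rep C \<in> carrier G" if "C \<in> Q" for C using rep_in Q_sub that by blast
  have rep_coset: "K #>\<^bsub>G\<^esub> rep C = C" if C: "C \<in> Q" for C
  proof -
    obtain a where "a \<in> carrier G" "C = K #>\<^bsub>G\<^esub> a" using C by (auto simp: Q_def RCOSETS_def)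
    then show ?thesis using rep_in[OF C] G.repr_independence[OF _ _ assms(7)] by auto
  qed
  have Q_coset: "K #>\<^bsub>G\<^esub> a \<in> Q" if "a \<in> carrier G" for a
    using that by (auto simp: Q_def RCOSETS_def)
  have coset_mult: "C #>\<^bsub>G\<^esub> g \<in> Q" "(C #>\<^bsub>G\<^esub> g) = K #>\<^bsub>G\<^esub> (rep C \<otimes>\<^bsub>G\<^esub> g)"
    if "C \<in> Q" "g \<in> carrier G" for C g
  proof -
    have "(K #>\<^bsub>G\<^esub> rep C) #>\<^bsub>G\<^esub> g = K #>\<^bsub>G\<^esub> (rep C \<otimes>\<^bsub>G\<^esub> g)"
      using that rep_car K.subset by (intro G.coset_mult_assoc) auto
    then show "(C #>\<^bsub>G\<^esub> g) = K #>\<^bsub>G\<^esub> (rep C \<otimes>\<^bsub>G\<^esub> g)" using rep_coset that by simp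
    then show "C #>\<^bsub>G\<^esub> g \<in> Q" using that rep_car by (simp add: Q_coset)
  qed
  define tr where "tr = (\<lambda>C g. rep C \<otimes>\<^bsub>G\<^esub> g \<otimes>\<^bsub>G\<^esub> inv\<^bsub>G\<^esub> (rep (C #>\<^bsub>G\<^esub> g)))"
  have tr_K: "tr C g \<in> K" if C: "C \<in> Q" and g: "g \<in> carrier G" for C g
  proof -
    have "rep (C #>\<^bsub>G\<^esub> g) \<in> K #>\<^bsub>G\<^esub> (rep C \<otimes>\<^bsub>G\<^esub> g)"
      using rep_in[OF coset_mult(1)[OF that]] coset_mult(2)[OF that] by simp
    then obtain k where k: "k \<in> K" "rep (C #>\<^bsub>G\<^esub> g) = k \<otimes>\<^bsub>G\<^esub> (rep C \<otimes>\<^bsub>G\<^esub> g)"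
      by (auto simp: r_coset_def)
    have "tr C g = inv\<^bsub>G\<^esub> k"
      unfolding tr_def k(2) using k(1) rep_car[OF C] g by (simp add: G.inv_mult_group G.m_assoc[symmetric]) (simp add: G.m_assoc)
    then show ?thesis using k(1) by simp
  qed
  \<comment> \<open>Cocycle identity: the representative of the intermediate coset cancels, so
    reading a word multiplies the Schreier elements of its letters.\<close>
  have tr_mult: "tr C (g \<otimes>\<^bsub>G\<^esub> h) = tr C g \<otimes>\<^bsub>G\<^esub> tr (C #>\<^bsub>G\<^esub> g) h"
    if C: "C \<in> Q" and g: "g \<in> carrier G" and h: "h \<in> carrier G" for C g h
  proof -
    have "C #>\<^bsub>G\<^esub> (g \<otimes>\<^bsub>G\<^esub> h) = (C #>\<^bsub>G\<^esub> g) #>\<^bsub>G\<^esub> h"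
      using G.coset_mult_assoc[OF Q_sub[OF C] g h] by simp
    moreover have "rep (C #>\<^bsub>G\<^esub> g) \<in> carrier G" "rep ((C #>\<^bsub>G\<^esub> g) #>\<^bsub>G\<^esub> h) \<in> carrier G"
      using rep_car coset_mult(1) that by blast+
    ultimately show ?thesis unfolding tr_def using rep_car[OF C] g h
      by (simp add: G.m_assoc G.inv_solve_left' flip: G.m_assoc) (simp add: G.m_assoc)
  qed

  \<comment> \<open>Operators attached to a coset and a letter\<close>
  define wd where "wd = (\<lambda>i k. SOME u. u \<in> ?W i \<and> ?R i `` {u} = \<phi> k i)"
  have wd: "wd i k \<in> ?W i" "?R i `` {wd i k} = \<phi> k i" if "i < t" "k \<in> K" for i k
  proof -
    have "\<phi> k i \<in> carrier (?FP i)" using \<phi>_car[OF that(2) that(2)] that(1) by (auto simp: P_eq)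
    then have "\<exists>u. u \<in> ?W i \<and> ?R i `` {u} = \<phi> k i" by (auto simp: free_product_def elim!: quotientE)
    from someI_ex[OF this] show "wd i k \<in> ?W i" "?R i `` {wd i k} = \<phi> k i" by (auto simp: wd_def)
  qed
  have \<phi>_mult_nth: "\<phi> (k \<otimes>\<^bsub>G\<^esub> k') i = \<phi> k i \<otimes>\<^bsub>?FP i\<^esub> \<phi> k' i" if "i < t" "k \<in> K" "k' \<in> K" for i k k'
    using \<phi>_mult[OF that(2,3)] that(1) by (simp add: P_eq)

  define lw where "lw = (\<lambda>i c x. wd i (tr (dec c) (letter_val G \<gamma> x)))"
  \<comment> \<open>\<open>insert 0\<close> keeps the maximum meaningful when the alphabet is
    empty.\<close>
  define J where "J = Max (insert 0 ((\<lambda>(i, c, x). length (word_ops (r i) (lw i c x))) ` ({..<t} \<times> {..<card Q} \<times> \<Sigma>)))"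
  define ops where "ops = (\<lambda>i c x. word_ops (r i) (lw i c x) @ replicate (J - length (word_ops (r i) (lw i c x))) (1\<^sub>m 2))"
  define \<delta> where "\<delta> = (\<lambda>c x. enc (dec c #>\<^bsub>G\<^esub> letter_val G \<gamma> x))"

  interpret A: pass_automaton \<Sigma> t "card Q" J "enc K" \<delta> ops "{enc K}"
  proof
    show "finite \<Sigma>" by (rule fin\<Sigma>)
    show "enc K < card Q" by (rule enc_less[OF KQ])
    show "\<delta> c x < card Q" if "c < card Q" "x \<in> \<Sigma>" for c x
      unfolding \<delta>_def using that by (intro enc_less coset_mult(1) dec_Q lv)
    show "length (ops i c x) = J" if "i < t" "c < card Q" "x \<in> \<Sigma>" for i c x
    proof -
      have "length (word_ops (r i) (lw i c x)) \<le> J"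
        unfolding J_def using fin\<Sigma> that by (intro Max_ge) force+
      then show ?thesis by (simp add: ops_def)
    qed
    show "unitary_mat 2 U" if "U \<in> set (ops i c x)" for i c x U
      using that word_ops_props(1)[of U "r i" "lw i c x"] unitary_mat_one[of 2]
      unfolding ops_def set_append by (auto simp del: set_concat)
    show "U $$ (a, b) \<in> C_tilde" if "U \<in> set (ops i c x)" "a < 2" "b < 2" for i c x U a b
      using that word_ops_props(2)[of U "r i" "lw i c x" a b]
      unfolding ops_def set_append by (auto simp del: set_concat)
  qed

  \<comment> \<open>Start coset and register are arbitrary for the induction. Only the class of
    \<open>u\<close> is determined by \<open>\<phi>\<close>; \<open>u\<close> itself is a
    concatenation of chosen words, hence the existential form.\<close>
  have evolve: "\<exists>u. u \<in> ?W i \<and> ?R i `` {u} = \<phi> (tr (dec c) (val w)) i \<and>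
      A.evolve i c (vec2 s) w = (enc (dec c #>\<^bsub>G\<^esub> val w), vec2 (fold (letter_act (r i)) u s))"
    if "i < t" "w \<in> lists \<Sigma>" "c < card Q" for i w c s
    using that(2,3)
  proof (induction w arbitrary: c s)
    case Nil
    have C: "dec c \<in> Q" by (rule dec_Q[OF Nil])
    have 1: "dec c #>\<^bsub>G\<^esub> \<one>\<^bsub>G\<^esub> = dec c" using G.coset_mult_one Q_sub[OF C] by simp
    have "tr (dec c) \<one>\<^bsub>G\<^esub> = \<one>\<^bsub>G\<^esub>" using rep_car[OF C] by (simp add: tr_def 1)
    then have "\<phi> (tr (dec c) (val [])) i = \<one>\<^bsub>P\<^esub> i" by (simp add: val_Nil \<phi>_one)
    also have "\<dots> = ?R i `` {[]}" using that(1) by (simp add: P_eq free_product_def)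
    finally show ?case using enc_dec[OF Nil] by (intro exI[of _ "[]"]) (auto simp: val_Nil 1)
  next
    case (Cons x w)
    let ?g = "letter_val G \<gamma> x" and ?C = "dec c"
    have g: "?g \<in> carrier G" by (rule lv[OF Cons.hyps(1)])
    have h: "val w \<in> carrier G" by (rule val_car[OF Cons.hyps(2)])
    have C: "?C \<in> Q" by (rule dec_Q[OF Cons.prems])
    have C': "?C #>\<^bsub>G\<^esub> ?g \<in> Q" by (rule coset_mult(1)[OF C g])
    let ?u = "lw i c x"
    have lw: "?u \<in> ?W i" "?R i `` {?u} = \<phi> (tr ?C ?g) i"
      unfolding lw_def using wd[OF that(1) tr_K[OF C g]] by auto
    obtain u where u: "u \<in> ?W i" "?R i `` {u} = \<phi> (tr (dec (\<delta> c x)) (val w)) i"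
      "A.evolve i (\<delta> c x) (vec2 (fold (letter_act (r i)) ?u s)) w =
        (enc (dec (\<delta> c x) #>\<^bsub>G\<^esub> val w), vec2 (fold (letter_act (r i)) u (fold (letter_act (r i)) ?u s)))"
      using Cons.IH[of "\<delta> c x" "fold (letter_act (r i)) ?u s"] A.\<delta>[OF Cons.prems Cons.hyps(1)] by blast
    have d: "dec (\<delta> c x) = ?C #>\<^bsub>G\<^esub> ?g" by (simp add: \<delta>_def dec_enc[OF C'])
    have ap: "apply_ops (ops i c x) (vec2 s) = vec2 (fold (letter_act (r i)) ?u s)"
      by (simp add: ops_def apply_word_ops one_mat_funpow del: letter_act.simps)
    have "\<phi> (tr ?C (val (x # w))) i = \<phi> (tr ?C ?g) i \<otimes>\<^bsub>?FP i\<^esub> \<phi> (tr (?C #>\<^bsub>G\<^esub> ?g) (val w)) i"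
      unfolding val_Cons tr_mult[OF C g h] by (rule \<phi>_mult_nth[OF that(1) tr_K[OF C g] tr_K[OF C' h]])
    also have "\<dots> = ?R i `` {?u @ u}"
      unfolding lw(2)[symmetric] u(2)[unfolded d, symmetric]
      by (rule free_product_mult[OF group_int_power_group lw(1) u(1)])
    finally have "?R i `` {?u @ u} = \<phi> (tr ?C (val (x # w))) i" by simp
    moreover have "?u @ u \<in> ?W i" using lw(1) u(1) by simp
    moreover have "(?C #>\<^bsub>G\<^esub> ?g) #>\<^bsub>G\<^esub> val w = ?C #>\<^bsub>G\<^esub> val (x # w)"
      unfolding val_Cons by (rule G.coset_mult_assoc[OF Q_sub[OF C] g h])
    ultimately show ?case
      using u(3) by (intro exI[of _ "?u @ u"]) (simp add: ap d)
  qed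

  \<comment> \<open>The accepted words are those of trivial value\<close>
  have "word_problem G S \<gamma> = A.language"
  proof -
    have "w \<in> A.language \<longleftrightarrow> val w = \<one>\<^bsub>G\<^esub>" if w: "w \<in> lists \<Sigma>" for w
    proof -
      have h: "val w \<in> carrier G" by (rule val_car[OF w])
      have e0: "unit_vec 2 0 = vec2 (1, 0)" by (rule eq_vecI) (auto simp: vec2_def)
      have KK: "dec (enc K) = K" by (rule dec_enc[OF KQ])
      have Kw: "K #>\<^bsub>G\<^esub> val w \<in> Q" by (rule coset_mult(1)[OF KQ h])
      have tr_w: "tr K (val w) = val w" if "val w \<in> K"
        using that h G.coset_join2[OF h assms(7) that] by (simp add: tr_def rep_def)
      \<comment> \<open>At least one pass takes place, so the final coset is tested and membership
        in \<open>K\<close> can be read off.\<close>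
      have t0: "0 < t" using assms(5) by simp
      have key: "fst (A.evolve i (enc K) (unit_vec 2 0) w) = enc K \<and>
          snd (A.evolve i (enc K) (unit_vec 2 0) w) $ 1 = 0 \<longleftrightarrow>
        val w \<in> K \<and> \<phi> (val w) i = \<one>\<^bsub>P\<^esub> i" if i: "i < t" for i
      proof -
        obtain u where u: "u \<in> ?W i" "?R i `` {u} = \<phi> (tr K (val w)) i"
          "A.evolve i (enc K) (vec2 (1, 0)) w = (enc (K #>\<^bsub>G\<^esub> val w), vec2 (fold (letter_act (r i)) u (1, 0)))"
          using evolve[OF i w enc_less[OF KQ], of "(1, 0)"] unfolding KK by blast
        have "enc (K #>\<^bsub>G\<^esub> val w) = enc K \<longleftrightarrow> K #>\<^bsub>G\<^esub> val w = K"
          using dec_enc[OF Kw] KK by metis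
        also have "\<dots> \<longleftrightarrow> val w \<in> K"
          using G.coset_join1[OF _ h assms(7)] G.coset_join2[OF h assms(7)] K.subset by blast
        finally have 1: "enc (K #>\<^bsub>G\<^esub> val w) = enc K \<longleftrightarrow> val w \<in> K" .
        have "snd (fold (letter_act (r i)) u (1, 0)) = 0 \<longleftrightarrow> (u, []) \<in> ?R i"
          by (rule letter_act_faithful[OF u(1)])
        also have "\<dots> \<longleftrightarrow> ?R i `` {u} = ?R i `` {[]}"
          using eq_equiv_class_iff[OF equiv_fp_rel[OF group_int_power_group] u(1), of "[]"] by simp
        also have "\<dots> \<longleftrightarrow> \<phi> (tr K (val w)) i = \<one>\<^bsub>P\<^esub> i"
          using i by (simp add: u(2) P_eq free_product_def)
        finally have 2: "snd (fold (letter_act (r i)) u (1, 0)) = 0 \<longleftrightarrow> \<phi> (tr K (val w)) i = \<one>\<^bsub>P\<^esub> i" .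
        \<comment> \<open>Outside \<open>K\<close> both sides fail by the coset test; inside
          \<open>K\<close> the Schreier element at \<open>K\<close> is \<open>val w\<close>
          itself.\<close>
        show ?thesis unfolding e0 u(3)
          by (cases "val w \<in> K") (simp_all add: 1 2 tr_w)
      qed
      have "w \<in> A.language \<longleftrightarrow> (\<forall>i<t. val w \<in> K \<and> \<phi> (val w) i = \<one>\<^bsub>P\<^esub> i)"
        using w key by (simp add: A.language_def)
      also have "\<dots> \<longleftrightarrow> val w \<in> K \<and> (\<forall>i<t. \<phi> (val w) i = \<one>\<^bsub>P\<^esub> i)"
        using t0 by blast
      also have "\<dots> \<longleftrightarrow> val w \<in> K \<and> \<phi> (val w) = \<one>\<^bsub>P\<^esub>"
      proof (rule conj_cong[OF refl])
        assume "val w \<in> K"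
        then have "\<phi> (val w) \<in> carrier P" using \<phi>_car by blast
        then show "(\<forall>i<t. \<phi> (val w) i = \<one>\<^bsub>P\<^esub> i) \<longleftrightarrow> \<phi> (val w) = \<one>\<^bsub>P\<^esub>"
          by (auto simp: P_eq fun_eq_iff PiE_def extensional_def)
      qed
      also have "\<dots> \<longleftrightarrow> val w = \<one>\<^bsub>G\<^esub>"
        using inj_onD[OF inj\<phi>, of "val w" "\<one>\<^bsub>G\<^esub>"] \<phi>_one by auto
      finally show ?thesis .
    qed
    moreover have "A.language \<subseteq> lists \<Sigma>" by (auto simp: A.language_def)
    ultimately show ?thesis by (auto simp: word_problem_def val_def \<Sigma>_def)
  qed
  then show ?thesis using A.language_in_coN2QCFA by (simp add: \<Sigma>_def)
qed

end
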